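(* Let $G$ be a finite group acting on a Frobenius cyclic poset $(\mathcal{X},\mathcal{X}_0)$, let $R=\mathbb{C}[[t]]$ and $\mathcal{F}=\mathcal{F}(\mathcal{X},\mathcal{X}_0)$. Then every object of the Frobenius category $\mathcal{F}^G$ is isomorphic to a direct sum of strongly indecomposable objects of the form $S_\rho X$ where $X\in\mathcal{X}$ and $\rho$ is an irreducible complex representation of $H_X=\{\beta\in G\mid\beta X\cong X\}$. Furthermore, two such objects $S_\lambda X$, $S_\mu Y$ are isomorphic if and only if there is some $\gamma\in G$ so that (1) $Y\cong\gamma X$ (in particular, $H_Y=\gamma H_X\gamma^{-1}$), and (2) $\lambda$ is conjugate (equivalent as a representation) to the composition of $\mu$ with the isomorphism $H_X\to\gamma H_X\gamma^{-1}$ given by conjugation with $\gamma$.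
   Context: A reduced cocycle on a set $\mathcal{X}$ is a function $c:\mathcal{X}^3\to\mathbb{N}=\{0,1,2,\dots\}$ with $c(X,Y,Z)-c(W,Y,Z)+c(W,X,Z)-c(W,X,Y)=0$ and $c(X,X,Y)=0=c(X,Y,Y)$ for all $W,X,Y,Z\in\mathcal{X}$. A cyclic poset is a set with a reduced cocycle. Given a cyclic poset $(\mathcal{X},c)$ and a discrete valuation ring $R$ with uniformizer $u$ (here $R=\mathbb{C}[[t]]$, $u=t$), $\mathcal{P}(\mathcal{X})$ is the $R$-category with object set $\mathcal{X}$, in which each $\mathrm{Hom}(X,Y)$ is a free $R$-module of rank one on a generator $f_{XY}$ (the basic morphism), with $f_{XX}=\mathrm{id}$ and $f_{YZ}\circ f_{XY}=u^{c(X,Y,Z)}f_{XZ}$. Let $\operatorname{add}\mathcal{P}(\mathcal{X})$ be the additive category of finite (ordered) direct sums of objects of $\mathcal{X}$. Two elements $X,Y\in\mathcal{X}$ are isomorphic iff $c(X,Y,X)=0$. Let $\mathcal{X}_0\subseteq\mathcal{X}$ be closed under isomorphism. The pair $(\mathcal{X},\mathcal{X}_0)$ is a Frobenius cyclic poset if, for every choice of $(R,u)$, $\operatorname{add}\mathcal{P}(\mathcal{X})$ admits the (necessarily unique) structure of a Frobenius category with $\mathcal{X}_0$ the set of indecomposable projective-injective objects; this Frobenius category is denoted $\mathcal{F}(\mathcal{X},\mathcal{X}_0)$. An action of $G$ on $(\mathcal{X},\mathcal{X}_0)$ is an action of $G$ on the set $\mathcal{X}$ with $c(\gamma X,\gamma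 Y,\gamma Z)=c(X,Y,Z)$ and $\gamma\mathcal{X}_0=\mathcal{X}_0$ for all $\gamma\in G$. It induces an $R$-linear action of $G$ on $\mathcal{F}$ with $\gamma(\bigoplus X_i)=\bigoplus\gamma X_i$ and $\gamma f_{XY}=f_{\gamma X,\gamma Y}$. The category $\mathcal{F}^G$: objects are pairs $(X,\xi)$ with $X\in\mathcal{F}$ and $\xi$ a family of isomorphisms $\xi_\gamma:\gamma X\to X$ ($\gamma\in G$) such that $\xi_{\alpha\beta}=\xi_\alpha\circ\alpha\xi_\beta$ for all $\alpha,\beta\in G$; a morphism $(X,\xi^X)\to(Y,\xi^Y)$ is a morphism $f:X\to Y$ in $\mathcal{F}$ with $f\circ\xi^X_\gamma=\xi^Y_\gamma\circ\gamma f$ for all $\gamma$; exact sequences are those whose underlying sequence in $\mathcal{F}$ is exact. $\mathcal{F}^G$ is a Frobenius category. The object $S_\rho X$: let $X\in\mathcal{X}$, $H=H_X$, and $\rho:H\to GL(d,\mathbb{C})\subset GL(d,R)$ a representation. Choose representatives $\sigma_i$ of the left cosets of $H$ in $G$. Then $S_\rho X=(\bigoplus_i\sigma_iX^d,\xi)$ where, for $\gamma\in G$, writing $\gamma\sigma_i=\sigma_j\eta_j(\gamma)$ with $\eta_j(\gamma)\in H$, the component $\gamma\sigma_iX^d\to\sigma_jX^d$ of $\xi_\gamma$ is the morphism with $d\times d$ matrix $\rho(\eta_j(\gamma))$ (entries being the coefficients of the basic isomorphism $\gamma\sigma_iX\to\sigma_jX$), and all other components are zero. An object is strongly indecomposable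 if its endomorphism ring is local. *)

theory Defs
  imports
    "HOL-Algebra.Group_Action"
    "HOL-Algebra.Ring_Divisibility"
    "HOL-Computational_Algebra.Formal_Power_Series"
    "Jordan_Normal_Form.VS_Connect"
begin

section \<open>Preadditive categories\<close>

text \<open>
  \<open>Comp C g f\<close> is the composite "\<open>g\<close> after \<open>f\<close>". Hom-sets for different pairs of objects need
  not be disjoint, so source and target are passed along explicitly wherever they matter.
\<close>

record ('o, 'm) preadd_cat =
  Ob :: "'o set"
  Hom :: "'o \<Rightarrow> 'o \<Rightarrow> 'm set"
  Comp :: "'m \<Rightarrow> 'm \<Rightarrow> 'm"
  Idn :: "'o \<Rightarrow> 'm"
  Zer :: "'o \<Rightarrow> 'o \<Rightarrow> 'm"
  Add :: "'m \<Rightarrow> 'm \<Rightarrow> 'm"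

definition hom_group :: "('o, 'm) preadd_cat \<Rightarrow> 'o \<Rightarrow> 'o \<Rightarrow> 'm monoid" where
  "hom_group C A B = \<lparr>carrier = Hom C A B, monoid.mult = Add C, one = Zer C A B\<rparr>"

definition preadditive_category :: "('o, 'm) preadd_cat \<Rightarrow> bool" where
  "preadditive_category C \<longleftrightarrow>
     (\<forall>A\<in>Ob C. Idn C A \<in> Hom C A A) \<and>
     (\<forall>A\<in>Ob C. \<forall>B\<in>Ob C. \<forall>D\<in>Ob C. \<forall>f\<in>Hom C A B. \<forall>g\<in>Hom C B D. Comp C g f \<in> Hom C A D) \<and>
     (\<forall>A\<in>Ob C. \<forall>B\<in>Ob C. \<forall>f\<in>Hom C A B. Comp C f (Idn C A) = f \<and> Comp C (Idn C B) f = f) \<and>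
     (\<forall>A\<in>Ob C. \<forall>B\<in>Ob C. \<forall>D\<in>Ob C. \<forall>E\<in>Ob C. \<forall>f\<in>Hom C A B. \<forall>g\<in>Hom C B D. \<forall>h\<in>Hom C D E.
        Comp C h (Comp C g f) = Comp C (Comp C h g) f) \<and>
     (\<forall>A\<in>Ob C. \<forall>B\<in>Ob C. comm_group (hom_group C A B)) \<and>
     (\<forall>A\<in>Ob C. \<forall>B\<in>Ob C. \<forall>D\<in>Ob C. \<forall>f\<in>Hom C A B. \<forall>f'\<in>Hom C A B. \<forall>g\<in>Hom C B D. \<forall>g'\<in>Hom C B D.
        Comp C g (Add C f f') = Add C (Comp C g f) (Comp C g f') \<and>
        Comp C (Add C g g') f = Add C (Comp C g f) (Comp C g' f))"

definition isomorphism :: "('o, 'm) preadd_cat \<Rightarrow> 'o \<Rightarrow> 'o \<Rightarrow> 'm \<Rightarrow> bool" where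
  "isomorphism C A B f \<longleftrightarrow> f \<in> Hom C A B \<and>
     (\<exists>g\<in>Hom C B A. Comp C g f = Idn C A \<and> Comp C f g = Idn C B)"

definition isomorphic :: "('o, 'm) preadd_cat \<Rightarrow> 'o \<Rightarrow> 'o \<Rightarrow> bool" where
  "isomorphic C A B \<longleftrightarrow> (\<exists>f. isomorphism C A B f)"

definition zero_object :: "('o, 'm) preadd_cat \<Rightarrow> 'o \<Rightarrow> bool" where
  "zero_object C Z \<longleftrightarrow> Z \<in> Ob C \<and> Idn C Z = Zer C Z Z"

text \<open>
  \<open>D\<close> is a direct sum (biproduct) of the objects in the list \<open>As\<close>. For the empty list this says
  that \<open>D\<close> is a zero object.
\<close>

definition is_direct_sum :: "('o, 'm) preadd_cat \<Rightarrow> 'o \<Rightarrow> 'o list \<Rightarrow> bool" where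
  "is_direct_sum C D As \<longleftrightarrow> D \<in> Ob C \<and> set As \<subseteq> Ob C \<and>
     (\<exists>\<iota> \<pi>.
        (\<forall>k<length As. \<iota> k \<in> Hom C (As ! k) D \<and> \<pi> k \<in> Hom C D (As ! k)) \<and>
        (\<forall>k<length As. \<forall>l<length As.
           Comp C (\<pi> k) (\<iota> l) = (if k = l then Idn C (As ! k) else Zer C (As ! l) (As ! k))) \<and>
        foldr (Add C) (map (\<lambda>k. Comp C (\<iota> k) (\<pi> k)) [0..<length As]) (Zer C D D) = Idn C D)"

definition additive_category :: "('o, 'm) preadd_cat \<Rightarrow> bool" where
  "additive_category C \<longleftrightarrow> preadditive_category C \<and>
     (\<forall>As. set As \<subseteq> Ob C \<longrightarrow> (\<exists>D. is_direct_sum C D As))"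

definition indecomposable :: "('o, 'm) preadd_cat \<Rightarrow> 'o \<Rightarrow> bool" where
  "indecomposable C A \<longleftrightarrow> A \<in> Ob C \<and> \<not> zero_object C A \<and>
     (\<forall>B D. is_direct_sum C A [B, D] \<longrightarrow> zero_object C B \<or> zero_object C D)"

definition end_ring :: "('o, 'm) preadd_cat \<Rightarrow> 'o \<Rightarrow> 'm ring" where
  "end_ring C A = \<lparr>carrier = Hom C A A, monoid.mult = Comp C, one = Idn C A, ring.zero = Zer C A A, ring.add = Add C\<rparr>"

text \<open>
  A (not necessarily commutative) ring is local if its non-units form a two-sided ideal. The zero
  ring is excluded: there \<open>0\<close> is a unit and the set of non-units is empty.
\<close>

definition local_ring :: "'m ring \<Rightarrow> bool" where
  "local_ring S \<longleftrightarrow> ideal (carrier S - Units S) S"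

definition strongly_indecomposable :: "('o, 'm) preadd_cat \<Rightarrow> 'o \<Rightarrow> bool" where
  "strongly_indecomposable C A \<longleftrightarrow> A \<in> Ob C \<and> local_ring (end_ring C A)"


section \<open>Exact categories and Frobenius categories\<close>

definition is_kernel :: "('o, 'm) preadd_cat \<Rightarrow> 'o \<Rightarrow> 'm \<Rightarrow> 'o \<Rightarrow> 'm \<Rightarrow> 'o \<Rightarrow> bool" where
  "is_kernel C A i B p D \<longleftrightarrow> Comp C p i = Zer C A D \<and>
     (\<forall>T\<in>Ob C. \<forall>h\<in>Hom C T B. Comp C p h = Zer C T D \<longrightarrow> (\<exists>!k. k \<in> Hom C T A \<and> Comp C i k = h))"

definition is_cokernel :: "('o, 'm) preadd_cat \<Rightarrow> 'o \<Rightarrow> 'm \<Rightarrow> 'o \<Rightarrow> 'm \<Rightarrow> 'o \<Rightarrow> bool" where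
  "is_cokernel C A i B p D \<longleftrightarrow> Comp C p i = Zer C A D \<and>
     (\<forall>T\<in>Ob C. \<forall>h\<in>Hom C B T. Comp C h i = Zer C A T \<longrightarrow> (\<exists>!k. k \<in> Hom C D T \<and> Comp C k p = h))"

definition kernel_cokernel_pair :: "('o, 'm) preadd_cat \<Rightarrow> 'o \<times> 'm \<times> 'o \<times> 'm \<times> 'o \<Rightarrow> bool" where
  "kernel_cokernel_pair C = (\<lambda>(A, i, B, p, D).
     A \<in> Ob C \<and> B \<in> Ob C \<and> D \<in> Ob C \<and> i \<in> Hom C A B \<and> p \<in> Hom C B D \<and>
     is_kernel C A i B p D \<and> is_cokernel C A i B p D)"

text \<open>\<open>E\<close> is the set of short exact sequences \<open>A \<rightarrow> B \<rightarrow> D\<close>, stored as \<open>(A, i, B, p, D)\<close>.\<close>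

type_synonym ('o, 'm) exact_structure = "('o \<times> 'm \<times> 'o \<times> 'm \<times> 'o) set"

definition inflation :: "('o, 'm) exact_structure \<Rightarrow> 'o \<Rightarrow> 'o \<Rightarrow> 'm \<Rightarrow> bool" where
  "inflation E A B i \<longleftrightarrow> (\<exists>p D. (A, i, B, p, D) \<in> E)"

definition deflation :: "('o, 'm) exact_structure \<Rightarrow> 'o \<Rightarrow> 'o \<Rightarrow> 'm \<Rightarrow> bool" where
  "deflation E B D p \<longleftrightarrow> (\<exists>A i. (A, i, B, p, D) \<in> E)"

text \<open>The square with \<open>i : A \<rightarrow> B\<close>, \<open>f : A \<rightarrow> A'\<close>, \<open>i' : A' \<rightarrow> B'\<close>, \<open>f' : B \<rightarrow> B'\<close> is a pushout.\<close>

definition is_pushout ::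
    "('o, 'm) preadd_cat \<Rightarrow> 'o \<Rightarrow> 'o \<Rightarrow> 'o \<Rightarrow> 'o \<Rightarrow> 'm \<Rightarrow> 'm \<Rightarrow> 'm \<Rightarrow> 'm \<Rightarrow> bool" where
  "is_pushout C A B A' B' i f i' f' \<longleftrightarrow> B' \<in> Ob C \<and> i' \<in> Hom C A' B' \<and> f' \<in> Hom C B B' \<and>
     Comp C f' i = Comp C i' f \<and>
     (\<forall>T\<in>Ob C. \<forall>g\<in>Hom C B T. \<forall>h\<in>Hom C A' T. Comp C g i = Comp C h f \<longrightarrow>
        (\<exists>!k. k \<in> Hom C B' T \<and> Comp C k f' = g \<and> Comp C k i' = h))"

text \<open>The square with \<open>p : B \<rightarrow> D\<close>, \<open>f : D' \<rightarrow> D\<close>, \<open>p' : B' \<rightarrow> D'\<close>, \<open>f' : B' \<rightarrow> B\<close> is a pullback.\<close>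

definition is_pullback ::
    "('o, 'm) preadd_cat \<Rightarrow> 'o \<Rightarrow> 'o \<Rightarrow> 'o \<Rightarrow> 'o \<Rightarrow> 'm \<Rightarrow> 'm \<Rightarrow> 'm \<Rightarrow> 'm \<Rightarrow> bool" where
  "is_pullback C B D D' B' p f p' f' \<longleftrightarrow> B' \<in> Ob C \<and> p' \<in> Hom C B' D' \<and> f' \<in> Hom C B' B \<and>
     Comp C p f' = Comp C f p' \<and>
     (\<forall>T\<in>Ob C. \<forall>g\<in>Hom C T B. \<forall>h\<in>Hom C T D'. Comp C p g = Comp C f h \<longrightarrow>
        (\<exists>!k. k \<in> Hom C T B' \<and> Comp C f' k = g \<and> Comp C p' k = h))"

text \<open>Quillen's axioms, in the form given by Keller and Buehler.\<close>

definition exact_category :: "('o, 'm) preadd_cat \<Rightarrow> ('o, 'm) exact_structure \<Rightarrow> bool" where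
  "exact_category C E \<longleftrightarrow> additive_category C \<and>
     (\<forall>S\<in>E. kernel_cokernel_pair C S) \<and>
     (\<forall>A i B p D A' i' B' p' D' a b d. (A, i, B, p, D) \<in> E \<and>
        A' \<in> Ob C \<and> B' \<in> Ob C \<and> D' \<in> Ob C \<and> i' \<in> Hom C A' B' \<and> p' \<in> Hom C B' D' \<and>
        isomorphism C A A' a \<and> isomorphism C B B' b \<and> isomorphism C D D' d \<and>
        Comp C i' a = Comp C b i \<and> Comp C p' b = Comp C d p \<longrightarrow> (A', i', B', p', D') \<in> E) \<and>
     (\<forall>A\<in>Ob C. inflation E A A (Idn C A) \<and> deflation E A A (Idn C A)) \<and>
     (\<forall>A B D i j. inflation E A B i \<and> inflation E B D j \<longrightarrow> inflation E A D (Comp C j i)) \<and>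
     (\<forall>A B D p q. deflation E A B p \<and> deflation E B D q \<longrightarrow> deflation E A D (Comp C q p)) \<and>
     (\<forall>A B i. \<forall>A'\<in>Ob C. \<forall>f\<in>Hom C A A'. inflation E A B i \<longrightarrow>
        (\<exists>B' i' f'. is_pushout C A B A' B' i f i' f' \<and> inflation E A' B' i')) \<and>
     (\<forall>B D p. \<forall>D'\<in>Ob C. \<forall>f\<in>Hom C D' D. deflation E B D p \<longrightarrow>
        (\<exists>B' p' f'. is_pullback C B D D' B' p f p' f' \<and> deflation E B' D' p'))"

definition projective :: "('o, 'm) preadd_cat \<Rightarrow> ('o, 'm) exact_structure \<Rightarrow> 'o \<Rightarrow> bool" where
  "projective C E P \<longleftrightarrow> P \<in> Ob C \<and>
     (\<forall>B D p. deflation E B D p \<longrightarrow> (\<forall>f\<in>Hom C P D. \<exists>g\<in>Hom C P B. Comp C p g = f))"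

definition injective :: "('o, 'm) preadd_cat \<Rightarrow> ('o, 'm) exact_structure \<Rightarrow> 'o \<Rightarrow> bool" where
  "injective C E I \<longleftrightarrow> I \<in> Ob C \<and>
     (\<forall>A B i. inflation E A B i \<longrightarrow> (\<forall>f\<in>Hom C A I. \<exists>g\<in>Hom C B I. Comp C g i = f))"

definition frobenius_category :: "('o, 'm) preadd_cat \<Rightarrow> ('o, 'm) exact_structure \<Rightarrow> bool" where
  "frobenius_category C E \<longleftrightarrow> exact_category C E \<and>
     (\<forall>A\<in>Ob C. \<exists>P p. projective C E P \<and> deflation E P A p) \<and>
     (\<forall>A\<in>Ob C. \<exists>I i. injective C E I \<and> inflation E A I i) \<and>
     (\<forall>A\<in>Ob C. projective C E A \<longleftrightarrow> injective C E A)"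


section \<open>Cyclic posets\<close>

definition cyclic_poset :: "'x set \<Rightarrow> ('x \<Rightarrow> 'x \<Rightarrow> 'x \<Rightarrow> nat) \<Rightarrow> bool" where
  "cyclic_poset \<X> c \<longleftrightarrow>
     (\<forall>W\<in>\<X>. \<forall>X\<in>\<X>. \<forall>Y\<in>\<X>. \<forall>Z\<in>\<X>.
        int (c X Y Z) - int (c W Y Z) + int (c W X Z) - int (c W X Y) = 0) \<and>
     (\<forall>X\<in>\<X>. \<forall>Y\<in>\<X>. c X X Y = 0 \<and> c X Y Y = 0)"

text \<open>
  Isomorphism of elements of a cyclic poset; by \<open>isomorphic_singletons_iff\<close> below this is
  isomorphism of the corresponding objects, over any discrete valuation ring.
\<close>

definition cp_iso :: "('x \<Rightarrow> 'x \<Rightarrow> 'x \<Rightarrow> nat) \<Rightarrow> 'x \<Rightarrow> 'x \<Rightarrow> bool" where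
  "cp_iso c X Y \<longleftrightarrow> c X Y X = 0"

text \<open>
  \<open>R\<close> is a principal ideal domain whose only maximal ideal is the one generated by \<open>u\<close>, and \<open>R\<close> is
  not a field.
\<close>

definition dvr_uniformizer :: "'r ring \<Rightarrow> 'r \<Rightarrow> bool" where
  "dvr_uniformizer R u \<longleftrightarrow> principal_domain R \<and> u \<in> carrier R \<and> u \<noteq> \<zero>\<^bsub>R\<^esub> \<and>
     {M. maximalideal M R} = {PIdl\<^bsub>R\<^esub> u}"

text \<open>
  A morphism from \<open>A = A\<^sub>0 \<oplus> \<dots> \<oplus> A\<^sub>m\<^sub>-\<^sub>1\<close> to \<open>B = B\<^sub>0 \<oplus> \<dots> \<oplus> B\<^sub>n\<^sub>-\<^sub>1\<close> is stored as \<open>(A, B, M)\<close> with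
  an \<open>n \<times> m\<close> matrix \<open>M\<close> over \<open>R\<close>, whose entry at \<open>(k, i)\<close> is the coefficient of the basic morphism
  from \<open>A\<^sub>i\<close> to \<open>B\<^sub>k\<close>.
\<close>

type_synonym ('x, 'r) cp_mor = "'x list \<times> 'x list \<times> 'r mat"

definition cp_comp :: "'r ring \<Rightarrow> 'r \<Rightarrow> ('x \<Rightarrow> 'x \<Rightarrow> 'x \<Rightarrow> nat) \<Rightarrow>
    ('x, 'r) cp_mor \<Rightarrow> ('x, 'r) cp_mor \<Rightarrow> ('x, 'r) cp_mor" where
  "cp_comp R u c = (\<lambda>(B', D, N) (A, B, M). (A, D, mat (length D) (length A) (\<lambda>(k, i).
     \<Oplus>\<^bsub>R\<^esub>j\<in>{..<length B}. N $$ (k, j) \<otimes>\<^bsub>R\<^esub> M $$ (j, i) \<otimes>\<^bsub>R\<^esub> (u [^]\<^bsub>R\<^esub> c (A ! i) (B ! j) (D ! k)))))"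

definition add_P :: "'r ring \<Rightarrow> 'r \<Rightarrow> 'x set \<Rightarrow> ('x \<Rightarrow> 'x \<Rightarrow> 'x \<Rightarrow> nat) \<Rightarrow>
    ('x list, ('x, 'r) cp_mor) preadd_cat" where
  "add_P R u \<X> c = \<lparr>
     Ob = lists \<X>,
     Hom = (\<lambda>A B. {(A, B, M) | M. M \<in> carrier_mat (length B) (length A) \<and> elements_mat M \<subseteq> carrier R}),
     Comp = cp_comp R u c,
     Idn = (\<lambda>A. (A, A, mat (length A) (length A) (\<lambda>(k, i). if k = i then \<one>\<^bsub>R\<^esub> else \<zero>\<^bsub>R\<^esub>))),
     Zer = (\<lambda>A B. (A, B, mat (length B) (length A) (\<lambda>_. \<zero>\<^bsub>R\<^esub>))),
     Add = (\<lambda>(A, B, M) (A', B', N). (A, B, mat (length B) (length A) (\<lambda>x. M $$ x \<oplus>\<^bsub>R\<^esub> N $$ x)))\<rparr>"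

lemma cp_comp_singleton:
  assumes "cring R" "u \<in> carrier R" "M \<in> carrier_mat 1 1" "elements_mat M \<subseteq> carrier R"
    "N \<in> carrier_mat 1 1" "elements_mat N \<subseteq> carrier R"
  shows "cp_comp R u c ([Y], [Z], N) ([X], [Y], M) =
    ([X], [Z], mat 1 1 (\<lambda>_. N $$ (0, 0) \<otimes>\<^bsub>R\<^esub> M $$ (0, 0) \<otimes>\<^bsub>R\<^esub> (u [^]\<^bsub>R\<^esub> c X Y Z)))"
proof -
  interpret cring R by fact
  have m: "M $$ (0, 0) \<in> carrier R" "N $$ (0, 0) \<in> carrier R"
    using assms by (auto simp: elements_mat_def)
  have "finsum R f {..<length [Y]} = f 0" if "f 0 \<in> carrier R" for f
    using that by (simp add: lessThan_Suc)
  from this[of "\<lambda>j. N $$ (0, j) \<otimes>\<^bsub>R\<^esub> M $$ (j, 0) \<otimes>\<^bsub>R\<^esub> (u [^]\<^bsub>R\<^esub> c X ([Y] ! j) Z)"]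
  show ?thesis
    using m assms(2) unfolding cp_comp_def by (simp, intro eq_matI) simp_all
qed

lemma isomorphic_singletons_iff:
  assumes c: "cyclic_poset \<X> c" and X: "X \<in> \<X>" and Y: "Y \<in> \<X>" and d: "dvr_uniformizer R u"
  shows "isomorphic (add_P R u \<X> c) [X] [Y] \<longleftrightarrow> cp_iso c X Y"
proof -
  interpret principal_domain R using d by (simp add: dvr_uniformizer_def)
  have u: "u \<in> carrier R" using d by (simp add: dvr_uniformizer_def)
  have max: "maximalideal (PIdl\<^bsub>R\<^esub> u) R" using d by (auto simp: dvr_uniformizer_def)
  have R: "cring R" by (rule is_cring)
  let ?C = "add_P R u \<X> c"
  show ?thesis
  proof
    assume "isomorphic ?C [X] [Y]"
    then obtain f g where fg: "f \<in> Hom ?C [X] [Y]" "g \<in> Hom ?C [Y] [X]" "Comp ?C g f = Idn ?C [X]"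
      by (auto simp: isomorphic_def isomorphism_def)
    then obtain M N where f: "f = ([X], [Y], M)" and g: "g = ([Y], [X], N)"
      and M: "M \<in> carrier_mat 1 1" "elements_mat M \<subseteq> carrier R"
      and N: "N \<in> carrier_mat 1 1" "elements_mat N \<subseteq> carrier R"
      by (auto simp: add_P_def)
    have m: "M $$ (0, 0) \<in> carrier R" "N $$ (0, 0) \<in> carrier R"
      using M N by (auto simp: elements_mat_def)
    have "mat 1 1 (\<lambda>_. N $$ (0, 0) \<otimes>\<^bsub>R\<^esub> M $$ (0, 0) \<otimes>\<^bsub>R\<^esub> (u [^]\<^bsub>R\<^esub> c X Y X)) =
        mat 1 1 (\<lambda>(k, i). if k = i then \<one>\<^bsub>R\<^esub> else \<zero>\<^bsub>R\<^esub>)"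
      using fg(3) cp_comp_singleton[OF R u M N, of c Y X X] by (simp add: add_P_def f g)
    from arg_cong[OF this, of "\<lambda>A. A $$ (0, 0)"]
    have one: "N $$ (0, 0) \<otimes>\<^bsub>R\<^esub> M $$ (0, 0) \<otimes>\<^bsub>R\<^esub> (u [^]\<^bsub>R\<^esub> c X Y X) = \<one>\<^bsub>R\<^esub>" by simp
    show "cp_iso c X Y"
    proof (rule ccontr)
      assume "\<not> cp_iso c X Y"
      then obtain n where n: "c X Y X = Suc n" using not0_implies_Suc unfolding cp_iso_def by blast
      have "\<one>\<^bsub>R\<^esub> = (N $$ (0, 0) \<otimes>\<^bsub>R\<^esub> M $$ (0, 0) \<otimes>\<^bsub>R\<^esub> (u [^]\<^bsub>R\<^esub> n)) \<otimes>\<^bsub>R\<^esub> u"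
        using one m u by (simp add: n m_assoc)
      then have "\<one>\<^bsub>R\<^esub> \<in> PIdl\<^bsub>R\<^esub> u" using m u by (auto simp: cgenideal_def)
      then have "PIdl\<^bsub>R\<^esub> u = carrier R"
        using ideal.one_imp_carrier[OF maximalideal.axioms(1)[OF max]] by simp
      then show False using maximalideal.I_notcarr[OF max] by simp
    qed
  next
    assume iso: "cp_iso c X Y"
    have "int (c X Y X) - int (c Y Y X) + int (c Y X X) - int (c Y X Y) = 0"
      and "c Y Y X = 0" "c Y X X = 0"
      using c X Y unfolding cyclic_poset_def by blast+
    with iso have 0: "c X Y X = 0" "c Y X Y = 0" by (auto simp: cp_iso_def)
    let ?M = "mat 1 1 (\<lambda>_. \<one>\<^bsub>R\<^esub>)"
    have M: "?M \<in> carrier_mat 1 1" "elements_mat ?M \<subseteq> carrier R"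
      by (auto simp: elements_mat_def)
    have id: "mat 1 1 (\<lambda>_. \<one>\<^bsub>R\<^esub>) = mat 1 1 (\<lambda>(k, i). if k = i then \<one>\<^bsub>R\<^esub> else \<zero>\<^bsub>R\<^esub>)"
      by (rule eq_matI) auto
    have "Comp ?C ([Y], [X], ?M) ([X], [Y], ?M) = Idn ?C [X]"
      using cp_comp_singleton[OF R u M M, of c Y X X] 0 id by (simp add: add_P_def)
    moreover have "Comp ?C ([X], [Y], ?M) ([Y], [X], ?M) = Idn ?C [Y]"
      using cp_comp_singleton[OF R u M M, of c X Y Y] 0 id by (simp add: add_P_def)
    moreover have "([X], [Y], ?M) \<in> Hom ?C [X] [Y]" "([Y], [X], ?M) \<in> Hom ?C [Y] [X]"
      using M by (auto simp: add_P_def)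
    ultimately have "isomorphism ?C [X] [Y] ([X], [Y], ?M)"
      unfolding isomorphism_def by blast
    then show "isomorphic ?C [X] [Y]" by (auto simp: isomorphic_def)
  qed
qed

text \<open>
  The discrete valuation ring ranges over all rings with carrier inside the type of complex power
  series, that is, up to isomorphism over all discrete valuation rings of at most continuum
  cardinality (a definition cannot quantify over types).
\<close>

definition frobenius_cyclic_poset :: "'x set \<Rightarrow> ('x \<Rightarrow> 'x \<Rightarrow> 'x \<Rightarrow> nat) \<Rightarrow> 'x set \<Rightarrow> bool" where
  "frobenius_cyclic_poset \<X> c \<X>\<^sub>0 \<longleftrightarrow> cyclic_poset \<X> c \<and> \<X>\<^sub>0 \<subseteq> \<X> \<and>
     (\<forall>X\<in>\<X>\<^sub>0. \<forall>Y\<in>\<X>. cp_iso c X Y \<longrightarrow> Y \<in> \<X>\<^sub>0) \<and>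
     (\<forall>(R :: complex fps ring) u. dvr_uniformizer R u \<longrightarrow>
        (\<exists>E. frobenius_category (add_P R u \<X> c) E \<and>
           {A \<in> Ob (add_P R u \<X> c). indecomposable (add_P R u \<X> c) A \<and>
              projective (add_P R u \<X> c) E A \<and> injective (add_P R u \<X> c) E A} =
           (\<lambda>X. [X]) ` \<X>\<^sub>0))"


section \<open>Group actions and equivariant objects\<close>

definition cyclic_poset_action ::
    "'g monoid \<Rightarrow> ('g \<Rightarrow> 'x \<Rightarrow> 'x) \<Rightarrow> 'x set \<Rightarrow> ('x \<Rightarrow> 'x \<Rightarrow> 'x \<Rightarrow> nat) \<Rightarrow> 'x set \<Rightarrow> bool" where
  "cyclic_poset_action G \<phi> \<X> c \<X>\<^sub>0 \<longleftrightarrow> group_action G \<X> \<phi> \<and>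
     (\<forall>\<gamma>\<in>carrier G. \<forall>X\<in>\<X>. \<forall>Y\<in>\<X>. \<forall>Z\<in>\<X>. c (\<phi> \<gamma> X) (\<phi> \<gamma> Y) (\<phi> \<gamma> Z) = c X Y Z) \<and>
     (\<forall>\<gamma>\<in>carrier G. \<phi> \<gamma> ` \<X>\<^sub>0 = \<X>\<^sub>0)"

definition act_ob :: "('g \<Rightarrow> 'x \<Rightarrow> 'x) \<Rightarrow> 'g \<Rightarrow> 'x list \<Rightarrow> 'x list" where
  "act_ob \<phi> \<gamma> A = map (\<phi> \<gamma>) A"

definition act_mor :: "('g \<Rightarrow> 'x \<Rightarrow> 'x) \<Rightarrow> 'g \<Rightarrow> ('x, 'r) cp_mor \<Rightarrow> ('x, 'r) cp_mor" where
  "act_mor \<phi> \<gamma> = (\<lambda>(A, B, M). (act_ob \<phi> \<gamma> A, act_ob \<phi> \<gamma> B, M))"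

text \<open>
  The category \<open>C\<^sup>G\<close> for an action of \<open>G\<close> on \<open>C\<close> that is given by \<open>aO\<close> on objects and by \<open>aM\<close> on
  morphisms. Its morphisms are represented by the underlying morphisms of \<open>C\<close>.
\<close>

definition equivariant_category :: "'g monoid \<Rightarrow> ('g \<Rightarrow> 'o \<Rightarrow> 'o) \<Rightarrow> ('g \<Rightarrow> 'm \<Rightarrow> 'm) \<Rightarrow>
    ('o, 'm) preadd_cat \<Rightarrow> ('o \<times> ('g \<Rightarrow> 'm), 'm) preadd_cat" where
  "equivariant_category G aO aM C = \<lparr>
     Ob = {(A, \<xi>). A \<in> Ob C \<and> \<xi> \<in> (\<Pi>\<^sub>E \<gamma>\<in>carrier G. {f. isomorphism C (aO \<gamma> A) A f}) \<and>
            (\<forall>\<alpha>\<in>carrier G. \<forall>\<beta>\<in>carrier G. \<xi> (\<alpha> \<otimes>\<^bsub>G\<^esub> \<beta>) = Comp C (\<xi> \<alpha>) (aM \<alpha> (\<xi> \<beta>)))},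
     Hom = (\<lambda>(A, \<xi>) (B, \<zeta>). {f \<in> Hom C A B. \<forall>\<gamma>\<in>carrier G. Comp C f (\<xi> \<gamma>) = Comp C (\<zeta> \<gamma>) (aM \<gamma> f)}),
     Comp = Comp C,
     Idn = (\<lambda>P. Idn C (fst P)),
     Zer = (\<lambda>P Q. Zer C (fst P) (fst Q)),
     Add = Add C\<rparr>"

text \<open>
  The additive category underlying \<open>\<F>(\<X>, \<X>\<^sub>0)\<close> over the power series ring, and its category
  of \<open>G\<close>-equivariant objects.
\<close>

abbreviation \<F> :: "'x set \<Rightarrow> ('x \<Rightarrow> 'x \<Rightarrow> 'x \<Rightarrow> nat) \<Rightarrow>
    ('x list, ('x, complex fps) cp_mor) preadd_cat" where
  "\<F> \<X> c \<equiv> add_P class_ring fps_X \<X> c"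

definition \<F>G :: "'g monoid \<Rightarrow> ('g \<Rightarrow> 'x \<Rightarrow> 'x) \<Rightarrow> 'x set \<Rightarrow> ('x \<Rightarrow> 'x \<Rightarrow> 'x \<Rightarrow> nat) \<Rightarrow>
    ('x list \<times> ('g \<Rightarrow> ('x, complex fps) cp_mor), ('x, complex fps) cp_mor) preadd_cat" where
  "\<F>G G \<phi> \<X> c = equivariant_category G (act_ob \<phi>) (act_mor \<phi>) (\<F> \<X> c)"


section \<open>Representations and the objects induced from them\<close>

definition iso_stabilizer ::
    "'g monoid \<Rightarrow> ('g \<Rightarrow> 'x \<Rightarrow> 'x) \<Rightarrow> ('x \<Rightarrow> 'x \<Rightarrow> 'x \<Rightarrow> nat) \<Rightarrow> 'x \<Rightarrow> 'g set" where
  "iso_stabilizer G \<phi> c X = {\<beta> \<in> carrier G. cp_iso c (\<phi> \<beta> X) X}"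

abbreviation GL :: "nat \<Rightarrow> complex mat monoid" where
  "GL d \<equiv> units_of (ring_mat TYPE(complex) d ())"

definition representation :: "'g monoid \<Rightarrow> 'g set \<Rightarrow> nat \<Rightarrow> ('g \<Rightarrow> complex mat) \<Rightarrow> bool" where
  "representation G H d \<rho> \<longleftrightarrow> \<rho> \<in> hom (G\<lparr>carrier := H\<rparr>) (GL d)"

definition irreducible_representation ::
    "'g monoid \<Rightarrow> 'g set \<Rightarrow> nat \<Rightarrow> ('g \<Rightarrow> complex mat) \<Rightarrow> bool" where
  "irreducible_representation G H d \<rho> \<longleftrightarrow> representation G H d \<rho> \<and> 0 < d \<and>
     (\<forall>W. VectorSpace.subspace class_ring W (module_vec TYPE(complex) d) \<and>
        (\<forall>h\<in>H. \<forall>w\<in>W. \<rho> h *\<^sub>v w \<in> W) \<longrightarrow> W = {0\<^sub>v d} \<or> W = carrier_vec d)"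

definition equivalent_representations ::
    "'g set \<Rightarrow> nat \<Rightarrow> ('g \<Rightarrow> complex mat) \<Rightarrow> nat \<Rightarrow> ('g \<Rightarrow> complex mat) \<Rightarrow> bool" where
  "equivalent_representations H d \<rho> e \<tau> \<longleftrightarrow> d = e \<and>
     (\<exists>P\<in>carrier (GL d). \<forall>h\<in>H. P * \<rho> h = \<tau> h * P)"

definition left_transversal :: "'g monoid \<Rightarrow> 'g set \<Rightarrow> 'g list \<Rightarrow> bool" where
  "left_transversal G H ss \<longleftrightarrow> distinct ss \<and> set ss \<subseteq> carrier G \<and>
     (\<forall>g\<in>carrier G. \<exists>!s. s \<in> set ss \<and> g \<in> s <#\<^bsub>G\<^esub> H)"

text \<open>
  \<open>S_obj G \<phi> c ss X d \<rho>\<close> is \<open>S\<^sub>\<rho> X\<close>, built with the coset representatives \<open>ss\<close>: position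
  \<open>j * d + a\<close> in the list of summands is the \<open>a\<close>-th copy of \<open>\<sigma>\<^sub>j X\<close>, where \<open>\<sigma>\<^sub>j = ss ! j\<close>. The block of
  \<open>\<xi>\<^sub>\<gamma>\<close> from \<open>\<gamma>\<sigma>\<^sub>i X\<^sup>d\<close> to \<open>\<sigma>\<^sub>j X\<^sup>d\<close> is nonzero iff \<open>\<eta> = \<sigma>\<^sub>j\<^sup>-\<^sup>1 \<gamma> \<sigma>\<^sub>i\<close> lies in \<open>H\<^sub>X\<close>, and then it is \<open>\<rho>(\<eta>)\<close>.
\<close>

definition S_obj :: "'g monoid \<Rightarrow> ('g \<Rightarrow> 'x \<Rightarrow> 'x) \<Rightarrow> ('x \<Rightarrow> 'x \<Rightarrow> 'x \<Rightarrow> nat) \<Rightarrow> 'g list \<Rightarrow>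
    'x \<Rightarrow> nat \<Rightarrow> ('g \<Rightarrow> complex mat) \<Rightarrow> 'x list \<times> ('g \<Rightarrow> ('x, complex fps) cp_mor)" where
  "S_obj G \<phi> c ss X d \<rho> =
     (let A = concat (map (\<lambda>s. replicate d (\<phi> s X)) ss) in
      (A, \<lambda>\<gamma>\<in>carrier G. (act_ob \<phi> \<gamma> A, A, mat (length A) (length A) (\<lambda>(p, q).
         let \<eta> = inv\<^bsub>G\<^esub> (ss ! (p div d)) \<otimes>\<^bsub>G\<^esub> \<gamma> \<otimes>\<^bsub>G\<^esub> (ss ! (q div d))
         in if \<eta> \<in> iso_stabilizer G \<phi> c X then fps_const (\<rho> \<eta> $$ (p mod d, q mod d)) else 0))))"

end

theory Submission
  imports Defs "Jordan_Normal_Form.Spectral_Radius"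
begin

text \<open>
  The proof reduces everything to complex representation theory by setting \<open>t = 0\<close>.

  In \<open>add \<P>(\<X>)\<close> a matrix entry between non-isomorphic elements, or with coefficient divisible
  by \<open>t\<close>, is radical. Modulo the radical a morphism is a complex matrix supported on pairs of isomorphic
  elements; such matrices are called graded. Since the cocycle vanishes on isomorphic pairs, constant
  graded matrices compose by ordinary matrix multiplication, so the reduction \<open>red\<close> is a functor with the
  section \<open>const\<close>, both strictly compatible with the action of \<open>G\<close>. A morphism is invertible as soon as
  its reduction is (\<open>inverse_if_red_invertible\<close>).

  Given an equivariant object \<open>(A, \<xi>)\<close>, let \<open>\<xi>\<^sup>0\<close> be the constant lift of the reduction of \<open>\<xi>\<close>. The
  average over \<open>g\<close> of \<open>\<xi>\<^sup>0\<^sub>g \<circ> \<xi>\<^sub>g\<^sup>-\<^sup>1\<close> is an equivariant morphism from \<open>(A, \<xi>)\<close> to \<open>(A, \<xi>\<^sup>0)\<close> with reduction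
  \<open>1\<close>, hence an isomorphism (\<open>isomorphic_const_red\<close>). So every object is given by a complex
  representation of \<open>G\<close> that permutes the blocks of \<open>A\<close>, that is, its isomorphism classes
  (\<open>graded_rep\<close>). The object \<open>S\<^sub>\<rho> X\<close> is the representation induced from \<open>\<rho>\<close>, placed on the translates of
  \<open>X\<close>; its fibre at \<open>X\<close> is \<open>\<rho>\<close>.

  \<^item> For irreducible \<open>\<rho>\<close>, Schur's lemma on the fibre shows that the reduction of every endomorphism of
    \<open>S\<^sub>\<rho> X\<close> is a scalar (\<open>end_scalar\<close>). The endomorphisms that are not units are those with scalar
    \<open>0\<close>, and they form an ideal.

  \<^item> A non-zero equivariant idempotent has a non-zero fibre at some \<open>X\<close>. A smallest invariant subspace
    of this fibre is an irreducible representation of the stabilizer (\<open>irreducible_summand\<close>), and by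
    averaging the corresponding \<open>S\<^sub>\<rho> X\<close> splits off (\<open>induced_retract\<close>). Hence a maximal orthogonal
    family of such summands is complete (\<open>complete_orthogonal_summands\<close>).

  \<^item> An isomorphism \<open>S\<^sub>\<lambda> X \<rightarrow> S\<^sub>\<mu> Y\<close> matches the fibre of the source at \<open>X\<close> with a translate of the fibre
    of the target at \<open>Y\<close>. Conversely, an equivalence of these fibres makes \<open>S\<^sub>\<lambda> X\<close> a retract of \<open>S\<^sub>\<mu> Y\<close>,
    and the idempotent of this retract is a non-zero scalar.
\<close>

section \<open>Split bases of complex subspaces\<close>

lemma mult_index: "(M :: 'c :: comm_ring_1 mat) \<in> carrier_mat a b \<Longrightarrow> N \<in> carrier_mat b d \<Longrightarrow> k < a \<Longrightarrow> i < d \<Longrightarrow>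
   (M * N) $$ (k, i) = (\<Sum>j<b. M $$ (k, j) * N $$ (j, i))"
  by (simp add: scalar_prod_def lessThan_atLeast0)

text \<open>
  Padding a longer family and its dual family with zeros would give square matrices with a left inverse
  that is not a right inverse.
\<close>

lemma biorthogonal_le_dim:
  fixes b b' :: "nat \<Rightarrow> complex vec"
  assumes "\<And>k. k < r \<Longrightarrow> b k \<in> carrier_vec n" "\<And>k. k < r \<Longrightarrow> b' k \<in> carrier_vec n"
    and bi: "\<And>k l. k < r \<Longrightarrow> l < r \<Longrightarrow> b' k \<bullet> b l = (if k = l then 1 else 0)"
  shows "r \<le> n"
proof (rule ccontr)
  assume "\<not> r \<le> n"
  then have n: "n < r" by simp
  define T where "T = mat r r (\<lambda>(i, k). if i < n then b k $ i else 0)"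
  define L where "L = mat r r (\<lambda>(k, i). if i < n then b' k $ i else 0)"
  have T: "T \<in> carrier_mat r r" and L: "L \<in> carrier_mat r r" by (auto simp: T_def L_def)
  have "L * T = 1\<^sub>m r"
  proof (rule eq_matI)
    fix k l assume "k < dim_row (1\<^sub>m r)" "l < dim_col (1\<^sub>m r)"
    then have kl: "k < r" "l < r" by auto
    have "(L * T) $$ (k, l) = (\<Sum>i = 0..<r. (if i < n then b' k $ i else 0) * (if i < n then b l $ i else 0))"
      using kl by (simp add: L_def T_def scalar_prod_def)
    also have "\<dots> = (\<Sum>i = 0..<n. b' k $ i * b l $ i)"
      by (rule sum.mono_neutral_cong_right) (use n in auto)
    also have "\<dots> = b' k \<bullet> b l" using assms(1)[of l] kl by (simp add: scalar_prod_def)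
    finally show "(L * T) $$ (k, l) = 1\<^sub>m r $$ (k, l)" using bi kl by simp
  qed (auto simp: T_def L_def)
  then have "T * L = 1\<^sub>m r" using mat_mult_left_right_inverse L T by blast
  then have "(T * L) $$ (n, n) = 1" using n by simp
  moreover have "(T * L) $$ (n, n) = 0" using n by (simp add: T_def L_def scalar_prod_def)
  ultimately show False by simp
qed

lemma left_inverse_le_dim:
  fixes B C :: "complex mat"
  assumes B: "B \<in> carrier_mat n d" and C: "C \<in> carrier_mat d n" and CB: "C * B = 1\<^sub>m d"
  shows "d \<le> n"
proof (rule biorthogonal_le_dim[of d "col B" n "row C"])
  fix k l assume kl: "k < d" "l < d"
  have "row C k \<bullet> col B l = (C * B) $$ (k, l)" using kl B C by simp
  then show "row C k \<bullet> col B l = (if k = l then 1 else 0)" using kl CB by simp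
qed (use B C in auto)

definition subsp :: "nat \<Rightarrow> complex vec set \<Rightarrow> bool" where
  "subsp n W \<longleftrightarrow> VectorSpace.subspace class_ring W (module_vec TYPE(complex) n)"

lemma subsp_iff: "subsp n W \<longleftrightarrow> W \<subseteq> carrier_vec n \<and> 0\<^sub>v n \<in> W \<and>
    (\<forall>v\<in>W. \<forall>w\<in>W. v + w \<in> W) \<and> (\<forall>a. \<forall>v\<in>W. a \<cdot>\<^sub>v v \<in> W)"
proof -
  interpret vec_space "TYPE(complex)" n .
  show ?thesis unfolding subsp_def VectorSpace.subspace_def LinearCombinations.submodule_def
    using vectorspace_axioms module_axioms by (auto simp: module_vec_simps)
qed

lemma subsp_mult_mat_vec:
  assumes W: "subsp n W" and B: "B \<in> carrier_mat n r" and cols: "\<And>k. k < r \<Longrightarrow> col B k \<in> W"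
    and v: "v \<in> carrier_vec r"
  shows "B *\<^sub>v v \<in> W"
proof -
  have "vec n (\<lambda>i. \<Sum>k<m. B $$ (i, k) * v $ k) \<in> W" if "m \<le> r" for m
    using that
  proof (induction m)
    case 0
    have "vec n (\<lambda>i. \<Sum>k<0::nat. B $$ (i, k) * v $ k) = 0\<^sub>v n" by auto
    then show ?case using W by (simp add: subsp_iff)
  next
    case (Suc m)
    have "vec n (\<lambda>i. \<Sum>k<Suc m. B $$ (i, k) * v $ k) =
        vec n (\<lambda>i. \<Sum>k<m. B $$ (i, k) * v $ k) + v $ m \<cdot>\<^sub>v col B m"
      using B Suc.prems by (intro eq_vecI) (auto simp: mult.commute)
    then show ?case using Suc W cols[of m] by (simp add: subsp_iff)
  qed
  from this[of r] have "vec n (\<lambda>i. \<Sum>k<r. B $$ (i, k) * v $ k) \<in> W" by simp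
  also have "vec n (\<lambda>i. \<Sum>k<r. B $$ (i, k) * v $ k) = B *\<^sub>v v"
    using B v by (intro eq_vecI) (auto simp: scalar_prod_def lessThan_atLeast0)
  finally show ?thesis .
qed

text \<open>
  Subspaces are handled through such pairs: the columns of \<open>B\<close> are a basis of \<open>W\<close>, and \<open>B * C\<close>
  projects onto \<open>W\<close>. A biorthogonal family in \<open>W\<close> of maximal length provides them, because a vector
  \<open>w\<close> of \<open>W\<close> that is not fixed by \<open>B * C\<close> extends the family by \<open>w - B * C * w\<close>.
\<close>

lemma subspace_split_basis:
  assumes W: "subsp n W"
  obtains d B C where "B \<in> carrier_mat n d" "C \<in> carrier_mat d n" "C * B = 1\<^sub>m d"
    "\<And>v. v \<in> carrier_vec d \<Longrightarrow> B *\<^sub>v v \<in> W" "\<And>w. w \<in> W \<Longrightarrow> B *\<^sub>v (C *\<^sub>v w) = w"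
proof -
  define P where "P r \<longleftrightarrow> (\<exists>b b'. (\<forall>k<r. b k \<in> W \<and> b' k \<in> carrier_vec n) \<and>
      (\<forall>k<r. \<forall>l<r. b' k \<bullet> b l = (if k = l then 1 else (0::complex))))" for r :: nat
  have Wc: "W \<subseteq> carrier_vec n" using W by (simp add: subsp_iff)
  have bound: "r \<le> n" if Pr: "P r" for r :: nat
  proof -
    obtain b b' where "\<forall>k<r. b k \<in> W \<and> b' k \<in> carrier_vec n"
      "\<forall>k<r. \<forall>l<r. b' k \<bullet> b l = (if k = l then 1 else (0::complex))"
      using Pr unfolding P_def by blast
    then show ?thesis using Wc by (intro biorthogonal_le_dim[of r b n b']) auto
  qed
  have "P 0" by (simp add: P_def)
  then obtain r where r: "P r" "\<And>s. P s \<Longrightarrow> s \<le> r"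
    using bound by (metis GreatestI_nat Greatest_le_nat)
  then obtain b b' where b: "\<And>k. k < r \<Longrightarrow> b k \<in> W" "\<And>k. k < r \<Longrightarrow> b' k \<in> carrier_vec n"
    and bi: "\<And>k l. k < r \<Longrightarrow> l < r \<Longrightarrow> b' k \<bullet> b l = (if k = l then 1 else (0::complex))"
    unfolding P_def by blast
  have bc: "b k \<in> carrier_vec n" if "k < r" for k using b Wc that by blast
  define B where "B = mat n r (\<lambda>(i, k). b k $ i)"
  define C where "C = mat r n (\<lambda>(k, i). b' k $ i)"
  have B: "B \<in> carrier_mat n r" and C: "C \<in> carrier_mat r n" by (auto simp: B_def C_def)
  have colB: "col B k = b k" if "k < r" for k using that bc[OF that] by (intro eq_vecI) (auto simp: B_def)
  have rowC: "row C k = b' k" if "k < r" for k using that b(2)[OF that] by (intro eq_vecI) (auto simp: C_def)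
  have CB: "C * B = 1\<^sub>m r"
    using B C by (intro eq_matI) (auto simp: colB rowC bi)
  have BW: "B *\<^sub>v v \<in> W" if "v \<in> carrier_vec r" for v
    using subsp_mult_mat_vec[OF W B _ that] colB b by simp
  have fix_w: "B *\<^sub>v (C *\<^sub>v w) = w" if w: "w \<in> W" for w
  proof (rule ccontr)
    assume ne: "B *\<^sub>v (C *\<^sub>v w) \<noteq> w"
    have wc: "w \<in> carrier_vec n" using w Wc by blast
    define N where "N = 1\<^sub>m n - B * C"
    have N: "N \<in> carrier_mat n n" using B C unfolding N_def by (intro minus_carrier_mat mult_carrier_mat)
    have Nx: "N *\<^sub>v x = x - B *\<^sub>v (C *\<^sub>v x)" if "x \<in> carrier_vec n" for x
      using that B C by (simp add: N_def minus_mult_distrib_mat_vec[of _ n n])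
    define w' where "w' = N *\<^sub>v w"
    have w'c: "w' \<in> carrier_vec n" using N wc by (simp add: w'_def)
    have CBv: "C *\<^sub>v (B *\<^sub>v x) = x" if "x \<in> carrier_vec r" for x
      using that B C CB assoc_mult_mat_vec[OF C B that] by simp
    have "w' = w + (-1) \<cdot>\<^sub>v (B *\<^sub>v (C *\<^sub>v w))"
      using B C wc by (intro eq_vecI) (auto simp: w'_def Nx)
    then have w'W: "w' \<in> W" using W w BW[of "C *\<^sub>v w"] C wc by (simp add: subsp_iff)
    have Cw': "C *\<^sub>v w' = 0\<^sub>v r"
      using B C wc CBv[of "C *\<^sub>v w"] by (simp add: w'_def Nx mult_minus_distrib_mat_vec[of _ r n])
    have "\<exists>i<n. w' $ i \<noteq> 0"
    proof (rule ccontr)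
      assume "\<not> ?thesis"
      then have "w $ i = (B *\<^sub>v (C *\<^sub>v w)) $ i" if "i < n" for i
        using that B C wc by (simp add: w'_def Nx)
      then have "B *\<^sub>v (C *\<^sub>v w) = w" using B C wc by (intro eq_vecI) auto
      then show False using ne by simp
    qed
    then obtain i where i: "i < n" "w' $ i \<noteq> 0" by blast
    \<comment> \<open>the rows of \<open>N = 1 - B * C\<close> vanish on the family, and \<open>N\<close> fixes \<open>w'\<close>\<close>
    define u where "u = (1 / w' $ i) \<cdot>\<^sub>v row N i"
    have uc: "u \<in> carrier_vec n" using N i by (auto simp: u_def)
    have ux: "u \<bullet> x = (N *\<^sub>v x) $ i / w' $ i" if "x \<in> carrier_vec n" for x
      using that N i by (simp add: u_def)
    have 1: "u \<bullet> w' = 1" using ux[OF w'c] Nx[OF w'c] Cw' B i w'c by simp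
    have 2: "u \<bullet> b k = 0" if k: "k < r" for k
    proof -
      have "b k = B *\<^sub>v unit_vec r k" using k bc[OF k] by (intro eq_vecI) (auto simp: B_def)
      then have "B *\<^sub>v (C *\<^sub>v b k) = b k" using CBv[of "unit_vec r k"] by simp
      then have "N *\<^sub>v b k = 0\<^sub>v n" using Nx[OF bc[OF k]] bc[OF k] by simp
      then show ?thesis using ux[OF bc[OF k]] i by simp
    qed
    have 3: "b' k \<bullet> w' = 0" if k: "k < r" for k
    proof -
      have "(C *\<^sub>v w') $ k = row C k \<bullet> w'" using k C by simp
      then show ?thesis using k Cw' rowC[OF k] by simp
    qed
    have "P (Suc r)" unfolding P_def
      by (intro exI[of _ "b(r := w')"] exI[of _ "b'(r := u)"])
        (auto simp: less_Suc_eq b w'W uc bi 1 2 3)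
    then show False using r(2)[of "Suc r"] by simp
  qed
  show thesis using that[OF B C CB BW fix_w] .
qed

section \<open>The additive category over the power series ring\<close>

text \<open>
  The coefficient matrix of a composite in \<open>add \<P>(\<X>)\<close>: the basic morphisms satisfy
  \<open>f\<^sub>Y\<^sub>Z \<circ> f\<^sub>X\<^sub>Y = t\<^bsup>c(X, Y, Z)\<^esup> f\<^sub>X\<^sub>Z\<close>.
\<close>

definition twist_mult :: "('x \<Rightarrow> 'x \<Rightarrow> 'x \<Rightarrow> nat) \<Rightarrow> 'x list \<Rightarrow> 'x list \<Rightarrow> 'x list \<Rightarrow>
    complex fps mat \<Rightarrow> complex fps mat \<Rightarrow> complex fps mat" where
  "twist_mult c A B D N M = mat (length D) (length A)
     (\<lambda>(k, i). \<Sum>j<length B. N $$ (k, j) * M $$ (j, i) * fps_X ^ c (A ! i) (B ! j) (D ! k))"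

lemma twist_mult_carrier [simp]:
  "length D = n \<Longrightarrow> length A = m \<Longrightarrow> twist_mult c A B D N M \<in> carrier_mat n m"
  by (simp add: twist_mult_def)

lemma twist_mult_index: "k < length D \<Longrightarrow> i < length A \<Longrightarrow>
   twist_mult c A B D N M $$ (k, i) = (\<Sum>j<length B. N $$ (k, j) * M $$ (j, i) * fps_X ^ c (A ! i) (B ! j) (D ! k))"
  by (simp add: twist_mult_def)

lemma class_ring_pow: "a [^]\<^bsub>class_ring\<^esub> (n::nat) = (a::'a::comm_ring_1) ^ n"
  by (induction n) (simp_all add: nat_pow_def matrix_vs_simps mult.commute)

lemma Comp_F: "Comp (\<F> \<X> c) (B', D, N) (A, B, M) = (A, D, twist_mult c A B D N M)"
  by (simp add: add_P_def cp_comp_def twist_mult_def matrix_vs_simps class_ring_pow)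

lemma Ob_F: "Ob (\<F> \<X> c) = lists \<X>" by (simp add: add_P_def)

lemma Hom_F: "f \<in> Hom (\<F> \<X> c) A B \<longleftrightarrow> (\<exists>M\<in>carrier_mat (length B) (length A). f = (A, B, M))"
  by (auto simp: add_P_def matrix_vs_simps)

lemma Idn_F: "Idn (\<F> \<X> c) A = (A, A, 1\<^sub>m (length A))"
  by (auto simp: add_P_def matrix_vs_simps)

lemma Zer_F: "Zer (\<F> \<X> c) A B = (A, B, 0\<^sub>m (length B) (length A))"
  by (auto simp: add_P_def matrix_vs_simps)

lemma Add_F: "M \<in> carrier_mat (length B) (length A) \<Longrightarrow> N \<in> carrier_mat (length B) (length A) \<Longrightarrow>
   Add (\<F> \<X> c) (A, B, M) (A', B', N) = (A, B, M + N)"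
  by (auto simp: add_P_def matrix_vs_simps)

lemma twist_mult_add_right:
  assumes "M \<in> carrier_mat (length B) (length A)" "M' \<in> carrier_mat (length B) (length A)"
  shows "twist_mult c A B D N (M + M') = twist_mult c A B D N M + twist_mult c A B D N M'"
  using assms by (intro eq_matI; simp add: twist_mult_def ring_distribs sum.distrib)

lemma twist_mult_add_left:
  assumes "N \<in> carrier_mat (length D) (length B)" "N' \<in> carrier_mat (length D) (length B)"
  shows "twist_mult c A B D (N + N') M = twist_mult c A B D N M + twist_mult c A B D N' M"
  using assms by (intro eq_matI; simp add: twist_mult_def ring_distribs sum.distrib)

locale cyc_poset =
  fixes \<X> :: "'x set" and c :: "'x \<Rightarrow> 'x \<Rightarrow> 'x \<Rightarrow> nat"
  assumes cp: "cyclic_poset \<X> c"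
begin

lemma cocycle:
  assumes "W \<in> \<X>" "X \<in> \<X>" "Y \<in> \<X>" "Z \<in> \<X>"
  shows "c X Y Z + c W X Z = c W Y Z + c W X Y"
proof -
  have "int (c X Y Z) - int (c W Y Z) + int (c W X Z) - int (c W X Y) = 0"
    using cp assms unfolding cyclic_poset_def by blast
  then show ?thesis by linarith
qed

lemma reduced [simp]:
  assumes "X \<in> \<X>" "Y \<in> \<X>"
  shows "c X X Y = 0" "c X Y Y = 0"
  using cp assms unfolding cyclic_poset_def by blast+

lemma cp_iso_refl [simp]: "X \<in> \<X> \<Longrightarrow> cp_iso c X X"
  by (simp add: cp_iso_def)

lemma cp_iso_sym:
  assumes "X \<in> \<X>" "Y \<in> \<X>" "cp_iso c X Y"
  shows "cp_iso c Y X"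
  using cocycle[of Y X Y X] assms by (simp add: cp_iso_def)

text \<open>
  Composing with a basic isomorphism produces no power of \<open>t\<close>: for \<open>X \<cong> Y\<close> the cocycle identity
  exhibits the sum of two natural numbers as zero.
\<close>

lemma cp_iso_zero:
  assumes "X \<in> \<X>" "Y \<in> \<X>" "Z \<in> \<X>" "cp_iso c X Y"
  shows "c X Y Z = 0" "c Z X Y = 0"
  using cocycle[of X Y X Z] cocycle[of Z X Y X] assms by (auto simp: cp_iso_def)

lemma cp_iso_trans:
  assumes "X \<in> \<X>" "Y \<in> \<X>" "Z \<in> \<X>" "cp_iso c X Y" "cp_iso c Y Z"
  shows "cp_iso c X Z"
  using cocycle[of X Y Z X] assms cp_iso_zero(1)[of Y Z X] by (simp add: cp_iso_def)

text \<open>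
  Up to the isomorphism \<open>Z \<cong> X\<close> the path \<open>X \<rightarrow> Y \<rightarrow> Z\<close> is the loop at \<open>X\<close> through \<open>Y\<close>.
\<close>

lemma zero_iff_iso:
  assumes "X \<in> \<X>" "Y \<in> \<X>" "Z \<in> \<X>" "cp_iso c X Z"
  shows "c X Y Z = 0 \<longleftrightarrow> cp_iso c X Y"
  using cocycle[of X Y Z X] assms cp_iso_zero(2)[of Z X Y] cp_iso_sym[of X Z] by (simp add: cp_iso_def)

lemma nth_in: "A \<in> lists \<X> \<Longrightarrow> i < length A \<Longrightarrow> A ! i \<in> \<X>"
  using nth_mem by blast

lemma twist_mult_assoc:
  assumes ob: "A \<in> lists \<X>" "B \<in> lists \<X>" "D \<in> lists \<X>" "E \<in> lists \<X>"
  shows "twist_mult c A D E L (twist_mult c A B D N M) = twist_mult c A B E (twist_mult c B D E L N) M"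
proof (rule eq_matI)
  fix m i assume "m < dim_row (twist_mult c A B E (twist_mult c B D E L N) M)"
    "i < dim_col (twist_mult c A B E (twist_mult c B D E L N) M)"
  then have mi: "m < length E" "i < length A" by (auto simp: twist_mult_def)
  have "L $$ (m, l) * (N $$ (l, j) * M $$ (j, i) * fps_X ^ c (A ! i) (B ! j) (D ! l)) * fps_X ^ c (A ! i) (D ! l) (E ! m)
      = (L $$ (m, l) * N $$ (l, j) * fps_X ^ c (B ! j) (D ! l) (E ! m)) * M $$ (j, i) * fps_X ^ c (A ! i) (B ! j) (E ! m)"
    if "l < length D" "j < length B" for l j
  proof -
    have "c (B ! j) (D ! l) (E ! m) + c (A ! i) (B ! j) (E ! m) = c (A ! i) (D ! l) (E ! m) + c (A ! i) (B ! j) (D ! l)"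
      using cocycle[of "A!i" "B!j" "D!l" "E!m"] nth_in ob mi that by blast
    then have "(fps_X :: complex fps) ^ c (B ! j) (D ! l) (E ! m) * fps_X ^ c (A ! i) (B ! j) (E ! m) =
       fps_X ^ c (A ! i) (D ! l) (E ! m) * fps_X ^ c (A ! i) (B ! j) (D ! l)"
      by (simp only: power_add[symmetric])
    then show ?thesis by (simp add: algebra_simps)
  qed
  then have "(\<Sum>l<length D. \<Sum>j<length B. L $$ (m, l) * (N $$ (l, j) * M $$ (j, i) * fps_X ^ c (A ! i) (B ! j) (D ! l)) * fps_X ^ c (A ! i) (D ! l) (E ! m))
     = (\<Sum>l<length D. \<Sum>j<length B. (L $$ (m, l) * N $$ (l, j) * fps_X ^ c (B ! j) (D ! l) (E ! m)) * M $$ (j, i) * fps_X ^ c (A ! i) (B ! j) (E ! m))"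
    by (intro sum.cong) auto
  also have "\<dots> = (\<Sum>j<length B. \<Sum>l<length D. (L $$ (m, l) * N $$ (l, j) * fps_X ^ c (B ! j) (D ! l) (E ! m)) * M $$ (j, i) * fps_X ^ c (A ! i) (B ! j) (E ! m))"
    by (rule sum.swap)
  finally show "twist_mult c A D E L (twist_mult c A B D N M) $$ (m, i) = twist_mult c A B E (twist_mult c B D E L N) M $$ (m, i)"
    using mi by (simp add: twist_mult_index sum_distrib_left sum_distrib_right)
qed (auto simp: twist_mult_def)

lemma twist_mult_one:
  assumes ob: "A \<in> lists \<X>" "B \<in> lists \<X>" and M: "M \<in> carrier_mat (length B) (length A)"
  shows "twist_mult c A A B M (1\<^sub>m (length A)) = M" "twist_mult c A B B (1\<^sub>m (length B)) M = M"
proof -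
  have "(\<Sum>j<length A. M $$ (k, j) * 1\<^sub>m (length A) $$ (j, i) * fps_X ^ c (A ! i) (A ! j) (B ! k)) = M $$ (k, i)"
    if "i < length A" "k < length B" for i k
  proof -
    have "(\<Sum>j<length A. M $$ (k, j) * 1\<^sub>m (length A) $$ (j, i) * fps_X ^ c (A ! i) (A ! j) (B ! k))
       = (\<Sum>j<length A. if j = i then M $$ (k, i) else 0)"
      using that nth_in ob by (intro sum.cong) auto
    then show ?thesis using that by simp
  qed
  then show "twist_mult c A A B M (1\<^sub>m (length A)) = M"
    using M by (intro eq_matI) (simp_all add: twist_mult_index, auto simp: twist_mult_def)
  have "(\<Sum>j<length B. 1\<^sub>m (length B) $$ (k, j) * M $$ (j, i) * fps_X ^ c (A ! i) (B ! j) (B ! k)) = M $$ (k, i)"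
    if "i < length A" "k < length B" for i k
  proof -
    have "(\<Sum>j<length B. 1\<^sub>m (length B) $$ (k, j) * M $$ (j, i) * fps_X ^ c (A ! i) (B ! j) (B ! k))
       = (\<Sum>j<length B. if k = j then M $$ (k, i) else 0)"
      using that nth_in ob by (intro sum.cong) auto
    then show ?thesis using that by simp
  qed
  then show "twist_mult c A B B (1\<^sub>m (length B)) M = M"
    using M by (intro eq_matI) (simp_all add: twist_mult_index, auto simp: twist_mult_def)
qed

section \<open>Constant morphisms and reduction\<close>

text \<open>
  The support condition on the matrices that remain of \<open>add \<P>(\<X>)\<close> modulo its radical.
\<close>

definition graded :: "'x list \<Rightarrow> 'x list \<Rightarrow> complex mat \<Rightarrow> bool" where
  "graded A B M \<longleftrightarrow> M \<in> carrier_mat (length B) (length A) \<and>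
     (\<forall>k<length B. \<forall>i<length A. M $$ (k, i) \<noteq> 0 \<longrightarrow> cp_iso c (A ! i) (B ! k))"

definition red :: "'x list \<Rightarrow> 'x list \<Rightarrow> complex fps mat \<Rightarrow> complex mat" where
  "red A B M = mat (length B) (length A)
     (\<lambda>(k, i). if cp_iso c (A ! i) (B ! k) then fps_nth (M $$ (k, i)) 0 else 0)"

abbreviation const :: "complex mat \<Rightarrow> complex fps mat" where
  "const \<equiv> map_mat fps_const"

lemma gradedD: "graded A B M \<Longrightarrow> M \<in> carrier_mat (length B) (length A)"
  by (simp add: graded_def)

lemma gradedE: "graded A B M \<Longrightarrow> k < length B \<Longrightarrow> i < length A \<Longrightarrow> \<not> cp_iso c (A ! i) (B ! k) \<Longrightarrow> M $$ (k, i) = 0"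
  by (auto simp: graded_def)

lemma gradedI:
  assumes "M \<in> carrier_mat (length B) (length A)"
    and "\<And>k i. k < length B \<Longrightarrow> i < length A \<Longrightarrow> \<not> cp_iso c (A ! i) (B ! k) \<Longrightarrow> M $$ (k, i) = 0"
  shows "graded A B M"
  using assms by (auto simp: graded_def)

lemma red_index: "k < length B \<Longrightarrow> i < length A \<Longrightarrow>
   red A B M $$ (k, i) = (if cp_iso c (A ! i) (B ! k) then fps_nth (M $$ (k, i)) 0 else 0)"
  by (simp add: red_def)

lemma graded_red: "graded A B (red A B M)"
  by (auto simp: graded_def red_def)

lemma red_const: "graded A B M \<Longrightarrow> red A B (const M) = M"
  by (frule gradedD, intro eq_matI) (auto simp: red_def gradedE)

lemma graded_one: "A \<in> lists \<X> \<Longrightarrow> graded A A (1\<^sub>m (length A))"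
  using nth_in by (auto simp: graded_def)

lemma graded_minus: "graded A B M \<Longrightarrow> graded A B N \<Longrightarrow> graded A B (M - N)"
  by (frule gradedD[of _ _ N], frule gradedD[of _ _ M], rule gradedI) (auto simp: gradedE minus_carrier_mat)

lemma graded_mult:
  assumes ob: "A \<in> lists \<X>" "B \<in> lists \<X>" "D \<in> lists \<X>" and M: "graded A B M" and N: "graded B D N"
  shows "graded A D (N * M)"
proof -
  have "cp_iso c (A ! i) (D ! k)" if "k < length D" "i < length A" "(N * M) $$ (k, i) \<noteq> 0" for k i
  proof -
    have "(\<Sum>j<length B. N $$ (k, j) * M $$ (j, i)) \<noteq> 0"
      using that mult_index[OF gradedD[OF N] gradedD[OF M]] by simp
    then obtain j where j: "j < length B" "N $$ (k, j) * M $$ (j, i) \<noteq> 0"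
      by (meson lessThan_iff sum.not_neutral_contains_not_neutral)
    then have "cp_iso c (A ! i) (B ! j)" "cp_iso c (B ! j) (D ! k)"
      using gradedE[OF N] gradedE[OF M] that by auto
    then show ?thesis using cp_iso_trans nth_in ob that j by blast
  qed
  then show ?thesis using gradedD[OF M] gradedD[OF N] by (auto simp: graded_def)
qed

text \<open>
  Both factors of a summand are supported on isomorphic pairs, where the exponent of \<open>t\<close> is zero.
\<close>

lemma twist_mult_const:
  assumes ob: "A \<in> lists \<X>" "B \<in> lists \<X>" "D \<in> lists \<X>" and M: "graded A B M" and N: "graded B D N"
  shows "twist_mult c A B D (const N) (const M) = const (N * M)"
proof (rule eq_matI)
  fix k i assume "k < dim_row (const (N * M))" "i < dim_col (const (N * M))"
  then have ki: "k < length D" "i < length A" using gradedD[OF M] gradedD[OF N] by auto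
  have "const N $$ (k, j) * const M $$ (j, i) * fps_X ^ c (A ! i) (B ! j) (D ! k) = fps_const (N $$ (k, j) * M $$ (j, i))"
    if j: "j < length B" for j
  proof (cases "cp_iso c (A ! i) (B ! j)")
    case True
    then have "c (A ! i) (B ! j) (D ! k) = 0" using cp_iso_zero(1) nth_in ob j ki by metis
    then show ?thesis using j ki gradedD[OF M] gradedD[OF N] by simp
  next
    case False
    then have "M $$ (j, i) = 0" using gradedE[OF M] j ki by blast
    then show ?thesis using j ki gradedD[OF M] gradedD[OF N] by simp
  qed
  then have "twist_mult c A B D (const N) (const M) $$ (k, i) = (\<Sum>j<length B. fps_const (N $$ (k, j) * M $$ (j, i)))"
    using ki by (simp add: twist_mult_index)
  also have "\<dots> = fps_const (\<Sum>j<length B. N $$ (k, j) * M $$ (j, i))"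
    by (rule fps_ext) (simp add: fps_sum_nth sum.If_cases)
  also have "\<dots> = const (N * M) $$ (k, i)"
    using mult_index[OF gradedD[OF N] gradedD[OF M] ki] ki gradedD[OF M] gradedD[OF N] by simp
  finally show "twist_mult c A B D (const N) (const M) $$ (k, i) = const (N * M) $$ (k, i)" .
qed (use gradedD[OF M] gradedD[OF N] in \<open>auto simp: twist_mult_def\<close>)

text \<open>
  A path between isomorphic objects through a non-isomorphic one carries a positive power of \<open>t\<close>, and a
  path between non-isomorphic objects cannot consist of two isomorphisms; neither kind contributes to
  either side.
\<close>

lemma red_twist_mult:
  assumes ob: "A \<in> lists \<X>" "B \<in> lists \<X>" "D \<in> lists \<X>"
  shows "red A D (twist_mult c A B D N M) = red B D N * red A B M"
proof (rule eq_matI)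
  have dims: "red B D N \<in> carrier_mat (length D) (length B)" "red A B M \<in> carrier_mat (length B) (length A)"
    by (simp_all add: red_def)
  fix k i assume "k < dim_row (red B D N * red A B M)" "i < dim_col (red B D N * red A B M)"
  then have ki: "k < length D" "i < length A" using dims by auto
  have "(if cp_iso c (A ! i) (D ! k) then fps_nth (N $$ (k, j) * M $$ (j, i) * fps_X ^ c (A ! i) (B ! j) (D ! k)) 0 else 0)
      = red B D N $$ (k, j) * red A B M $$ (j, i)" if j: "j < length B" for j
  proof (cases "cp_iso c (A ! i) (D ! k)")
    case True
    note in\<X> = nth_in[OF ob(1) ki(2)] nth_in[OF ob(2) j] nth_in[OF ob(3) ki(1)]
    have "c (A ! i) (B ! j) (D ! k) = 0 \<longleftrightarrow> cp_iso c (A ! i) (B ! j)"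
      using zero_iff_iso[OF in\<X> True] .
    moreover have "cp_iso c (A ! i) (B ! j) \<Longrightarrow> cp_iso c (B ! j) (D ! k)"
      using True cp_iso_trans cp_iso_sym in\<X> by blast
    ultimately show ?thesis using True j ki by (auto simp: red_index zero_power)
  next
    case False
    then have "\<not> (cp_iso c (A ! i) (B ! j) \<and> cp_iso c (B ! j) (D ! k))"
      using cp_iso_trans nth_in ob j ki by blast
    then show ?thesis using False j ki by (auto simp: red_index)
  qed
  then have "(\<Sum>j<length B. if cp_iso c (A ! i) (D ! k) then fps_nth (N $$ (k, j) * M $$ (j, i) * fps_X ^ c (A ! i) (B ! j) (D ! k)) 0 else 0)
     = (red B D N * red A B M) $$ (k, i)"
    using mult_index[OF dims ki] by simp
  then show "red A D (twist_mult c A B D N M) $$ (k, i) = (red B D N * red A B M) $$ (k, i)"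
    using ki by (auto simp: red_index twist_mult_index fps_sum_nth)
qed (auto simp: red_def)

lemma red_add: "M \<in> carrier_mat (length B) (length A) \<Longrightarrow> N \<in> carrier_mat (length B) (length A) \<Longrightarrow>
   red A B (M + N) = red A B M + red A B N"
  by (auto intro!: eq_matI simp: red_def)

lemma red_one: "A \<in> lists \<X> \<Longrightarrow> red A A (1\<^sub>m (length A)) = 1\<^sub>m (length A)"
  using nth_in by (auto intro!: eq_matI simp: red_def)

text \<open>
  Column \<open>i\<close> of a right inverse solves the linear system with matrix
  \<open>M\<^sub>k\<^sub>j t\<^bsup>c(A\<^sub>i, A\<^sub>j, A\<^sub>k)\<^esup>\<close>. By the cocycle identity, the pairs \<open>j, k\<close> with
  \<open>c(A\<^sub>i, A\<^sub>j, A\<^sub>k) = 0\<close> and \<open>A\<^sub>j\<close> not isomorphic to \<open>A\<^sub>k\<close> form a strict partial order, for which the constant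
  term of this matrix is unitriangular. So its determinant is a unit of the power series ring.
\<close>

lemma right_inverse_if_red_one:
  assumes A: "A \<in> lists \<X>" and M: "M \<in> carrier_mat (length A) (length A)"
    and red: "red A A M = 1\<^sub>m (length A)"
  obtains N where "N \<in> carrier_mat (length A) (length A)" "twist_mult c A A A M N = 1\<^sub>m (length A)"
proof -
  let ?n = "length A"
  have diag: "fps_nth (M $$ (k, k)) 0 = 1" if "k < ?n" for k
    using arg_cong[OF red, of "\<lambda>Z. Z $$ (k, k)"] that A nth_in by (simp add: red_index)
  have offdiag: "fps_nth (M $$ (k, j)) 0 = 0" if "k < ?n" "j < ?n" "cp_iso c (A ! j) (A ! k)" "j \<noteq> k" for k j
    using arg_cong[OF red, of "\<lambda>Z. Z $$ (k, j)"] that by (simp add: red_index)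
  have "\<exists>x. \<forall>k<?n. (\<Sum>j<?n. M $$ (k, j) * x j * fps_X ^ c (A ! i) (A ! j) (A ! k)) = (if k = i then 1 else 0)"
    if i: "i < ?n" for i
  proof -
    define T where "T = mat ?n ?n (\<lambda>(k, j). M $$ (k, j) * fps_X ^ c (A ! i) (A ! j) (A ! k))"
    have T: "T \<in> carrier_mat ?n ?n" by (simp add: T_def)
    interpret h: comm_ring_hom "\<lambda>f :: complex fps. fps_nth f 0"
      by unfold_locales (auto simp: fps_mult_nth)
    define T0 where "T0 = map_mat (\<lambda>f. fps_nth f 0) T"
    have T0: "T0 \<in> carrier_mat ?n ?n" using T by (simp add: T0_def)
    define R where "R j k \<longleftrightarrow> c (A ! i) (A ! j) (A ! k) = 0 \<and> \<not> cp_iso c (A ! j) (A ! k)" for j k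
    have R_trans: "R j l" if "R j k" "R k l" "j < ?n" "k < ?n" "l < ?n" for j k l
    proof -
      have in\<X>: "A ! i \<in> \<X>" "A ! j \<in> \<X>" "A ! k \<in> \<X>" "A ! l \<in> \<X>"
        using nth_in A i that by auto
      have z: "c (A ! i) (A ! j) (A ! k) = 0" "c (A ! i) (A ! k) (A ! l) = 0" using that by (auto simp: R_def)
      then have jl: "c (A ! i) (A ! j) (A ! l) = 0" "c (A ! j) (A ! k) (A ! l) = 0"
        using cocycle[OF in\<X>] by auto
      have "\<not> cp_iso c (A ! j) (A ! l)"
      proof
        assume "cp_iso c (A ! j) (A ! l)"
        then have "cp_iso c (A ! j) (A ! k)"
          using zero_iff_iso[OF in\<X>(2,3,4)] jl by simp
        then show False using \<open>R j k\<close> by (simp add: R_def)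
      qed
      then show ?thesis using jl by (simp add: R_def)
    qed
    \<comment> \<open>a height function along which \<open>R\<close> increases; it carries the elimination below\<close>
    define ht where "ht k = card {j. j < ?n \<and> R j k}" for k
    have ht_less: "ht j < ht k" if "R j k" "j < ?n" "k < ?n" for j k
      unfolding ht_def
    proof (rule psubset_card_mono)
      have "\<not> R j j" using that nth_in A by (auto simp: R_def)
      then show "{l. l < ?n \<and> R l j} \<subset> {l. l < ?n \<and> R l k}" using R_trans that by blast
    qed simp
    have T0_entry: "T0 $$ (k, j) = (if k = j then 1 else if R j k then fps_nth (M $$ (k, j)) 0 else 0)"
      if "k < ?n" "j < ?n" for k j
      using that diag[of k] offdiag[of k j] A nth_in i
      by (auto simp: T0_def T_def R_def zero_power)
    have "det T0 \<noteq> 0"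
    proof
      assume "det T0 = 0"
      then obtain v where v: "v \<in> carrier_vec ?n" "v \<noteq> 0\<^sub>v ?n" "T0 *\<^sub>v v = 0\<^sub>v ?n"
        using det_0_iff_vec_prod_zero[OF T0] by blast
      \<comment> \<open>forward substitution: row \<open>k\<close> of \<open>T0\<close> involves only \<open>v $ k\<close> and entries of smaller height\<close>
      have "v $ k = 0" if "k < ?n" for k
        using that
      proof (induction "ht k" arbitrary: k rule: less_induct)
        case less
        have "(\<Sum>j<?n. T0 $$ (k, j) * v $ j) = 0"
          using arg_cong[OF v(3), of "\<lambda>w. w $ k"] T0 v(1) less.prems
          by (simp add: scalar_prod_def lessThan_atLeast0)
        moreover have "T0 $$ (k, j) * v $ j = (if j = k then v $ k else 0)" if "j < ?n" for j
          using that less ht_less by (auto simp: T0_entry)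
        ultimately have "(\<Sum>j<?n. if j = k then v $ k else 0) = 0" by simp
        then show ?case using less.prems by simp
      qed
      then have "v = 0\<^sub>v ?n" using v(1) by (intro eq_vecI) auto
      then show False using v by simp
    qed
    then have "fps_nth (det T) 0 \<noteq> 0" using h.hom_det[of T] by (simp add: T0_def)
    then have inv: "det T * inverse (det T) = 1" using inverse_mult_eq_1 by (metis mult.commute)
    define x where "x j = inverse (det T) * adj_mat T $$ (j, i)" for j
    have adj: "adj_mat T \<in> carrier_mat ?n ?n" "T * adj_mat T = det T \<cdot>\<^sub>m 1\<^sub>m ?n"
      using adj_mat[OF T] by auto
    have "(\<Sum>j<?n. M $$ (k, j) * x j * fps_X ^ c (A ! i) (A ! j) (A ! k)) = (if k = i then 1 else 0)" if k: "k < ?n" for k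
    proof -
      have "(\<Sum>j<?n. M $$ (k, j) * x j * fps_X ^ c (A ! i) (A ! j) (A ! k))
         = inverse (det T) * (\<Sum>j<?n. T $$ (k, j) * adj_mat T $$ (j, i))"
        unfolding sum_distrib_left using k by (intro sum.cong) (auto simp: T_def x_def algebra_simps)
      also have "(\<Sum>j<?n. T $$ (k, j) * adj_mat T $$ (j, i)) = (T * adj_mat T) $$ (k, i)"
        using mult_index[OF T adj(1) k i] by simp
      also have "inverse (det T) * \<dots> = (if k = i then 1 else 0)"
        using adj(2) k i inv by (simp add: mult.commute)
      finally show ?thesis .
    qed
    then show ?thesis by blast
  qed
  then have "\<forall>i\<in>{..<?n}. \<exists>x. \<forall>k<?n. (\<Sum>j<?n. M $$ (k, j) * x j * fps_X ^ c (A ! i) (A ! j) (A ! k)) = (if k = i then 1 else 0)"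
    by simp
  from bchoice[OF this] obtain x where x: "\<And>i k. i < ?n \<Longrightarrow> k < ?n \<Longrightarrow>
      (\<Sum>j<?n. M $$ (k, j) * x i j * fps_X ^ c (A ! i) (A ! j) (A ! k)) = (if k = i then 1 else 0)"
    by auto
  define N where "N = mat ?n ?n (\<lambda>(j, i). x i j)"
  have "twist_mult c A A A M N = 1\<^sub>m ?n"
    using x by (intro eq_matI) (auto simp: twist_mult_def N_def)
  then show thesis using that[of N] by (simp add: N_def)
qed

lemma inverse_if_red_one:
  assumes A: "A \<in> lists \<X>" and M: "M \<in> carrier_mat (length A) (length A)"
    and red: "red A A M = 1\<^sub>m (length A)"
  obtains N where "N \<in> carrier_mat (length A) (length A)" "twist_mult c A A A M N = 1\<^sub>m (length A)"
    "twist_mult c A A A N M = 1\<^sub>m (length A)"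
proof -
  obtain N where N: "N \<in> carrier_mat (length A) (length A)" "twist_mult c A A A M N = 1\<^sub>m (length A)"
    using right_inverse_if_red_one[OF A M red] .
  have "red A A M * red A A N = 1\<^sub>m (length A)"
    using red_twist_mult[OF A A A, of M N] N(2) red_one[OF A] by simp
  then have "red A A N = 1\<^sub>m (length A)" using red gradedD[OF graded_red[of A A N]] by simp
  then obtain L where L: "L \<in> carrier_mat (length A) (length A)" "twist_mult c A A A N L = 1\<^sub>m (length A)"
    using right_inverse_if_red_one[OF A N(1)] by blast
  have "M = twist_mult c A A A M (twist_mult c A A A N L)"
    using L twist_mult_one[OF A A M] by simp
  also have "\<dots> = L"
    using twist_mult_assoc[OF A A A A, of M N L] N twist_mult_one[OF A A L(1)] by simp
  finally show thesis using that N L by blast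
qed

text \<open>
  Composing with the constant lift of the inverse of the reduction, on either side, gives an endomorphism
  with reduction \<open>1\<close>.
\<close>

lemma inverse_if_red_invertible:
  assumes A: "A \<in> lists \<X>" and B: "B \<in> lists \<X>" and M: "M \<in> carrier_mat (length B) (length A)"
    and K: "graded B A K" "K * red A B M = 1\<^sub>m (length A)" "red A B M * K = 1\<^sub>m (length B)"
  obtains N where "N \<in> carrier_mat (length A) (length B)" "twist_mult c A B A N M = 1\<^sub>m (length A)"
    "twist_mult c B A B M N = 1\<^sub>m (length B)"
proof -
  have "red A A (twist_mult c A B A (const K) M) = 1\<^sub>m (length A)"
    using red_twist_mult[OF A B A] K red_const[OF K(1)] by simp
  from inverse_if_red_one[OF A _ this]
  obtain P where P: "P \<in> carrier_mat (length A) (length A)"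
    "twist_mult c A A A P (twist_mult c A B A (const K) M) = 1\<^sub>m (length A)" by auto
  have "red B B (twist_mult c B A B M (const K)) = 1\<^sub>m (length B)"
    using red_twist_mult[OF B A B] K red_const[OF K(1)] by simp
  from inverse_if_red_one[OF B _ this]
  obtain Q where Q: "Q \<in> carrier_mat (length B) (length B)"
    "twist_mult c B B B (twist_mult c B A B M (const K)) Q = 1\<^sub>m (length B)" by auto
  define N where "N = twist_mult c B A A P (const K)"
  have N: "N \<in> carrier_mat (length A) (length B)" by (simp add: N_def)
  have left: "twist_mult c A B A N M = 1\<^sub>m (length A)"
    using P twist_mult_assoc[OF A B A A] by (simp add: N_def)
  define N' where "N' = twist_mult c B B A (const K) Q"
  have N': "N' \<in> carrier_mat (length A) (length B)" by (simp add: N'_def)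
  have right: "twist_mult c B A B M N' = 1\<^sub>m (length B)"
    using Q twist_mult_assoc[OF B B A B] by (simp add: N'_def)
  have "N = twist_mult c B B A N (twist_mult c B A B M N')"
    using right twist_mult_one[OF B A N] by simp
  also have "\<dots> = N'" using left twist_mult_assoc[OF B A B A, of N M N'] twist_mult_one[OF B A N'] by simp
  finally show thesis using that N left right by simp
qed

end

section \<open>Averaging\<close>

text \<open>
  With \<open>s = 1 / card S\<close> this is the average of the matrices \<open>f x\<close>. The dimensions are arguments
  because matrices of varying size have no common zero.
\<close>

definition wsum :: "'r::comm_ring_1 \<Rightarrow> nat \<Rightarrow> nat \<Rightarrow> 's set \<Rightarrow> ('s \<Rightarrow> 'r mat) \<Rightarrow> 'r mat" where
  "wsum s n m S f = mat n m (\<lambda>ki. s * (\<Sum>x\<in>S. f x $$ ki))"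

lemma wsum_carrier [simp]: "wsum s n m S f \<in> carrier_mat n m"
  by (simp add: wsum_def)

lemma wsum_cong: "(\<And>x. x \<in> S \<Longrightarrow> f x = g x) \<Longrightarrow> wsum s n m S f = wsum s n m S g"
  by (simp add: wsum_def)

lemma wsum_reindex: "bij_betw h S T \<Longrightarrow> wsum s n m S (\<lambda>x. f (h x)) = wsum s n m T f"
  using sum.reindex_bij_betw[of h S T "\<lambda>x. f x $$ ki" for ki] by (simp add: wsum_def)

lemma wsum_average:
  assumes "finite S" "S \<noteq> {}" "M \<in> carrier_mat n m" "\<And>x. x \<in> S \<Longrightarrow> f x = M"
  shows "wsum (1 / of_nat (card S) :: complex) n m S f = M"
  using assms by (intro eq_matI) (auto simp: wsum_def)

lemma sum_scaled_sum:
  "(\<Sum>j<b. u j * (s * (\<Sum>x\<in>S. f x j)) * v j) = (s :: 'r :: comm_ring_1) * (\<Sum>x\<in>S. \<Sum>j<(b::nat). u j * f x j * v j)"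
proof -
  have "(\<Sum>j<b. u j * (s * (\<Sum>x\<in>S. f x j)) * v j) = (\<Sum>j<b. \<Sum>x\<in>S. s * (u j * f x j * v j))"
    by (simp add: sum_distrib_left sum_distrib_right mult_ac)
  also have "\<dots> = (\<Sum>x\<in>S. \<Sum>j<b. s * (u j * f x j * v j))" by (rule sum.swap)
  finally show ?thesis by (simp add: sum_distrib_left)
qed

lemma mult_wsum:
  assumes N: "N \<in> carrier_mat a n" and f: "\<And>x. x \<in> S \<Longrightarrow> f x \<in> carrier_mat n m"
  shows "N * wsum s n m S f = wsum s a m S (\<lambda>x. N * f x)"
proof (rule eq_matI)
  fix k i assume "k < dim_row (wsum s a m S (\<lambda>x. N * f x))" "i < dim_col (wsum s a m S (\<lambda>x. N * f x))"
  then have ki: "k < a" "i < m" by (auto simp: wsum_def)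
  then show "(N * wsum s n m S f) $$ (k, i) = wsum s a m S (\<lambda>x. N * f x) $$ (k, i)"
    using mult_index[OF N wsum_carrier[of s n m S f] ki] mult_index[OF N f ki]
      sum_scaled_sum[where b = n and u = "\<lambda>j. N $$ (k, j)" and s = s and S = S and f = "\<lambda>x j. f x $$ (j, i)" and v = "\<lambda>_. 1"]
    by (simp add: wsum_def)
qed (use N in \<open>auto simp: wsum_def\<close>)

lemma wsum_mult:
  assumes N: "N \<in> carrier_mat m b" and f: "\<And>x. x \<in> S \<Longrightarrow> f x \<in> carrier_mat n m"
  shows "wsum s n m S f * N = wsum s n b S (\<lambda>x. f x * N)"
proof (rule eq_matI)
  fix k i assume "k < dim_row (wsum s n b S (\<lambda>x. f x * N))" "i < dim_col (wsum s n b S (\<lambda>x. f x * N))"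
  then have ki: "k < n" "i < b" by (auto simp: wsum_def)
  then show "(wsum s n m S f * N) $$ (k, i) = wsum s n b S (\<lambda>x. f x * N) $$ (k, i)"
    using mult_index[OF wsum_carrier[of s n m S f] N ki] mult_index[OF f N ki]
      sum_scaled_sum[where b = m and u = "\<lambda>_. 1" and s = s and S = S and f = "\<lambda>x j. f x $$ (k, j)" and v = "\<lambda>j. N $$ (j, i)"]
    by (simp add: wsum_def)
qed (use N in \<open>auto simp: wsum_def\<close>)

lemma twist_mult_wsum_right:
  "twist_mult c A B D N (wsum s (length B) (length A) S f) = wsum s (length D) (length A) S (\<lambda>x. twist_mult c A B D N (f x))"
  by (intro eq_matI) (auto simp: wsum_def twist_mult_def sum_scaled_sum)

lemma twist_mult_wsum_left:
  "twist_mult c A B D (wsum s (length D) (length B) S f) M = wsum s (length D) (length A) S (\<lambda>x. twist_mult c A B D (f x) M)"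
proof (rule eq_matI)
  fix k i assume "k < dim_row (wsum s (length D) (length A) S (\<lambda>x. twist_mult c A B D (f x) M))"
    "i < dim_col (wsum s (length D) (length A) S (\<lambda>x. twist_mult c A B D (f x) M))"
  then have ki: "k < length D" "i < length A" by (auto simp: wsum_def)
  then show "twist_mult c A B D (wsum s (length D) (length B) S f) M $$ (k, i) =
     wsum s (length D) (length A) S (\<lambda>x. twist_mult c A B D (f x) M) $$ (k, i)"
    using sum_scaled_sum[where b = "length B" and u = "\<lambda>_. 1" and s = s and S = S and f = "\<lambda>x j. f x $$ (k, j)" and v = "\<lambda>j. M $$ (j, i) * fps_X ^ c (A ! i) (B ! j) (D ! k)"]
    by (simp add: wsum_def twist_mult_index mult.assoc)
qed (auto simp: wsum_def twist_mult_def)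

lemma (in cyc_poset) red_wsum:
  "red A B (wsum (fps_const s) (length B) (length A) S f) = wsum s (length B) (length A) S (\<lambda>x. red A B (f x))"
  by (intro eq_matI) (auto simp: red_def wsum_def fps_sum_nth)

lemma (in cyc_poset) graded_wsum:
  assumes "\<And>x. x \<in> S \<Longrightarrow> graded A B (f x)"
  shows "graded A B (wsum s (length B) (length A) S f)"
  by (intro gradedI) (simp_all add: wsum_def gradedE[OF assms])

section \<open>Equivariant objects\<close>

locale cyc_poset_action = cyc_poset \<X> c + group G
  for \<X> :: "'x set" and c and G :: "'g monoid" (structure) +
  fixes \<phi> :: "'g \<Rightarrow> 'x \<Rightarrow> 'x"
  assumes act: "group_action G \<X> \<phi>" and fin: "finite (carrier G)"
    and c_act: "\<And>g X Y Z. g \<in> carrier G \<Longrightarrow> X \<in> \<X> \<Longrightarrow> Y \<in> \<X> \<Longrightarrow> Z \<in> \<X> \<Longrightarrow> c (\<phi> g X) (\<phi> g Y) (\<phi> g Z) = c X Y Z"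
begin

lemma act_in [simp]: "g \<in> carrier G \<Longrightarrow> X \<in> \<X> \<Longrightarrow> \<phi> g X \<in> \<X>"
  using group_action.element_image[OF act] by blast

lemma act_mult: "\<alpha> \<in> carrier G \<Longrightarrow> \<beta> \<in> carrier G \<Longrightarrow> X \<in> \<X> \<Longrightarrow> \<phi> (\<alpha> \<otimes> \<beta>) X = \<phi> \<alpha> (\<phi> \<beta> X)"
  using group_action.composition_rule[OF act] by blast

lemma act_one [simp]: "X \<in> \<X> \<Longrightarrow> \<phi> \<one> X = X"
  using group_action.id_eq_one[OF act] by (metis restrict_apply)

lemma cp_iso_act [simp]: "g \<in> carrier G \<Longrightarrow> X \<in> \<X> \<Longrightarrow> Y \<in> \<X> \<Longrightarrow> cp_iso c (\<phi> g X) (\<phi> g Y) \<longleftrightarrow> cp_iso c X Y"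
  by (simp add: cp_iso_def c_act)

abbreviation act_list :: "'g \<Rightarrow> 'x list \<Rightarrow> 'x list" (infixr "\<cdot>" 75) where
  "g \<cdot> A \<equiv> act_ob \<phi> g A"

lemma length_act [simp]: "length (g \<cdot> A) = length A" by (simp add: act_ob_def)

lemma nth_act: "i < length A \<Longrightarrow> (g \<cdot> A) ! i = \<phi> g (A ! i)" by (simp add: act_ob_def)

lemma act_list_in [simp]: "g \<in> carrier G \<Longrightarrow> A \<in> lists \<X> \<Longrightarrow> g \<cdot> A \<in> lists \<X>"
  by (auto simp: act_ob_def)

lemma act_list_mult: "\<alpha> \<in> carrier G \<Longrightarrow> \<beta> \<in> carrier G \<Longrightarrow> A \<in> lists \<X> \<Longrightarrow> (\<alpha> \<otimes> \<beta>) \<cdot> A = \<alpha> \<cdot> (\<beta> \<cdot> A)"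
  by (auto simp: act_ob_def act_mult)

lemma act_list_one [simp]: "A \<in> lists \<X> \<Longrightarrow> \<one> \<cdot> A = A"
  by (auto simp: act_ob_def intro!: map_idI)

lemma act_list_cancel [simp]:
  "\<alpha> \<in> carrier G \<Longrightarrow> A \<in> lists \<X> \<Longrightarrow> \<alpha> \<cdot> (inv \<alpha> \<cdot> A) = A"
  "\<alpha> \<in> carrier G \<Longrightarrow> A \<in> lists \<X> \<Longrightarrow> inv \<alpha> \<cdot> (\<alpha> \<cdot> A) = A"
  by (simp_all flip: act_list_mult)

lemma graded_act:
  assumes "g \<in> carrier G" "A \<in> lists \<X>" "B \<in> lists \<X>"
  shows "graded (g \<cdot> A) (g \<cdot> B) M \<longleftrightarrow> graded A B M"
  using assms nth_in by (auto simp: graded_def nth_act)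

lemma red_act:
  assumes "g \<in> carrier G" "A \<in> lists \<X>" "B \<in> lists \<X>"
  shows "red (g \<cdot> A) (g \<cdot> B) M = red A B M"
  using assms nth_in by (auto simp: red_def nth_act)

lemma twist_mult_act:
  assumes "g \<in> carrier G" "A \<in> lists \<X>" "B \<in> lists \<X>" "D \<in> lists \<X>"
  shows "twist_mult c (g \<cdot> A) (g \<cdot> B) (g \<cdot> D) N M = twist_mult c A B D N M"
proof -
  have "c ((g \<cdot> A) ! i) ((g \<cdot> B) ! j) ((g \<cdot> D) ! k) = c (A ! i) (B ! j) (D ! k)"
    if "i < length A" "j < length B" "k < length D" for i j k
    using that assms nth_in by (simp add: nth_act c_act)
  then show ?thesis by (intro eq_matI) (auto simp: twist_mult_def)
qed

text \<open>
  Used to read a composite that ends in a translate \<open>g \<cdot> D\<close> as a translate of a composite that ends in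
  \<open>D\<close>, where the cocycle condition for structure isomorphisms applies.
\<close>

lemma twist_mult_act_inv:
  assumes "g \<in> carrier G" "A \<in> lists \<X>" "B \<in> lists \<X>" "D \<in> lists \<X>"
  shows "twist_mult c A B (g \<cdot> D) N M = twist_mult c (inv g \<cdot> A) (inv g \<cdot> B) D N M"
  using twist_mult_act[of "inv g" A B "g \<cdot> D"] assms by simp

text \<open>
  The data of an object of the equivariant category: the structure isomorphism for \<open>g\<close> is
  \<open>(g \<cdot> A, A, m g)\<close>. Given the cocycle condition, invertibility of all \<open>m g\<close> amounts to the
  normalization at \<open>\<one>\<close>: the inverse of \<open>m g\<close> is \<open>m (inv g)\<close>, and an invertible idempotent is the
  identity.
\<close>

definition equivariant :: "'x list \<Rightarrow> ('g \<Rightarrow> complex fps mat) \<Rightarrow> bool" where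
  "equivariant A m \<longleftrightarrow> A \<in> lists \<X> \<and> (\<forall>g\<in>carrier G. m g \<in> carrier_mat (length A) (length A)) \<and>
     (\<forall>\<alpha>\<in>carrier G. \<forall>\<beta>\<in>carrier G. m (\<alpha> \<otimes> \<beta>) = twist_mult c ((\<alpha> \<otimes> \<beta>) \<cdot> A) (\<alpha> \<cdot> A) A (m \<alpha>) (m \<beta>)) \<and>
     m \<one> = 1\<^sub>m (length A)"

definition obj :: "'x list \<Rightarrow> ('g \<Rightarrow> complex fps mat) \<Rightarrow> 'x list \<times> ('g \<Rightarrow> ('x, complex fps) cp_mor)" where
  "obj A m = (A, \<lambda>g\<in>carrier G. (g \<cdot> A, A, m g))"

abbreviation FG where "FG \<equiv> \<F>G G \<phi> \<X> c"

lemma FG_simps: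
  "Comp FG = Comp (\<F> \<X> c)" "Add FG = Add (\<F> \<X> c)"
  "Idn FG (obj A m) = (A, A, 1\<^sub>m (length A))"
  "Zer FG (obj A m) (obj B m') = (A, B, 0\<^sub>m (length B) (length A))"
  by (simp_all add: \<F>G_def equivariant_category_def obj_def Idn_F Zer_F)

lemma equivariantD:
  assumes "equivariant A m"
  shows "A \<in> lists \<X>" "g \<in> carrier G \<Longrightarrow> m g \<in> carrier_mat (length A) (length A)"
    "\<alpha> \<in> carrier G \<Longrightarrow> \<beta> \<in> carrier G \<Longrightarrow> m (\<alpha> \<otimes> \<beta>) = twist_mult c ((\<alpha> \<otimes> \<beta>) \<cdot> A) (\<alpha> \<cdot> A) A (m \<alpha>) (m \<beta>)"
    "m \<one> = 1\<^sub>m (length A)"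
  using assms by (auto simp: equivariant_def)

lemma obj_in_FG:
  assumes m: "equivariant A m"
  shows "obj A m \<in> Ob FG"
proof -
  note D = equivariantD[OF m]
  have "isomorphism (\<F> \<X> c) (g \<cdot> A) A (g \<cdot> A, A, m g)" if g: "g \<in> carrier G" for g
  proof -
    have "twist_mult c (g \<cdot> A) A (g \<cdot> A) (m (inv g)) (m g) = 1\<^sub>m (length A)"
      using twist_mult_act_inv[of g "g \<cdot> A" A A] D(3)[of "inv g" g] D g by simp
    moreover have "twist_mult c A (g \<cdot> A) A (m g) (m (inv g)) = 1\<^sub>m (length A)"
      using D(3)[of g "inv g"] D g by simp
    ultimately show ?thesis using D g unfolding isomorphism_def
      by (intro conjI bexI[of _ "(A, g \<cdot> A, m (inv g))"]) (auto simp: Hom_F Comp_F Idn_F)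
  qed
  moreover have "Comp (\<F> \<X> c) (\<alpha> \<cdot> A, A, m \<alpha>) (act_mor \<phi> \<alpha> (\<beta> \<cdot> A, A, m \<beta>)) = ((\<alpha> \<otimes> \<beta>) \<cdot> A, A, m (\<alpha> \<otimes> \<beta>))"
    if "\<alpha> \<in> carrier G" "\<beta> \<in> carrier G" for \<alpha> \<beta>
    using that D by (simp add: act_mor_def Comp_F act_list_mult)
  ultimately show ?thesis using D
    by (auto simp: \<F>G_def equivariant_category_def obj_def Ob_F)
qed

lemma Ob_FG_obtain:
  assumes "P \<in> Ob FG"
  obtains A m where "equivariant A m" "P = obj A m"
proof -
  obtain A \<xi> where P: "P = (A, \<xi>)" by fastforce
  have A: "A \<in> lists \<X>"
    and \<xi>: "\<xi> \<in> (\<Pi>\<^sub>E g\<in>carrier G. {f. isomorphism (\<F> \<X> c) (g \<cdot> A) A f})"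
    and coc: "\<And>\<alpha> \<beta>. \<alpha> \<in> carrier G \<Longrightarrow> \<beta> \<in> carrier G \<Longrightarrow> \<xi> (\<alpha> \<otimes> \<beta>) = Comp (\<F> \<X> c) (\<xi> \<alpha>) (act_mor \<phi> \<alpha> (\<xi> \<beta>))"
    using assms unfolding P by (simp_all add: \<F>G_def equivariant_category_def Ob_F)
  define m where "m g = snd (snd (\<xi> g))" for g
  have iso: "isomorphism (\<F> \<X> c) (g \<cdot> A) A (\<xi> g)" if "g \<in> carrier G" for g
    using \<xi> that by auto
  have \<xi>_eq: "\<xi> g = (g \<cdot> A, A, m g)" and m: "m g \<in> carrier_mat (length A) (length A)" if "g \<in> carrier G" for g
    using iso[OF that] by (auto simp: isomorphism_def Hom_F m_def)
  have mult: "m (\<alpha> \<otimes> \<beta>) = twist_mult c ((\<alpha> \<otimes> \<beta>) \<cdot> A) (\<alpha> \<cdot> A) A (m \<alpha>) (m \<beta>)"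
    if "\<alpha> \<in> carrier G" "\<beta> \<in> carrier G" for \<alpha> \<beta>
    using coc[OF that] that A by (simp add: \<xi>_eq act_mor_def Comp_F act_list_mult)
  obtain N where N: "N \<in> carrier_mat (length A) (length A)" "twist_mult c A A A N (m \<one>) = 1\<^sub>m (length A)"
    using iso[OF one_closed] A by (auto simp: isomorphism_def Hom_F \<xi>_eq Comp_F Idn_F)
  have "m \<one> = twist_mult c A A A (twist_mult c A A A N (m \<one>)) (m \<one>)"
    using twist_mult_one(2)[OF A A m[OF one_closed]] N by simp
  also have "\<dots> = twist_mult c A A A N (twist_mult c A A A (m \<one>) (m \<one>))"
    using twist_mult_assoc A by simp
  also have "\<dots> = 1\<^sub>m (length A)" using mult[OF one_closed one_closed] A N by simp
  finally have "m \<one> = 1\<^sub>m (length A)" .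
  then have "equivariant A m" using A m mult by (auto simp: equivariant_def)
  moreover have "P = obj A m"
    using \<xi> \<xi>_eq by (auto simp: P obj_def PiE_iff extensional_def fun_eq_iff)
  ultimately show thesis using that by blast
qed

definition eq_hom :: "'x list \<Rightarrow> ('g \<Rightarrow> complex fps mat) \<Rightarrow> 'x list \<Rightarrow> ('g \<Rightarrow> complex fps mat) \<Rightarrow> complex fps mat \<Rightarrow> bool" where
  "eq_hom A m B m' M \<longleftrightarrow> M \<in> carrier_mat (length B) (length A) \<and>
     (\<forall>g\<in>carrier G. twist_mult c (g \<cdot> A) A B M (m g) = twist_mult c (g \<cdot> A) (g \<cdot> B) B (m' g) M)"

lemma Hom_FG: "f \<in> Hom FG (obj A m) (obj B m') \<longleftrightarrow> (\<exists>M. eq_hom A m B m' M \<and> f = (A, B, M))"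
  by (auto simp: \<F>G_def equivariant_category_def obj_def Hom_F eq_hom_def Comp_F act_mor_def)

lemma eq_hom_inverse:
  assumes A: "equivariant A m" and B: "equivariant B m'" and M: "eq_hom A m B m' M"
    and N: "N \<in> carrier_mat (length A) (length B)" "twist_mult c A B A N M = 1\<^sub>m (length A)"
     "twist_mult c B A B M N = 1\<^sub>m (length B)"
  shows "eq_hom B m' A m N"
  unfolding eq_hom_def
proof (intro conjI ballI)
  fix g assume g: "g \<in> carrier G"
  note [simp] = equivariantD(1)[OF A] equivariantD(1)[OF B]
  have mc: "m g \<in> carrier_mat (length A) (length A)" "m' g \<in> carrier_mat (length B) (length B)"
    using equivariantD(2) A B g by auto
  let ?Ng = "twist_mult c (g \<cdot> B) B A N (m' g)"
  have "?Ng = twist_mult c (g \<cdot> B) (g \<cdot> B) A ?Ng (twist_mult c (g \<cdot> B) (g \<cdot> A) (g \<cdot> B) M N)"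
    using N twist_mult_one(1)[of "g \<cdot> B" A ?Ng] g twist_mult_act[of g B A B M N] mc by simp
  also have "\<dots> = twist_mult c (g \<cdot> B) (g \<cdot> A) A (twist_mult c (g \<cdot> A) (g \<cdot> B) A ?Ng M) N"
    using g by (simp add: twist_mult_assoc)
  also have "twist_mult c (g \<cdot> A) (g \<cdot> B) A ?Ng M = twist_mult c (g \<cdot> A) B A N (twist_mult c (g \<cdot> A) (g \<cdot> B) B (m' g) M)"
    using g by (simp add: twist_mult_assoc)
  also have "\<dots> = twist_mult c (g \<cdot> A) B A N (twist_mult c (g \<cdot> A) A B M (m g))"
    using M g by (simp add: eq_hom_def)
  also have "\<dots> = m g"
    using g N mc twist_mult_one(2)[of "g \<cdot> A" A "m g"] by (simp add: twist_mult_assoc)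
  finally show "?Ng = twist_mult c (g \<cdot> B) (g \<cdot> A) A (m g) N" .
qed (fact N(1))

lemma isomorphismI:
  assumes A: "equivariant A m" and B: "equivariant B m'" and M: "eq_hom A m B m' M"
    and N: "N \<in> carrier_mat (length A) (length B)" "twist_mult c A B A N M = 1\<^sub>m (length A)"
     "twist_mult c B A B M N = 1\<^sub>m (length B)"
  shows "isomorphism FG (obj A m) (obj B m') (A, B, M)"
  using eq_hom_inverse[OF assms] M N unfolding isomorphism_def
  by (intro conjI bexI[of _ "(B, A, N)"]) (auto simp: Hom_FG FG_simps Comp_F)

section \<open>Constant objects\<close>

text \<open>
  A complex representation of \<open>G\<close> with a system of imprimitivity: \<open>\<Xi> g\<close> maps the block of an
  isomorphism class in \<open>A\<close> to the block of its translate by \<open>g\<close>.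
\<close>

definition graded_rep :: "'x list \<Rightarrow> ('g \<Rightarrow> complex mat) \<Rightarrow> bool" where
  "graded_rep A \<Xi> \<longleftrightarrow> A \<in> lists \<X> \<and> (\<forall>g\<in>carrier G. graded (g \<cdot> A) A (\<Xi> g)) \<and>
     (\<forall>\<alpha>\<in>carrier G. \<forall>\<beta>\<in>carrier G. \<Xi> (\<alpha> \<otimes> \<beta>) = \<Xi> \<alpha> * \<Xi> \<beta>) \<and> \<Xi> \<one> = 1\<^sub>m (length A)"

definition graded_hom :: "'x list \<Rightarrow> ('g \<Rightarrow> complex mat) \<Rightarrow> 'x list \<Rightarrow> ('g \<Rightarrow> complex mat) \<Rightarrow> complex mat \<Rightarrow> bool" where
  "graded_hom A \<Xi> B \<Omega> M \<longleftrightarrow> graded A B M \<and> (\<forall>g\<in>carrier G. M * \<Xi> g = \<Omega> g * M)"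

definition cobj :: "'x list \<Rightarrow> ('g \<Rightarrow> complex mat) \<Rightarrow> 'x list \<times> ('g \<Rightarrow> ('x, complex fps) cp_mor)" where
  "cobj A \<Xi> = obj A (\<lambda>g. const (\<Xi> g))"

lemma graded_repD:
  assumes "graded_rep A \<Xi>"
  shows "A \<in> lists \<X>" "g \<in> carrier G \<Longrightarrow> graded (g \<cdot> A) A (\<Xi> g)"
    "g \<in> carrier G \<Longrightarrow> \<Xi> g \<in> carrier_mat (length A) (length A)"
    "\<alpha> \<in> carrier G \<Longrightarrow> \<beta> \<in> carrier G \<Longrightarrow> \<Xi> (\<alpha> \<otimes> \<beta>) = \<Xi> \<alpha> * \<Xi> \<beta>"
    "\<Xi> \<one> = 1\<^sub>m (length A)"
proof -
  show "g \<in> carrier G \<Longrightarrow> \<Xi> g \<in> carrier_mat (length A) (length A)"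
    using assms gradedD by (fastforce simp: graded_rep_def)
qed (use assms in \<open>auto simp: graded_rep_def\<close>)

lemma graded_homD:
  assumes "graded_hom A \<Xi> B \<Omega> M"
  shows "graded A B M" "M \<in> carrier_mat (length B) (length A)" "g \<in> carrier G \<Longrightarrow> M * \<Xi> g = \<Omega> g * M"
  using assms gradedD by (auto simp: graded_hom_def)

lemma equivariant_const:
  assumes "graded_rep A \<Xi>"
  shows "equivariant A (\<lambda>g. const (\<Xi> g))"
proof -
  note D = graded_repD[OF assms]
  have "const (\<Xi> (\<alpha> \<otimes> \<beta>)) = twist_mult c ((\<alpha> \<otimes> \<beta>) \<cdot> A) (\<alpha> \<cdot> A) A (const (\<Xi> \<alpha>)) (const (\<Xi> \<beta>))"
    if "\<alpha> \<in> carrier G" "\<beta> \<in> carrier G" for \<alpha> \<beta>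
  proof -
    have "graded (\<alpha> \<cdot> \<beta> \<cdot> A) (\<alpha> \<cdot> A) (\<Xi> \<beta>)" using D that by (simp add: graded_act)
    then show ?thesis using D that by (simp add: twist_mult_const act_list_mult)
  qed
  moreover have "const (\<Xi> \<one>) = 1\<^sub>m (length A)" using D by (auto intro!: eq_matI)
  ultimately show ?thesis using D by (simp add: equivariant_def)
qed

lemma cobj_in_FG: "graded_rep A \<Xi> \<Longrightarrow> cobj A \<Xi> \<in> Ob FG"
  by (simp add: cobj_def obj_in_FG equivariant_const)

lemma graded_rep_red:
  assumes "equivariant A m"
  shows "graded_rep A (\<lambda>g. red (g \<cdot> A) A (m g))"
proof -
  note D = equivariantD[OF assms]
  show ?thesis using D
    by (simp add: graded_rep_def graded_red red_one red_twist_mult act_list_mult red_act)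
qed

lemma eq_hom_const:
  assumes A: "graded_rep A \<Xi>" and B: "graded_rep B \<Omega>" and M: "graded_hom A \<Xi> B \<Omega> M"
  shows "eq_hom A (\<lambda>g. const (\<Xi> g)) B (\<lambda>g. const (\<Omega> g)) (const M)"
proof -
  note A' = graded_repD[OF A] and B' = graded_repD[OF B]
  have M': "graded A B M" "\<And>g. g \<in> carrier G \<Longrightarrow> M * \<Xi> g = \<Omega> g * M" using M by (auto simp: graded_hom_def)
  show ?thesis unfolding eq_hom_def
    using A' B' M' gradedD[OF M'(1)] by (simp add: twist_mult_const graded_act)
qed

lemma graded_hom_red:
  assumes A: "graded_rep A \<Xi>" and B: "graded_rep B \<Omega>"
    and M: "eq_hom A (\<lambda>g. const (\<Xi> g)) B (\<lambda>g. const (\<Omega> g)) M"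
  shows "graded_hom A \<Xi> B \<Omega> (red A B M)"
  unfolding graded_hom_def
proof (intro conjI ballI graded_red)
  note A' = graded_repD[OF A] and B' = graded_repD[OF B]
  fix g assume g: "g \<in> carrier G"
  have "red (g \<cdot> A) B (twist_mult c (g \<cdot> A) A B M (const (\<Xi> g))) =
      red (g \<cdot> A) B (twist_mult c (g \<cdot> A) (g \<cdot> B) B (const (\<Omega> g)) M)"
    using M g by (simp add: eq_hom_def)
  then show "red A B M * \<Xi> g = \<Omega> g * red A B M"
    using A' B' g by (simp add: red_twist_mult red_const red_act)
qed

text \<open>
  Here \<open>m (inv g)\<close>, read as a morphism \<open>A \<rightarrow> g \<cdot> A\<close>, is the inverse of the structure isomorphism \<open>m g\<close>. The
  average \<open>P\<close> of the composites \<open>\<Xi> g \<circ> (m g)\<^sup>-\<^sup>1\<close> intertwines \<open>m\<close> with \<open>\<Xi>\<close> because translation by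
  \<open>\<beta>\<close> permutes the summands. Each summand reduces to \<open>1\<close>, hence so does \<open>P\<close>, and \<open>P\<close> is invertible.
\<close>

lemma isomorphic_const_red:
  assumes m: "equivariant A m"
  shows "isomorphic FG (obj A m) (cobj A (\<lambda>g. red (g \<cdot> A) A (m g)))"
proof -
  note D = equivariantD[OF m]
  let ?n = "length A"
  define \<Xi> where "\<Xi> = (\<lambda>g. red (g \<cdot> A) A (m g))"
  have rep: "graded_rep A \<Xi>" unfolding \<Xi>_def by (rule graded_rep_red[OF m])
  note R = graded_repD[OF rep]
  have C: "equivariant A (\<lambda>g. const (\<Xi> g))" by (rule equivariant_const[OF rep])
  define p where "p g = twist_mult c A (g \<cdot> A) A (const (\<Xi> g)) (m (inv g))" for g
  define P where "P = wsum (fps_const (1 / of_nat (card (carrier G)))) ?n ?n (carrier G) p"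
  have P: "P \<in> carrier_mat ?n ?n" by (simp add: P_def)
  have "red A A (p g) = 1\<^sub>m ?n" if "g \<in> carrier G" for g
  proof -
    have "red A (g \<cdot> A) (m (inv g)) = \<Xi> (inv g)"
      using red_act[of "inv g" A "g \<cdot> A" "m (inv g)"] D that by (simp add: \<Xi>_def)
    then show ?thesis
      using R(4)[of g "inv g"] R D that by (simp add: p_def red_twist_mult red_const)
  qed
  then have "red A A P = 1\<^sub>m ?n"
    unfolding P_def red_wsum using fin one_closed by (intro wsum_average) auto
  from inverse_if_red_one[OF D(1) P this]
  obtain N where N: "N \<in> carrier_mat ?n ?n" "twist_mult c A A A P N = 1\<^sub>m ?n" "twist_mult c A A A N P = 1\<^sub>m ?n"
    by blast
  have "eq_hom A m A (\<lambda>g. const (\<Xi> g)) P"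
    unfolding eq_hom_def
  proof (intro conjI P ballI)
    fix \<beta> assume \<beta>: "\<beta> \<in> carrier G"
    define q where "q g = twist_mult c (\<beta> \<cdot> A) (g \<cdot> A) A (const (\<Xi> g)) (m (inv g \<otimes> \<beta>))" for g
    have 1: "twist_mult c (\<beta> \<cdot> A) A A (p g) (m \<beta>) = q g" if g: "g \<in> carrier G" for g
    proof -
      have "twist_mult c (\<beta> \<cdot> A) A A (p g) (m \<beta>) =
          twist_mult c (\<beta> \<cdot> A) (g \<cdot> A) A (const (\<Xi> g)) (twist_mult c (\<beta> \<cdot> A) A (g \<cdot> A) (m (inv g)) (m \<beta>))"
        using g \<beta> D by (simp add: p_def twist_mult_assoc)
      also have "twist_mult c (\<beta> \<cdot> A) A (g \<cdot> A) (m (inv g)) (m \<beta>) = m (inv g \<otimes> \<beta>)"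
        using twist_mult_act_inv[of g "\<beta> \<cdot> A" A A] g \<beta> D by (simp add: act_list_mult)
      finally show ?thesis by (simp add: q_def)
    qed
    have 2: "twist_mult c (\<beta> \<cdot> A) (\<beta> \<cdot> A) A (const (\<Xi> \<beta>)) (p g) = q (\<beta> \<otimes> g)" if g: "g \<in> carrier G" for g
    proof -
      have "p g = twist_mult c (\<beta> \<cdot> A) (\<beta> \<cdot> g \<cdot> A) (\<beta> \<cdot> A) (const (\<Xi> g)) (m (inv g))"
        using g \<beta> D by (simp add: p_def twist_mult_act)
      then have "twist_mult c (\<beta> \<cdot> A) (\<beta> \<cdot> A) A (const (\<Xi> \<beta>)) (p g) =
         twist_mult c (\<beta> \<cdot> A) (\<beta> \<cdot> g \<cdot> A) A (twist_mult c (\<beta> \<cdot> g \<cdot> A) (\<beta> \<cdot> A) A (const (\<Xi> \<beta>)) (const (\<Xi> g))) (m (inv g))"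
        using g \<beta> D by (simp add: twist_mult_assoc)
      also have "twist_mult c (\<beta> \<cdot> g \<cdot> A) (\<beta> \<cdot> A) A (const (\<Xi> \<beta>)) (const (\<Xi> g)) = const (\<Xi> (\<beta> \<otimes> g))"
        using equivariantD(3)[OF C \<beta> g] \<beta> g D by (simp add: act_list_mult)
      also have "inv g = inv (\<beta> \<otimes> g) \<otimes> \<beta>" using \<beta> g by (simp add: inv_mult_group m_assoc)
      finally show ?thesis using \<beta> g D by (simp add: q_def act_list_mult)
    qed
    have bij: "bij_betw (\<lambda>g. \<beta> \<otimes> g) (carrier G) (carrier G)"
      using \<beta> by (intro bij_betwI[where g = "\<lambda>g. inv \<beta> \<otimes> g"]) (auto simp: m_assoc[symmetric])
    let ?s = "fps_const (1 / of_nat (card (carrier G)) :: complex)"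
    have "twist_mult c (\<beta> \<cdot> A) A A P (m \<beta>) = wsum ?s ?n ?n (carrier G) q"
      using twist_mult_wsum_left[of c "\<beta> \<cdot> A" A A ?s "carrier G" p "m \<beta>"]
        wsum_cong[OF 1, of "carrier G" "\<lambda>g. g" ?s ?n ?n]
      by (simp add: P_def)
    also have "\<dots> = wsum ?s ?n ?n (carrier G) (\<lambda>g. q (\<beta> \<otimes> g))"
      by (rule wsum_reindex[OF bij, symmetric])
    also have "\<dots> = twist_mult c (\<beta> \<cdot> A) (\<beta> \<cdot> A) A (const (\<Xi> \<beta>)) P"
      using twist_mult_wsum_right[of c "\<beta> \<cdot> A" "\<beta> \<cdot> A" A "const (\<Xi> \<beta>)" ?s "carrier G" p]
        wsum_cong[OF 2, of "carrier G" "\<lambda>g. g" ?s ?n ?n]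
      by (simp add: P_def)
    finally show "twist_mult c (\<beta> \<cdot> A) A A P (m \<beta>) = twist_mult c (\<beta> \<cdot> A) (\<beta> \<cdot> A) A (const (\<Xi> \<beta>)) P" .
  qed
  then show ?thesis unfolding isomorphic_def cobj_def \<Xi>_def[symmetric]
    using isomorphismI[OF m C _ N(1) N(3) N(2)] by blast
qed

end

section \<open>Induced objects\<close>

lemma length_concat_replicate: "length (concat (map (\<lambda>s. replicate d (f s)) ss)) = length ss * d"
  by (induction ss) auto

lemma nth_concat_replicate:
  "p < length ss * d \<Longrightarrow> concat (map (\<lambda>s. replicate d (f s)) ss) ! p = f (ss ! (p div d))"
proof (induction ss arbitrary: p)
  case (Cons s ss)
  show ?case
  proof (cases "p < d")
    case True
    then show ?thesis by (simp add: nth_append)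
  next
    case False
    have "0 < d" using Cons.prems False by (cases d) auto
    then have "p div d = Suc ((p - d) div d)" using False by (simp add: le_div_geq)
    then show ?thesis using False Cons by (simp add: nth_append)
  qed
qed simp

lemma block_index_less: "p < n * d \<Longrightarrow> p div d < n \<and> p mod d < (d::nat)"
  by (metis less_mult_imp_div_less mod_less_divisor mult_0_right not_less_zero gr0I)

text \<open>
  A position \<open>q\<close> in the list underlying \<open>S\<^sub>\<rho> X\<close> stands for the copy \<open>q mod d\<close> of the translate of \<open>X\<close> by
  the representative \<open>q div d\<close>.
\<close>

lemma sum_blocks: "(\<Sum>q<n * d. f (q div d) (q mod d)) = (\<Sum>i<n. \<Sum>a<d. f i (a::nat))" for f :: "nat \<Rightarrow> nat \<Rightarrow> complex"
proof (cases "d = 0")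
  case False
  have "(\<Sum>q<n * d. f (q div d) (q mod d)) = (\<Sum>m<n. \<Sum>q\<in>{m * d..<m * d + d}. f (q div d) (q mod d))"
    by (rule sum.nat_group[symmetric])
  also have "\<dots> = (\<Sum>i<n. \<Sum>a<d. f i a)"
  proof (rule sum.cong[OF refl])
    fix m
    have "(\<Sum>q\<in>{m * d..<m * d + d}. f (q div d) (q mod d)) = (\<Sum>a\<in>{0..<d}. f ((a + m * d) div d) ((a + m * d) mod d))"
      using sum.shift_bounds_nat_ivl[of "\<lambda>q. f (q div d) (q mod d)" 0 "m * d" d] by (simp add: add.commute)
    also have "\<dots> = (\<Sum>a<d. f m a)" using False by (simp add: lessThan_atLeast0)
    finally show "(\<Sum>q\<in>{m * d..<m * d + d}. f (q div d) (q mod d)) = (\<Sum>a<d. f m a)" .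
  qed
  finally show ?thesis .
qed simp

lemma (in cyc_poset) graded_replicate_iso:
  assumes "X \<in> \<X>" "Y \<in> \<X>" "cp_iso c X Y" "A \<in> lists \<X>"
  shows "graded (replicate d X) A M \<longleftrightarrow> graded (replicate d Y) A M"
    and "graded A (replicate d X) M \<longleftrightarrow> graded A (replicate d Y) M"
proof -
  have "cp_iso c X (A ! k) \<longleftrightarrow> cp_iso c Y (A ! k)" "cp_iso c (A ! k) X \<longleftrightarrow> cp_iso c (A ! k) Y" if "k < length A" for k
    using that assms cp_iso_trans cp_iso_sym nth_in by meson+
  then show "graded (replicate d X) A M \<longleftrightarrow> graded (replicate d Y) A M"
    and "graded A (replicate d X) M \<longleftrightarrow> graded A (replicate d Y) M"
    by (auto simp: graded_def)
qed

context cyc_poset_action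
begin

abbreviation stab :: "'x \<Rightarrow> 'g set" where "stab \<equiv> iso_stabilizer G \<phi> c"

lemma act_replicate: "g \<cdot> replicate d X = replicate d (\<phi> g X)"
  by (simp add: act_ob_def)

lemma replicate_in [simp]: "X \<in> \<X> \<Longrightarrow> replicate d X \<in> lists \<X>"
  by auto

lemma stab_subset: "stab X \<subseteq> carrier G" by (auto simp: iso_stabilizer_def)

lemma cp_iso_act_iff:
  assumes "X \<in> \<X>" "\<alpha> \<in> carrier G" "\<beta> \<in> carrier G"
  shows "cp_iso c (\<phi> \<alpha> X) (\<phi> \<beta> X) \<longleftrightarrow> inv \<beta> \<otimes> \<alpha> \<in> stab X"
proof -
  have "cp_iso c (\<phi> \<alpha> X) (\<phi> \<beta> X) \<longleftrightarrow> cp_iso c (\<phi> (inv \<beta>) (\<phi> \<alpha> X)) (\<phi> (inv \<beta>) (\<phi> \<beta> X))"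
    using assms by (subst cp_iso_act) auto
  then show ?thesis using assms by (simp add: iso_stabilizer_def flip: act_mult)
qed

lemma stab_one: "X \<in> \<X> \<Longrightarrow> \<one> \<in> stab X"
  by (simp add: iso_stabilizer_def)

lemma stab_inv: "X \<in> \<X> \<Longrightarrow> h \<in> stab X \<Longrightarrow> inv h \<in> stab X"
proof -
  assume X: "X \<in> \<X>" and h: "h \<in> stab X"
  have hG: "h \<in> carrier G" and "cp_iso c (\<phi> h X) X" using h by (auto simp: iso_stabilizer_def)
  then have "cp_iso c (\<phi> \<one> X) (\<phi> h X)" using cp_iso_sym[of "\<phi> h X" X] X by simp
  then show "inv h \<in> stab X" using cp_iso_act_iff[OF X one_closed hG] hG by simp
qed

lemma stab_mult: "X \<in> \<X> \<Longrightarrow> h \<in> stab X \<Longrightarrow> k \<in> stab X \<Longrightarrow> h \<otimes> k \<in> stab X"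
  using cp_iso_trans[of "\<phi> (h \<otimes> k) X" "\<phi> h X" X] by (auto simp: iso_stabilizer_def act_mult)

lemma stab_mult_iff:
  assumes "X \<in> \<X>" "h \<in> stab X" "g \<in> carrier G"
  shows "h \<otimes> g \<in> stab X \<longleftrightarrow> g \<in> stab X" "g \<otimes> h \<in> stab X \<longleftrightarrow> g \<in> stab X"
proof -
  have h: "h \<in> carrier G" using assms stab_subset by blast
  have "inv h \<otimes> (h \<otimes> g) = g" "(g \<otimes> h) \<otimes> inv h = g"
    using h assms by (simp_all add: m_assoc flip: m_assoc[of "inv h"])
  then show "h \<otimes> g \<in> stab X \<longleftrightarrow> g \<in> stab X" "g \<otimes> h \<in> stab X \<longleftrightarrow> g \<in> stab X"
    using assms stab_mult stab_inv by metis+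
qed

lemma stab_inv_iff: "X \<in> \<X> \<Longrightarrow> g \<in> carrier G \<Longrightarrow> inv g \<in> stab X \<longleftrightarrow> g \<in> stab X"
  using stab_inv by (metis inv_inv)

lemma stab_group: "X \<in> \<X> \<Longrightarrow> subgroup (stab X) G"
  using stab_subset stab_one stab_inv stab_mult by (auto intro!: subgroup.intro)

lemma representationD:
  assumes X: "X \<in> \<X>" and rep: "representation G (stab X) d \<rho>"
  shows "h \<in> stab X \<Longrightarrow> \<rho> h \<in> carrier_mat d d"
    "h \<in> stab X \<Longrightarrow> k \<in> stab X \<Longrightarrow> \<rho> (h \<otimes> k) = \<rho> h * \<rho> k"
    "\<rho> \<one> = 1\<^sub>m d"
proof -
  interpret R: ring "ring_mat TYPE(complex) d ()" by (rule ring_mat)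
  interpret GLd: group "GL d" by (rule R.units_group)
  interpret H: group "G\<lparr>carrier := stab X\<rparr>" using subgroup.subgroup_is_group[OF stab_group[OF X] is_group] .
  interpret hom: group_hom "G\<lparr>carrier := stab X\<rparr>" "GL d" \<rho>
    by unfold_locales (use rep in \<open>simp add: representation_def\<close>)
  show "h \<in> stab X \<Longrightarrow> \<rho> h \<in> carrier_mat d d"
    using hom.hom_closed[of h] by (auto simp: units_of_def Units_def ring_mat_simps)
  show "h \<in> stab X \<Longrightarrow> k \<in> stab X \<Longrightarrow> \<rho> (h \<otimes> k) = \<rho> h * \<rho> k"
    using hom.hom_mult[of h k] by (simp add: units_of_def ring_mat_simps)
  show "\<rho> \<one> = 1\<^sub>m d"
    using hom.hom_one by (simp add: units_of_def ring_mat_simps)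
qed

lemma representationI:
  assumes X: "X \<in> \<X>" and "\<And>h. h \<in> stab X \<Longrightarrow> \<rho> h \<in> carrier_mat d d"
    "\<And>h k. h \<in> stab X \<Longrightarrow> k \<in> stab X \<Longrightarrow> \<rho> (h \<otimes> k) = \<rho> h * \<rho> k" "\<rho> \<one> = 1\<^sub>m d"
  shows "representation G (stab X) d \<rho>"
  unfolding representation_def
proof (rule homI)
  fix h assume "h \<in> carrier (G\<lparr>carrier := stab X\<rparr>)"
  then have h: "h \<in> stab X" "h \<in> carrier G" using stab_subset by auto
  then have "\<rho> h * \<rho> (inv h) = 1\<^sub>m d" "\<rho> (inv h) * \<rho> h = 1\<^sub>m d"
    using assms stab_inv[OF X, of h] by (simp_all flip: assms(3))
  then show "\<rho> h \<in> carrier (GL d)"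
    using h assms(2) stab_inv[OF X, of h] by (auto simp: units_of_def Units_def ring_mat_simps)
qed (use assms in \<open>simp add: units_of_def ring_mat_simps\<close>)

end

locale induced = cyc_poset_action \<X> c G \<phi>
  for \<X> :: "'x set" and c and G :: "'g monoid" (structure) and \<phi> +
  fixes X :: 'x and ss :: "'g list" and d :: nat and \<rho> :: "'g \<Rightarrow> complex mat"
  assumes X: "X \<in> \<X>" and transversal: "left_transversal G (iso_stabilizer G \<phi> c X) ss"
    and rep: "representation G (iso_stabilizer G \<phi> c X) d \<rho>" and d_pos: "0 < d"
begin

abbreviation H where "H \<equiv> stab X"

lemmas H_one = stab_one[OF X] and H_mult_iff = stab_mult_iff[OF X] and H_inv_iff = stab_inv_iff[OF X]
  and \<rho>_carrier = representationD(1)[OF X rep] and \<rho>_mult = representationD(2)[OF X rep]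
  and \<rho>_one = representationD(3)[OF X rep]

lemma H_carrier [simp]: "h \<in> H \<Longrightarrow> h \<in> carrier G" using stab_subset by blast

lemma ss_carrier [simp]: "i < length ss \<Longrightarrow> ss ! i \<in> carrier G"
  using transversal nth_mem by (fastforce simp: left_transversal_def)

lemma ss_set: "set ss \<subseteq> carrier G"
  using transversal by (simp add: left_transversal_def)

lemma mem_coset_iff:
  assumes "s \<in> carrier G" "y \<in> carrier G"
  shows "y \<in> s <# H \<longleftrightarrow> inv s \<otimes> y \<in> H"
proof
  assume "y \<in> s <# H"
  then obtain h where "h \<in> H" "y = s \<otimes> h" by (auto simp: l_coset_def)
  then show "inv s \<otimes> y \<in> H" using assms by (simp flip: m_assoc)
next
  assume "inv s \<otimes> y \<in> H"
  moreover have "y = s \<otimes> (inv s \<otimes> y)" using assms by (simp flip: m_assoc)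
  ultimately show "y \<in> s <# H" unfolding l_coset_def by blast
qed

lemma coset_index:
  assumes y: "y \<in> carrier G"
  obtains i where "i < length ss" "inv (ss ! i) \<otimes> y \<in> H"
    "\<And>j. j < length ss \<Longrightarrow> inv (ss ! j) \<otimes> y \<in> H \<Longrightarrow> j = i"
proof -
  have "\<exists>!s. s \<in> set ss \<and> y \<in> s <# H" and dist: "distinct ss"
    using transversal y by (auto simp: left_transversal_def)
  then obtain s where s: "s \<in> set ss" "y \<in> s <# H" "\<And>s'. s' \<in> set ss \<Longrightarrow> y \<in> s' <# H \<Longrightarrow> s' = s"
    by blast
  then obtain i where i: "i < length ss" "s = ss ! i" by (metis in_set_conv_nth)
  show thesis
  proof (rule that[OF i(1)])
    show "inv (ss ! i) \<otimes> y \<in> H" using s i y mem_coset_iff by simp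
    fix j assume j: "j < length ss" "inv (ss ! j) \<otimes> y \<in> H"
    then have "ss ! j = s" using s(3)[of "ss ! j"] y mem_coset_iff by simp
    then show "j = i" using i j dist nth_eq_iff_index_eq by blast
  qed
qed

lemma ss_diff_in_H_iff:
  assumes "i < length ss" "j < length ss"
  shows "inv (ss ! i) \<otimes> ss ! j \<in> H \<longleftrightarrow> i = j"
proof -
  obtain k where k: "\<And>l. l < length ss \<Longrightarrow> inv (ss ! l) \<otimes> ss ! j \<in> H \<Longrightarrow> l = k"
    using coset_index[of "ss ! j"] assms by auto
  have "inv (ss ! j) \<otimes> ss ! j \<in> H" using assms H_one by simp
  then show ?thesis using k[of i] k[of j] assms by auto
qed

lemma sum_over_coset:
  fixes f :: "nat \<Rightarrow> nat \<Rightarrow> complex"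
  assumes i: "i < length ss" "\<And>j. j < length ss \<Longrightarrow> inv (ss ! j) \<otimes> y \<in> H \<Longrightarrow> j = i"
    and zero: "\<And>j a. j < length ss \<Longrightarrow> a < d \<Longrightarrow> inv (ss ! j) \<otimes> y \<notin> H \<Longrightarrow> f j a = 0"
  shows "(\<Sum>q<length ss * d. f (q div d) (q mod d)) = (\<Sum>a<d. f i a)"
proof -
  have "(\<Sum>q<length ss * d. f (q div d) (q mod d)) = (\<Sum>j<length ss. \<Sum>a<d. f j a)" by (rule sum_blocks)
  also have "\<dots> = (\<Sum>j\<in>{i}. \<Sum>a<d. f j a)"
    using i zero by (intro sum.mono_neutral_right) (auto intro!: sum.neutral)
  finally show ?thesis by simp
qed

text \<open>
  The representation extended by zero to all of \<open>G\<close>: with it, the case distinction in \<open>S_obj\<close>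
  disappears from computations.
\<close>

definition ext :: "'g \<Rightarrow> complex mat" where
  "ext g = (if g \<in> H then \<rho> g else 0\<^sub>m d d)"

lemma ext_carrier [simp]: "ext g \<in> carrier_mat d d"
  by (simp add: ext_def \<rho>_carrier)

lemma ext_mult:
  assumes "g \<in> carrier G" "h \<in> H"
  shows "ext (g \<otimes> h) = ext g * \<rho> h" "ext (h \<otimes> g) = \<rho> h * ext g"
  using assms H_mult_iff[of h g] \<rho>_carrier[of h] by (auto simp: ext_def \<rho>_mult)

text \<open>
  All maps attached to \<open>S\<^sub>\<rho> X\<close> have this form: rows \<open>ss\<close> and columns \<open>g ss\<close> give the action of \<open>g\<close>, and
  replacing one of the lists by \<open>[\<one>]\<close> gives the inclusion and the projection of the fibre at \<open>X\<close>.
\<close>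

definition block_mat :: "'g list \<Rightarrow> 'g list \<Rightarrow> complex mat" where
  "block_mat xs ys = mat (length xs * d) (length ys * d)
     (\<lambda>(p, q). ext (inv (xs ! (p div d)) \<otimes> ys ! (q div d)) $$ (p mod d, q mod d))"

lemma block_mat_carrier [simp]:
  "length xs * d = n \<Longrightarrow> length ys * d = m \<Longrightarrow> block_mat xs ys \<in> carrier_mat n m"
  by (simp add: block_mat_def)

lemma nth_in_carrier: "set xs \<subseteq> carrier G \<Longrightarrow> p < length xs * d \<Longrightarrow> xs ! (p div d) \<in> carrier G"
  using block_index_less nth_mem by blast

text \<open>
  This is \<open>\<Sum>\<^sub>i ext (x\<^sup>-\<^sup>1 s\<^sub>i) ext (s\<^sub>i\<^sup>-\<^sup>1 y) = ext (x\<^sup>-\<^sup>1 y)\<close>: only the representative \<open>s\<^sub>i\<close> of the coset of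
  \<open>y\<close> contributes.
\<close>

lemma block_mat_mult:
  assumes xs: "set xs \<subseteq> carrier G" and ys: "set ys \<subseteq> carrier G"
  shows "block_mat xs ss * block_mat ss ys = block_mat xs ys"
proof (rule eq_matI)
  fix p r assume "p < dim_row (block_mat xs ys)" "r < dim_col (block_mat xs ys)"
  then have pr: "p < length xs * d" "r < length ys * d" by (auto simp: block_mat_def)
  let ?x = "xs ! (p div d)" and ?y = "ys ! (r div d)" and ?b = "p mod d" and ?e = "r mod d"
  have x: "?x \<in> carrier G" and y: "?y \<in> carrier G" using nth_in_carrier xs ys pr by auto
  have be: "?b < d" "?e < d" using d_pos by auto
  obtain i where i: "i < length ss" "inv (ss ! i) \<otimes> ?y \<in> H"
    and uniq: "\<And>j. j < length ss \<Longrightarrow> inv (ss ! j) \<otimes> ?y \<in> H \<Longrightarrow> j = i"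
    using coset_index[OF y] by metis
  define f where "f j a = ext (inv ?x \<otimes> ss ! j) $$ (?b, a) * ext (inv (ss ! j) \<otimes> ?y) $$ (a, ?e)" for j a
  have "(block_mat xs ss * block_mat ss ys) $$ (p, r) = (\<Sum>q<length ss * d. f (q div d) (q mod d))"
    using pr mult_index[of "block_mat xs ss" "length xs * d" "length ss * d" "block_mat ss ys" "length ys * d" p r]
    by (simp add: block_mat_def f_def)
  also have "\<dots> = (\<Sum>a<d. f i a)"
    by (rule sum_over_coset[OF i(1) uniq]) (auto simp: f_def ext_def be)
  also have "\<dots> = (ext (inv ?x \<otimes> ss ! i) * ext (inv (ss ! i) \<otimes> ?y)) $$ (?b, ?e)"
    using mult_index[OF ext_carrier ext_carrier be] by (simp add: f_def)
  also have "ext (inv ?x \<otimes> ss ! i) * ext (inv (ss ! i) \<otimes> ?y) = ext ((inv ?x \<otimes> ss ! i) \<otimes> (inv (ss ! i) \<otimes> ?y))"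
    using ext_mult(1)[of "inv ?x \<otimes> ss ! i"] i x by (simp add: ext_def)
  also have "(inv ?x \<otimes> ss ! i) \<otimes> (inv (ss ! i) \<otimes> ?y) = inv ?x \<otimes> ?y"
    using x y i by (simp add: m_assoc flip: m_assoc[of "ss ! i"])
  finally show "(block_mat xs ss * block_mat ss ys) $$ (p, r) = block_mat xs ys $$ (p, r)"
    using pr by (simp add: block_mat_def)
qed (auto simp: block_mat_def)

lemma block_mat_translate:
  assumes "g \<in> carrier G" and xs: "set xs \<subseteq> carrier G" and ys: "set ys \<subseteq> carrier G"
  shows "block_mat (map ((\<otimes>) g) xs) (map ((\<otimes>) g) ys) = block_mat xs ys"
proof -
  have "inv (g \<otimes> x) \<otimes> (g \<otimes> y) = inv x \<otimes> y" if "x \<in> carrier G" "y \<in> carrier G" for x y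
    using that assms(1) by (simp add: inv_mult_group m_assoc flip: m_assoc[of "inv g"])
  then show ?thesis
    using block_index_less nth_in_carrier xs ys by (intro eq_matI) (auto simp: block_mat_def)
qed

definition shift :: "'g \<Rightarrow> 'g list" where
  "shift g = map ((\<otimes>) g) ss"

lemma shift_simps [simp]: "length (shift g) = length ss" "g \<in> carrier G \<Longrightarrow> set (shift g) \<subseteq> carrier G"
  using ss_set by (auto simp: shift_def)

lemma map_shift: "\<alpha> \<in> carrier G \<Longrightarrow> \<beta> \<in> carrier G \<Longrightarrow> map ((\<otimes>) \<alpha>) (shift \<beta>) = shift (\<alpha> \<otimes> \<beta>)"
  using ss_set by (auto simp: shift_def m_assoc)

lemma shift_one: "shift \<one> = ss"
  using ss_set by (auto simp: shift_def intro!: map_idI)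

definition ind_list :: "'x list" where
  "ind_list = concat (map (\<lambda>s. replicate d (\<phi> s X)) ss)"

definition ind_rep :: "'g \<Rightarrow> complex mat" where
  "ind_rep g = block_mat ss (shift g)"

lemma ind_rep_alt: "g \<in> carrier G \<Longrightarrow> ind_rep g = block_mat (shift (inv g)) ss"
proof -
  assume g: "g \<in> carrier G"
  have "map ((\<otimes>) g) (shift (inv g)) = ss" using g by (simp add: map_shift shift_one)
  then show ?thesis using block_mat_translate[OF g shift_simps(2)[of "inv g"] ss_set] g
    by (simp add: ind_rep_def flip: shift_def)
qed

lemma length_ind_list [simp]: "length ind_list = length ss * d"
  by (simp add: ind_list_def length_concat_replicate)

lemma nth_ind_list: "p < length ss * d \<Longrightarrow> ind_list ! p = \<phi> (ss ! (p div d)) X"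
  by (simp add: ind_list_def nth_concat_replicate)

lemma ind_list_in: "ind_list \<in> lists \<X>"
  using X by (auto simp: ind_list_def intro!: act_in subsetD[OF ss_set])

lemma ind_rep_carrier: "ind_rep g \<in> carrier_mat (length ss * d) (length ss * d)"
  by (simp add: ind_rep_def)

lemma ind_rep_index: "g \<in> carrier G \<Longrightarrow> p < length ss * d \<Longrightarrow> q < length ss * d \<Longrightarrow>
   ind_rep g $$ (p, q) = ext (inv (ss ! (p div d)) \<otimes> g \<otimes> ss ! (q div d)) $$ (p mod d, q mod d)"
  using block_index_less[of _ "length ss" d] by (simp add: ind_rep_def block_mat_def shift_def m_assoc)

lemma S_obj_eq: "S_obj G \<phi> c ss X d \<rho> = cobj ind_list ind_rep"
proof -
  have "mat (length ind_list) (length ind_list) (\<lambda>(p, q).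
         let \<eta> = inv (ss ! (p div d)) \<otimes> g \<otimes> (ss ! (q div d))
         in if \<eta> \<in> H then fps_const (\<rho> \<eta> $$ (p mod d, q mod d)) else 0) = const (ind_rep g)"
    if "g \<in> carrier G" for g
    using that d_pos ind_rep_carrier[of g] by (intro eq_matI) (auto simp: ind_rep_index ext_def Let_def)
  then show ?thesis unfolding S_obj_def cobj_def obj_def ind_list_def[symmetric] Let_def
    by (auto simp: Let_def)
qed

lemma graded_rep_ind: "graded_rep ind_list ind_rep"
  unfolding graded_rep_def
proof (intro conjI ballI ind_list_in)
  fix g assume g: "g \<in> carrier G"
  show "graded (g \<cdot> ind_list) ind_list (ind_rep g)"
  proof (rule gradedI)
    fix p q assume pq: "p < length ind_list" "q < length (g \<cdot> ind_list)"
      "\<not> cp_iso c ((g \<cdot> ind_list) ! q) (ind_list ! p)"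
    have "inv (ss ! (p div d)) \<otimes> (g \<otimes> ss ! (q div d)) \<notin> H"
      using pq g block_index_less[of _ "length ss" d] cp_iso_act_iff[OF X, of "g \<otimes> ss ! (q div d)" "ss ! (p div d)"] X
      by (simp add: nth_act nth_ind_list act_mult)
    then show "ind_rep g $$ (p, q) = 0"
      using pq g d_pos block_index_less[of _ "length ss" d] by (simp add: ind_rep_index ext_def m_assoc)
  qed (simp add: ind_rep_carrier)
  fix \<beta> assume \<beta>: "\<beta> \<in> carrier G"
  have "ind_rep g * ind_rep \<beta> = block_mat (shift (inv g)) (shift \<beta>)"
    using ind_rep_alt[OF g] block_mat_mult[of "shift (inv g)" "shift \<beta>"] g \<beta> by (simp add: ind_rep_def)
  also have "\<dots> = block_mat (map ((\<otimes>) g) (shift (inv g))) (map ((\<otimes>) g) (shift \<beta>))"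
    using block_mat_translate g \<beta> by simp
  also have "map ((\<otimes>) g) (shift (inv g)) = ss" using g by (simp add: map_shift shift_one)
  also have "map ((\<otimes>) g) (shift \<beta>) = shift (g \<otimes> \<beta>)"
    using g \<beta> by (rule map_shift)
  finally show "ind_rep (g \<otimes> \<beta>) = ind_rep g * ind_rep \<beta>" by (simp add: ind_rep_def)
next
  show "ind_rep \<one> = 1\<^sub>m (length ind_list)"
  proof (rule eq_matI)
    fix p q assume "p < dim_row (1\<^sub>m (length ind_list))" "q < dim_col (1\<^sub>m (length ind_list))"
    then have pq: "p < length ss * d" "q < length ss * d" by auto
    note b = block_index_less[OF pq(1)] block_index_less[OF pq(2)]
    have "p = q" if "p div d = q div d" "p mod d = q mod d"
      using that by (metis div_mult_mod_eq)
    then show "ind_rep \<one> $$ (p, q) = 1\<^sub>m (length ind_list) $$ (p, q)"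
      using pq b ss_diff_in_H_iff[of "p div d" "q div d"]
      by (auto simp: ind_rep_index ext_def \<rho>_one)
  qed (auto simp: ind_rep_def block_mat_def)
qed

text \<open>
  The fibre of \<open>S\<^sub>\<rho> X\<close> at \<open>X\<close> is \<open>\<rho>\<close>, embedded by \<open>incl \<one>\<close> and recovered by \<open>proj \<one>\<close>; the maps \<open>incl g\<close>
  and \<open>proj g\<close> belong to its translate by \<open>g\<close>.
\<close>

definition incl :: "'g \<Rightarrow> complex mat" where "incl g = block_mat ss [g]"
definition proj :: "'g \<Rightarrow> complex mat" where "proj g = block_mat [g] ss"

lemma incl_carrier [simp]: "incl g \<in> carrier_mat (length ss * d) d"
  and proj_carrier [simp]: "proj g \<in> carrier_mat d (length ss * d)"
  by (simp_all add: incl_def proj_def)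

lemma ind_rep_incl: "g \<in> carrier G \<Longrightarrow> x \<in> carrier G \<Longrightarrow> ind_rep g * incl x = incl (g \<otimes> x)"
proof -
  assume g: "g \<in> carrier G" and x: "x \<in> carrier G"
  have "ind_rep g * incl x = block_mat (shift (inv g)) [x]"
    using block_mat_mult[of "shift (inv g)" "[x]"] g x by (simp add: ind_rep_alt incl_def)
  also have "\<dots> = block_mat (map ((\<otimes>) g) (shift (inv g))) [g \<otimes> x]"
    using block_mat_translate[of g "shift (inv g)" "[x]"] g x by simp
  also have "map ((\<otimes>) g) (shift (inv g)) = ss" using g by (simp add: map_shift shift_one)
  finally show ?thesis by (simp add: incl_def)
qed

lemma proj_ind_rep: "g \<in> carrier G \<Longrightarrow> x \<in> carrier G \<Longrightarrow> proj x * ind_rep g = proj (inv g \<otimes> x)"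
proof -
  assume g: "g \<in> carrier G" and x: "x \<in> carrier G"
  have "proj x * ind_rep g = block_mat [x] (shift g)"
    using block_mat_mult[of "[x]" "shift g"] g x by (simp add: ind_rep_def proj_def)
  also have "\<dots> = block_mat [inv g \<otimes> x] (map ((\<otimes>) (inv g)) (shift g))"
    using block_mat_translate[of "inv g" "[x]" "shift g"] g x by simp
  also have "map ((\<otimes>) (inv g)) (shift g) = ss" using g by (simp add: map_shift shift_one)
  finally show ?thesis by (simp add: proj_def)
qed

lemma incl_mult: "h \<in> H \<Longrightarrow> incl \<one> * \<rho> h = incl h"
proof (rule eq_matI)
  assume h: "h \<in> H"
  fix p a assume "p < dim_row (incl h)" "a < dim_col (incl h)"
  then have pa: "p < length ss * d" "a < d" by (auto simp: incl_def block_mat_def)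
  note b = block_index_less[OF pa(1)]
  have "(incl \<one> * \<rho> h) $$ (p, a) = (\<Sum>e<d. ext (inv (ss ! (p div d))) $$ (p mod d, e) * \<rho> h $$ (e, a))"
    using mult_index[OF incl_carrier \<rho>_carrier[OF h] pa, of \<one>] pa b by (simp add: incl_def block_mat_def)
  also have "\<dots> = (ext (inv (ss ! (p div d))) * \<rho> h) $$ (p mod d, a)"
    using mult_index[OF ext_carrier \<rho>_carrier[OF h], of "p mod d" a] b pa by simp
  also have "\<dots> = incl h $$ (p, a)"
    using pa b h ext_mult(1)[of "inv (ss ! (p div d))" h] by (simp add: incl_def block_mat_def)
  finally show "(incl \<one> * \<rho> h) $$ (p, a) = incl h $$ (p, a)" .
qed (auto simp: incl_def block_mat_def dest: \<rho>_carrier)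

lemma mult_proj: "h \<in> H \<Longrightarrow> \<rho> h * proj \<one> = proj (inv h)"
proof (rule eq_matI)
  assume h: "h \<in> H"
  fix a p assume "a < dim_row (proj (inv h))" "p < dim_col (proj (inv h))"
  then have pa: "a < d" "p < length ss * d" by (auto simp: proj_def block_mat_def)
  note b = block_index_less[OF pa(2)]
  have "(\<rho> h * proj \<one>) $$ (a, p) = (\<Sum>e<d. \<rho> h $$ (a, e) * ext (ss ! (p div d)) $$ (e, p mod d))"
    using mult_index[OF \<rho>_carrier[OF h] proj_carrier pa, of \<one>] pa b by (simp add: proj_def block_mat_def)
  also have "\<dots> = (\<rho> h * ext (ss ! (p div d))) $$ (a, p mod d)"
    using mult_index[OF \<rho>_carrier[OF h] ext_carrier, of a "p mod d"] b pa by simp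
  also have "\<dots> = proj (inv h) $$ (a, p)"
    using pa b h ext_mult(2)[of "ss ! (p div d)" h] by (simp add: proj_def block_mat_def)
  finally show "(\<rho> h * proj \<one>) $$ (a, p) = proj (inv h) $$ (a, p)" .
qed (auto simp: proj_def block_mat_def dest: \<rho>_carrier)

lemma proj_incl: "proj \<one> * incl \<one> = 1\<^sub>m d"
proof -
  have "proj \<one> * incl \<one> = block_mat [\<one>] [\<one>]"
    using block_mat_mult[of "[\<one>]" "[\<one>]"] by (simp add: proj_def incl_def)
  also have "\<dots> = 1\<^sub>m d" using \<rho>_one H_one by (intro eq_matI) (auto simp: block_mat_def ext_def)
  finally show ?thesis .
qed

lemma graded_incl: "graded (replicate d X) ind_list (incl \<one>)"
proof (rule gradedI)
  fix p a assume pa: "p < length ind_list" "a < length (replicate d X)"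
    "\<not> cp_iso c (replicate d X ! a) (ind_list ! p)"
  then have "inv (ss ! (p div d)) \<notin> H"
    using cp_iso_act_iff[OF X, of \<one> "ss ! (p div d)"] X block_index_less[of p "length ss" d]
    by (simp add: nth_ind_list)
  then show "incl \<one> $$ (p, a) = 0" using pa block_index_less[of p "length ss" d]
    by (simp add: incl_def block_mat_def ext_def)
qed simp

lemma graded_proj: "graded ind_list (replicate d X) (proj \<one>)"
proof (rule gradedI)
  fix a p assume pa: "a < length (replicate d X)" "p < length ind_list"
    "\<not> cp_iso c (ind_list ! p) (replicate d X ! a)"
  then have "ss ! (p div d) \<notin> H"
    using cp_iso_act_iff[OF X, of "ss ! (p div d)" \<one>] X block_index_less[of p "length ss" d]
    by (simp add: nth_ind_list)
  then show "proj \<one> $$ (a, p) = 0" using pa block_index_less[of p "length ss" d]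
    by (simp add: proj_def block_mat_def ext_def)
qed simp

lemma incl_proj_index:
  assumes pq: "p < length ss * d" "q < length ss * d" and q: "ss ! (q div d) \<in> H"
  shows "(incl \<one> * proj \<one>) $$ (p, q) = (if p = q then 1 else 0)"
proof -
  note b = block_index_less[OF pq(1)] block_index_less[OF pq(2)]
  have "(incl \<one> * proj \<one>) $$ (p, q) =
      (\<Sum>e<d. ext (inv (ss ! (p div d))) $$ (p mod d, e) * ext (ss ! (q div d)) $$ (e, q mod d))"
    using mult_index[OF incl_carrier proj_carrier pq, of \<one> \<one>] pq b by (simp add: incl_def proj_def block_mat_def)
  also have "\<dots> = (ext (inv (ss ! (p div d))) * ext (ss ! (q div d))) $$ (p mod d, q mod d)"
    using mult_index[OF ext_carrier ext_carrier, of "p mod d" "q mod d"] b by simp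
  also have "ext (inv (ss ! (p div d))) * ext (ss ! (q div d)) = ext (inv (ss ! (p div d)) \<otimes> ss ! (q div d))"
    using ext_mult(1)[of "inv (ss ! (p div d))" "ss ! (q div d)"] q b by (simp add: ext_def)
  also have "\<dots> $$ (p mod d, q mod d) = ind_rep \<one> $$ (p, q)"
    using pq b by (simp add: ind_rep_index)
  also have "\<dots> = (if p = q then 1 else 0)" using graded_repD(5)[OF graded_rep_ind] pq by simp
  finally show ?thesis .
qed

text \<open>
  The product \<open>incl \<one> * proj \<one>\<close> is the projection onto the rows isomorphic to \<open>X\<close>, and a graded \<open>M\<close>
  lives on these rows.
\<close>

lemma incl_proj_mult:
  assumes M: "graded (replicate m X) ind_list M"
  shows "incl \<one> * (proj \<one> * M) = M"
proof -
  let ?N = "length ss * d"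
  have Mc: "M \<in> carrier_mat ?N m" using gradedD[OF M] by simp
  have IP: "incl \<one> * proj \<one> \<in> carrier_mat ?N ?N" by (rule mult_carrier_mat[OF incl_carrier proj_carrier])
  have "((incl \<one> * proj \<one>) * M) $$ (p, a) = M $$ (p, a)" if "p < ?N" "a < m" for p a
  proof -
    have "(incl \<one> * proj \<one>) $$ (p, q) * M $$ (q, a) = (if q = p then M $$ (p, a) else 0)" if q: "q < ?N" for q
    proof (cases "ss ! (q div d) \<in> H")
      case True
      then show ?thesis using incl_proj_index \<open>p < ?N\<close> q by simp
    next
      case False
      then have "M $$ (q, a) = 0"
        using gradedE[OF M, of q a] q \<open>a < m\<close> cp_iso_act_iff[OF X, of \<one> "ss ! (q div d)"] X
          block_index_less[of q "length ss" d] H_inv_iff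
        by (simp add: nth_ind_list)
      then show ?thesis by auto
    qed
    then show ?thesis using mult_index[OF IP Mc that] that by simp
  qed
  then have "(incl \<one> * proj \<one>) * M = M" using Mc IP by (intro eq_matI) auto
  then show ?thesis using assoc_mult_mat[OF incl_carrier proj_carrier Mc] by simp
qed

lemma incl_ss_index:
  assumes "i < length ss" "p < length ss * d" "a < d"
  shows "incl (ss ! i) $$ (p, a) = (if p = i * d + a then 1 else 0)"
proof -
  note b = block_index_less[OF assms(2)]
  have "p = i * d + a \<longleftrightarrow> p div d = i \<and> p mod d = a"
  proof
    assume "p div d = i \<and> p mod d = a"
    then show "p = i * d + a" using div_mult_mod_eq[of p d] by simp
  qed (use assms in simp)
  then show ?thesis using assms b ss_diff_in_H_iff[of "p div d" i]
    by (auto simp: incl_def block_mat_def ext_def \<rho>_one)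
qed

end

section \<open>Strong indecomposability\<close>

context cyc_poset_action
begin

lemma twist_mult_zero:
  "twist_mult c A B D N (0\<^sub>m (length B) (length A)) = 0\<^sub>m (length D) (length A)"
  "twist_mult c A B D (0\<^sub>m (length D) (length B)) M = 0\<^sub>m (length D) (length A)"
  by (auto intro!: eq_matI simp: twist_mult_def)

lemma twist_mult_uminus:
  "M \<in> carrier_mat (length B) (length A) \<Longrightarrow> twist_mult c A B D N (- M) = - twist_mult c A B D N M"
  "N \<in> carrier_mat (length D) (length B) \<Longrightarrow> twist_mult c A B D (- N) M = - twist_mult c A B D N M"
  by (auto intro!: eq_matI simp: twist_mult_def sum_negf)

lemma eq_hom_add:
  assumes "equivariant A m" "equivariant B m'" "eq_hom A m B m' M" "eq_hom A m B m' N"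
  shows "eq_hom A m B m' (M + N)"
  using assms equivariantD(2)[OF assms(1)] equivariantD(2)[OF assms(2)]
  by (simp add: eq_hom_def twist_mult_add_left twist_mult_add_right)

lemma eq_hom_uminus:
  assumes "equivariant A m" "equivariant B m'" "eq_hom A m B m' M"
  shows "eq_hom A m B m' (- M)"
  using assms equivariantD(2)[OF assms(1)] equivariantD(2)[OF assms(2)]
  by (simp add: eq_hom_def twist_mult_uminus)

lemma eq_hom_zero: "eq_hom A m B m' (0\<^sub>m (length B) (length A))"
  using twist_mult_zero(1)[of "g \<cdot> A" "g \<cdot> B" for g] twist_mult_zero(2)[where B = A and D = B]
  by (simp add: eq_hom_def)

lemma eq_hom_one: "equivariant A m \<Longrightarrow> eq_hom A m A m (1\<^sub>m (length A))"
  using equivariantD[of A m] twist_mult_one(1)[of "g \<cdot> A" A "m g" for g] twist_mult_one(2)[of "g \<cdot> A" A "m g" for g]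
  by (simp add: eq_hom_def)

lemma eq_hom_comp:
  assumes A: "equivariant A m" and B: "equivariant B m'" and D: "equivariant D m''"
    and M: "eq_hom A m B m' M" and N: "eq_hom B m' D m'' N"
  shows "eq_hom A m D m'' (twist_mult c A B D N M)"
  unfolding eq_hom_def
proof (intro conjI ballI)
  fix g assume g: "g \<in> carrier G"
  note [simp] = equivariantD(1)[OF A] equivariantD(1)[OF B] equivariantD(1)[OF D]
  have "twist_mult c (g \<cdot> A) A D (twist_mult c A B D N M) (m g) =
      twist_mult c (g \<cdot> A) B D N (twist_mult c (g \<cdot> A) A B M (m g))"
    using g by (simp add: twist_mult_assoc)
  also have "\<dots> = twist_mult c (g \<cdot> A) B D N (twist_mult c (g \<cdot> A) (g \<cdot> B) B (m' g) M)"
    using M g by (simp add: eq_hom_def)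
  also have "\<dots> = twist_mult c (g \<cdot> A) (g \<cdot> B) D (twist_mult c (g \<cdot> B) B D N (m' g)) M"
    using g by (simp add: twist_mult_assoc)
  also have "\<dots> = twist_mult c (g \<cdot> A) (g \<cdot> B) D (twist_mult c (g \<cdot> B) (g \<cdot> D) D (m'' g) N) M"
    using N g by (simp add: eq_hom_def)
  also have "\<dots> = twist_mult c (g \<cdot> A) (g \<cdot> D) D (m'' g) (twist_mult c (g \<cdot> A) (g \<cdot> B) (g \<cdot> D) N M)"
    using g by (simp add: twist_mult_assoc)
  finally show "twist_mult c (g \<cdot> A) A D (twist_mult c A B D N M) (m g) =
     twist_mult c (g \<cdot> A) (g \<cdot> D) D (m'' g) (twist_mult c A B D N M)"
    using g by (simp add: twist_mult_act)
qed simp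

lemma ring_end_ring:
  assumes m: "equivariant A m"
  shows "ring (end_ring FG (obj A m))" (is "ring ?R")
proof -
  note [simp] = equivariantD(1)[OF m]
  let ?n = "length A"
  have carr: "x \<in> carrier ?R \<longleftrightarrow> (\<exists>M. eq_hom A m A m M \<and> x = (A, A, M))" for x
    by (simp add: end_ring_def Hom_FG)
  have ops: "monoid.mult ?R = Comp (\<F> \<X> c)" "add ?R = Add (\<F> \<X> c)" "one ?R = (A, A, 1\<^sub>m ?n)" "zero ?R = (A, A, 0\<^sub>m ?n ?n)"
    by (simp_all add: end_ring_def FG_simps)
  have eqc: "M \<in> carrier_mat ?n ?n" if "eq_hom A m A m M" for M using that by (simp add: eq_hom_def)
  have plus: "Add (\<F> \<X> c) (A, A, M) (A, A, N) = (A, A, M + N)" if "eq_hom A m A m M" "eq_hom A m A m N" for M N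
    using that eqc by (simp add: Add_F)
  show ?thesis
  proof (rule ringI)
    show "abelian_group ?R"
    proof (rule abelian_groupI)
      fix x y z assume "x \<in> carrier ?R" "y \<in> carrier ?R" "z \<in> carrier ?R"
      then obtain M N L where *: "x = (A, A, M)" "y = (A, A, N)" "z = (A, A, L)"
        "eq_hom A m A m M" "eq_hom A m A m N" "eq_hom A m A m L" by (auto simp: carr)
      then show "x \<oplus>\<^bsub>?R\<^esub> y \<oplus>\<^bsub>?R\<^esub> z = x \<oplus>\<^bsub>?R\<^esub> (y \<oplus>\<^bsub>?R\<^esub> z)"
        using eqc[of M] eqc[of N] eqc[of L] by (simp add: ops Add_F assoc_add_mat[of _ ?n ?n])
    next
      fix x y assume "x \<in> carrier ?R" "y \<in> carrier ?R"
      then obtain M N where *: "x = (A, A, M)" "y = (A, A, N)"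
        "eq_hom A m A m M" "eq_hom A m A m N" by (auto simp: carr)
      show "x \<oplus>\<^bsub>?R\<^esub> y \<in> carrier ?R" using * eq_hom_add[OF m m] by (simp add: ops plus carr)
      show "x \<oplus>\<^bsub>?R\<^esub> y = y \<oplus>\<^bsub>?R\<^esub> x"
        using * eqc[of M] eqc[of N] by (simp add: ops plus comm_add_mat[of _ ?n ?n])
    next
      fix x assume "x \<in> carrier ?R"
      then obtain M where *: "x = (A, A, M)" "eq_hom A m A m M" by (auto simp: carr)
      show "\<zero>\<^bsub>?R\<^esub> \<oplus>\<^bsub>?R\<^esub> x = x" using * eqc[of M] by (simp add: ops Add_F)
      show "\<exists>y\<in>carrier ?R. y \<oplus>\<^bsub>?R\<^esub> x = \<zero>\<^bsub>?R\<^esub>"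
        using * eqc[of M] eq_hom_uminus[OF m m]
        by (intro bexI[of _ "(A, A, - M)"]) (auto simp: ops Add_F carr uminus_l_inv_mat)
    qed (use eq_hom_zero in \<open>simp add: carr ops\<close>)
    show "Group.monoid ?R"
    proof (rule monoidI)
      fix x y assume "x \<in> carrier ?R" "y \<in> carrier ?R"
      then show "x \<otimes>\<^bsub>?R\<^esub> y \<in> carrier ?R" using eq_hom_comp[OF m m m] by (auto simp: ops Comp_F carr)
    next
      fix x y z assume "x \<in> carrier ?R" "y \<in> carrier ?R" "z \<in> carrier ?R"
      then show "x \<otimes>\<^bsub>?R\<^esub> y \<otimes>\<^bsub>?R\<^esub> z = x \<otimes>\<^bsub>?R\<^esub> (y \<otimes>\<^bsub>?R\<^esub> z)"
        by (auto simp: ops Comp_F carr twist_mult_assoc)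
    qed (use eq_hom_one[OF m] in \<open>auto simp: ops Comp_F carr twist_mult_one eqc\<close>)
    fix x y z assume "x \<in> carrier ?R" "y \<in> carrier ?R" "z \<in> carrier ?R"
    then show "(x \<oplus>\<^bsub>?R\<^esub> y) \<otimes>\<^bsub>?R\<^esub> z = x \<otimes>\<^bsub>?R\<^esub> z \<oplus>\<^bsub>?R\<^esub> y \<otimes>\<^bsub>?R\<^esub> z"
      and "z \<otimes>\<^bsub>?R\<^esub> (x \<oplus>\<^bsub>?R\<^esub> y) = z \<otimes>\<^bsub>?R\<^esub> x \<oplus>\<^bsub>?R\<^esub> z \<otimes>\<^bsub>?R\<^esub> y"
      using eqc by (auto simp: ops Comp_F Add_F carr twist_mult_add_left twist_mult_add_right)
  qed
qed

text \<open>
  An endomorphism is a unit iff its reduction is a unit, that is, a non-zero scalar. The others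
  are those with reduction zero, and these form an ideal since reduction is additive and multiplicative.
\<close>

lemma strongly_indecomposable_if_scalar:
  assumes rep: "graded_rep A \<Xi>" and ne: "A \<noteq> []"
    and scalar: "\<And>C. graded_hom A \<Xi> A \<Xi> C \<Longrightarrow> \<exists>k. C = k \<cdot>\<^sub>m 1\<^sub>m (length A)"
  shows "strongly_indecomposable FG (cobj A \<Xi>)"
proof -
  let ?m = "\<lambda>g. const (\<Xi> g)" and ?n = "length A"
  have m: "equivariant A ?m" by (rule equivariant_const[OF rep])
  have A: "A \<in> lists \<X>" using equivariantD(1)[OF m] .
  let ?R = "end_ring FG (cobj A \<Xi>)"
  interpret ring ?R unfolding cobj_def by (rule ring_end_ring[OF m])
  have carr: "x \<in> carrier ?R \<longleftrightarrow> (\<exists>M. eq_hom A ?m A ?m M \<and> x = (A, A, M))" for x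
    by (simp add: end_ring_def cobj_def Hom_FG)
  have ops: "monoid.mult ?R = Comp (\<F> \<X> c)" "add ?R = Add (\<F> \<X> c)" "one ?R = (A, A, 1\<^sub>m ?n)" "zero ?R = (A, A, 0\<^sub>m ?n ?n)"
    by (simp_all add: end_ring_def cobj_def FG_simps)
  have eqc: "M \<in> carrier_mat ?n ?n" if "eq_hom A ?m A ?m M" for M using that by (simp add: eq_hom_def)
  have rc: "red A A M \<in> carrier_mat ?n ?n" for M by (simp add: red_def)
  have nz: "1\<^sub>m ?n \<noteq> (0\<^sub>m ?n ?n :: complex mat)"
  proof
    assume "1\<^sub>m ?n = (0\<^sub>m ?n ?n :: complex mat)"
    from arg_cong[OF this, of "\<lambda>Z. Z $$ (0, 0)"] ne show False by simp
  qed
  have unit: "(A, A, M) \<in> Units ?R \<longleftrightarrow> red A A M \<noteq> 0\<^sub>m ?n ?n" if M: "eq_hom A ?m A ?m M" for M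
  proof
    assume "(A, A, M) \<in> Units ?R"
    then obtain N where "twist_mult c A A A N M = 1\<^sub>m ?n" by (auto simp: Units_def carr ops Comp_F)
    then have "red A A N * red A A M = 1\<^sub>m ?n" using red_twist_mult[OF A A A, of N M] red_one[OF A] by simp
    then show "red A A M \<noteq> 0\<^sub>m ?n ?n" using nz rc[of N] by auto
  next
    assume ne0: "red A A M \<noteq> 0\<^sub>m ?n ?n"
    obtain k where k: "red A A M = k \<cdot>\<^sub>m 1\<^sub>m ?n" using scalar[OF graded_hom_red[OF rep rep M]] by blast
    have "k \<noteq> 0" using ne0 k by (auto intro!: eq_matI)
    define K :: "complex mat" where "K = (1 / k) \<cdot>\<^sub>m 1\<^sub>m ?n"
    have "graded A A K" by (rule gradedI) (use A nth_in in \<open>auto simp: K_def\<close>)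
    moreover have "K * red A A M = 1\<^sub>m ?n" "red A A M * K = 1\<^sub>m ?n"
      using \<open>k \<noteq> 0\<close> mult_smult_assoc_mat[OF one_carrier_mat, of "a \<cdot>\<^sub>m 1\<^sub>m ?n" ?n ?n b for a b :: complex]
      by (auto simp: k K_def intro!: eq_matI)
    ultimately obtain N where N: "N \<in> carrier_mat ?n ?n" "twist_mult c A A A N M = 1\<^sub>m ?n" "twist_mult c A A A M N = 1\<^sub>m ?n"
      using inverse_if_red_invertible[OF A A eqc[OF M]] by blast
    have "eq_hom A ?m A ?m N" by (rule eq_hom_inverse[OF m m M N])
    then show "(A, A, M) \<in> Units ?R" using M N unfolding Units_def
      by (auto simp: carr ops Comp_F intro!: bexI[of _ "(A, A, N)"])
  qed
  have nonunits: "x \<in> carrier ?R - Units ?R \<longleftrightarrow> (\<exists>M. x = (A, A, M) \<and> eq_hom A ?m A ?m M \<and> red A A M = 0\<^sub>m ?n ?n)" for x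
    using unit by (auto simp: carr)
  have "ideal (carrier ?R - Units ?R) ?R"
  proof (rule idealI)
    show "ring ?R" by (rule ring_axioms)
    show "subgroup (carrier ?R - Units ?R) (add_monoid ?R)"
    proof (rule add.subgroupI)
      have "red A A (0\<^sub>m ?n ?n) = 0\<^sub>m ?n ?n" by (auto intro!: eq_matI simp: red_def)
      then have "(A, A, 0\<^sub>m ?n ?n) \<in> carrier ?R - Units ?R"
        unfolding nonunits using eq_hom_zero[of A ?m A ?m] by (intro exI conjI) auto
      then show "carrier ?R - Units ?R \<noteq> {}" by blast
      fix x y assume xy: "x \<in> carrier ?R - Units ?R" "y \<in> carrier ?R - Units ?R"
      then obtain M N where *: "x = (A, A, M)" "eq_hom A ?m A ?m M" "red A A M = 0\<^sub>m ?n ?n"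
        "y = (A, A, N)" "eq_hom A ?m A ?m N" "red A A N = 0\<^sub>m ?n ?n" unfolding nonunits by blast
      show "x \<oplus>\<^bsub>?R\<^esub> y \<in> carrier ?R - Units ?R"
        using * eqc[of M] eqc[of N] eq_hom_add[OF m m] unfolding nonunits by (auto simp: ops Add_F red_add)
      have "\<ominus>\<^bsub>?R\<^esub> x = (A, A, - M)"
        using * eqc[of M] eq_hom_uminus[OF m m]
        by (intro minus_equality) (auto simp: ops Add_F carr uminus_l_inv_mat)
      moreover have "red A A (- M) = 0\<^sub>m ?n ?n"
      proof (rule eq_matI)
        fix i j assume "i < dim_row (0\<^sub>m ?n ?n)" "j < dim_col (0\<^sub>m ?n ?n)"
        then show "red A A (- M) $$ (i, j) = 0\<^sub>m ?n ?n $$ (i, j)"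
          using arg_cong[OF *(3), of "\<lambda>Z. Z $$ (i, j)"] eqc[OF *(2)] by (auto simp: red_index split: if_splits)
      qed (auto simp: red_def)
      ultimately show "\<ominus>\<^bsub>?R\<^esub> x \<in> carrier ?R - Units ?R"
        unfolding nonunits using * eq_hom_uminus[OF m m] by auto
    qed auto
    fix x y assume xy: "x \<in> carrier ?R - Units ?R" "y \<in> carrier ?R"
    then obtain M N where *: "x = (A, A, M)" "eq_hom A ?m A ?m M" "red A A M = 0\<^sub>m ?n ?n"
      "y = (A, A, N)" "eq_hom A ?m A ?m N" unfolding nonunits carr by blast
    show "y \<otimes>\<^bsub>?R\<^esub> x \<in> carrier ?R - Units ?R" "x \<otimes>\<^bsub>?R\<^esub> y \<in> carrier ?R - Units ?R"
      unfolding nonunits using * eq_hom_comp[OF m m m] rc[of N] by (auto simp: ops Comp_F red_twist_mult A)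
  qed
  then show ?thesis
    using cobj_in_FG[OF rep] by (simp add: strongly_indecomposable_def local_ring_def)
qed

end

section \<open>Schur's lemma\<close>

context induced
begin

text \<open>
  An eigenspace of \<open>C\<close> is an invariant subspace.
\<close>

lemma schur_scalar:
  assumes irr: "irreducible_representation G H d \<rho>" and C: "C \<in> carrier_mat d d"
    and comm: "\<And>h. h \<in> H \<Longrightarrow> C * \<rho> h = \<rho> h * C"
  obtains k where "C = k \<cdot>\<^sub>m 1\<^sub>m d"
proof -
  obtain k v where v: "v \<in> carrier_vec d" "v \<noteq> 0\<^sub>v d" "C *\<^sub>v v = k \<cdot>\<^sub>v v"
    using spectrum_non_empty[OF C d_pos] C by (auto simp: spectrum_def eigenvalue_def eigenvector_def)
  define W where "W = {w \<in> carrier_vec d. C *\<^sub>v w = k \<cdot>\<^sub>v w}"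
  have "subsp d W" unfolding subsp_iff W_def using C
    by (auto simp: mult_add_distrib_mat_vec[of _ d d] smult_add_distrib_vec[of _ d] mult_mat_vec[of _ d d]
        smult_smult_assoc mult.commute)
  moreover have "\<rho> h *\<^sub>v w \<in> W" if "h \<in> H" "w \<in> W" for h w
  proof -
    have w: "w \<in> carrier_vec d" "C *\<^sub>v w = k \<cdot>\<^sub>v w" using that by (auto simp: W_def)
    have r: "\<rho> h \<in> carrier_mat d d" using \<rho>_carrier that by blast
    have "C *\<^sub>v (\<rho> h *\<^sub>v w) = \<rho> h *\<^sub>v (C *\<^sub>v w)"
      using comm[OF that(1)] assoc_mult_mat_vec[OF C r w(1)] assoc_mult_mat_vec[OF r C w(1)] by simp
    also have "\<dots> = k \<cdot>\<^sub>v (\<rho> h *\<^sub>v w)" using w r by (simp add: mult_mat_vec)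
    finally show ?thesis using r w by (simp add: W_def)
  qed
  ultimately have "W = {0\<^sub>v d} \<or> W = carrier_vec d"
    using irr unfolding irreducible_representation_def subsp_def by blast
  moreover have "v \<in> W" using v by (simp add: W_def)
  ultimately have all: "W = carrier_vec d" using v by blast
  have "C $$ (i, j) = (k \<cdot>\<^sub>m 1\<^sub>m d) $$ (i, j)" if "i < d" "j < d" for i j
  proof -
    have "unit_vec d j \<in> W" using all by simp
    then have "C *\<^sub>v unit_vec d j = k \<cdot>\<^sub>v unit_vec d j" by (simp add: W_def)
    from arg_cong[OF this, of "\<lambda>u. u $ i"] show ?thesis using C that by simp
  qed
  then have "C = k \<cdot>\<^sub>m 1\<^sub>m d" using C by (intro eq_matI) auto
  then show thesis by (rule that)
qed

text \<open>
  On the fibre at \<open>X\<close> the endomorphism is an intertwiner of \<open>\<rho>\<close>, hence a scalar; it is the same scalar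
  on every translate of the fibre, and the translates \<open>incl (ss ! i)\<close> are the column blocks of the
  identity matrix.
\<close>

lemma end_scalar:
  assumes irr: "irreducible_representation G H d \<rho>" and C: "graded_hom ind_list ind_rep ind_list ind_rep C"
  shows "\<exists>k. C = k \<cdot>\<^sub>m 1\<^sub>m (length ind_list)"
proof -
  let ?N = "length ss * d"
  have Cc: "C \<in> carrier_mat ?N ?N" and Cg: "graded ind_list ind_list C"
    and comm: "\<And>g. g \<in> carrier G \<Longrightarrow> C * ind_rep g = ind_rep g * C"
    using graded_homD[OF C] by auto
  note ic = incl_carrier[of \<one>] and pc = proj_carrier[of \<one>] and rc = ind_rep_carrier
  define C0 where "C0 = proj \<one> * (C * incl \<one>)"
  have C0c: "C0 \<in> carrier_mat d d" using Cc ic pc unfolding C0_def by (intro mult_carrier_mat)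
  have "C0 * \<rho> h = \<rho> h * C0" if h: "h \<in> H" for h
  proof -
    note r = \<rho>_carrier[OF h]
    have "C0 * \<rho> h = proj \<one> * (C * (incl \<one> * \<rho> h))"
      using Cc ic pc r by (simp add: C0_def assoc_mult_mat[of _ d ?N _ d _ d] assoc_mult_mat[of _ ?N ?N _ d _ d])
    also have "incl \<one> * \<rho> h = ind_rep h * incl \<one>" using ind_rep_incl[of h \<one>] incl_mult[OF h] h by simp
    also have "C * (ind_rep h * incl \<one>) = ind_rep h * (C * incl \<one>)"
      using comm[of h] h assoc_mult_mat[OF Cc rc ic, of h] assoc_mult_mat[OF rc Cc ic, of h] by simp
    also have "proj \<one> * (ind_rep h * (C * incl \<one>)) = (proj \<one> * ind_rep h) * (C * incl \<one>)"
      using assoc_mult_mat[OF pc rc mult_carrier_mat[OF Cc ic], of h] by simp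
    also have "proj \<one> * ind_rep h = \<rho> h * proj \<one>" using proj_ind_rep[of h \<one>] mult_proj[OF h] h by simp
    also have "\<rho> h * proj \<one> * (C * incl \<one>) = \<rho> h * C0"
      using assoc_mult_mat[OF r pc mult_carrier_mat[OF Cc ic]] by (simp add: C0_def)
    finally show ?thesis .
  qed
  then obtain k where k: "C0 = k \<cdot>\<^sub>m 1\<^sub>m d" using schur_scalar[OF irr C0c] by blast
  have "graded (replicate d X) ind_list (C * incl \<one>)"
    by (rule graded_mult[OF _ ind_list_in ind_list_in graded_incl Cg]) (use X in auto)
  from incl_proj_mult[OF this] have "C * incl \<one> = incl \<one> * C0" by (simp add: C0_def)
  then have C1: "C * incl \<one> = k \<cdot>\<^sub>m incl \<one>"
    using mult_smult_distrib[OF ic one_carrier_mat, of k] right_mult_one_mat[OF ic] by (simp add: k)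
  have "C $$ (p, q) = (k \<cdot>\<^sub>m 1\<^sub>m ?N) $$ (p, q)" if pq: "p < ?N" "q < ?N" for p q
  proof -
    define i a where "i = q div d" and "a = q mod d"
    have ia: "i < length ss" "a < d" "q = i * d + a" using block_index_less[OF pq(2)] by (auto simp: i_def a_def)
    have "C * incl (ss ! i) = C * (ind_rep (ss ! i) * incl \<one>)" using ind_rep_incl[of "ss ! i" \<one>] ia by simp
    also have "\<dots> = C * ind_rep (ss ! i) * incl \<one>" by (rule assoc_mult_mat[OF Cc rc ic, symmetric])
    also have "\<dots> = ind_rep (ss ! i) * (C * incl \<one>)"
      unfolding comm[OF ss_carrier[OF ia(1)]] by (rule assoc_mult_mat[OF rc Cc ic])
    also have "\<dots> = k \<cdot>\<^sub>m incl (ss ! i)"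
      using ind_rep_incl[of "ss ! i" \<one>] ia mult_smult_distrib[OF rc ic] by (simp add: C1)
    finally have "(C * incl (ss ! i)) $$ (p, a) = (k \<cdot>\<^sub>m incl (ss ! i)) $$ (p, a)" by simp
    moreover have "(C * incl (ss ! i)) $$ (p, a) = (\<Sum>r<?N. if r = q then C $$ (p, q) else 0)"
    proof -
      have "(C * incl (ss ! i)) $$ (p, a) = (\<Sum>r<?N. C $$ (p, r) * incl (ss ! i) $$ (r, a))"
        using mult_index[OF Cc incl_carrier pq(1) ia(2)] .
      also have "\<dots> = (\<Sum>r<?N. if r = q then C $$ (p, q) else 0)"
        using ia by (intro sum.cong) (simp_all add: incl_ss_index)
      finally show ?thesis .
    qed
    moreover have "(k \<cdot>\<^sub>m incl (ss ! i)) $$ (p, a) = k * incl (ss ! i) $$ (p, a)"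
      using carrier_matD[OF incl_carrier[of "ss ! i"]] pq ia by (simp add: index_smult_mat)
    ultimately show ?thesis using pq ia by (simp add: incl_ss_index)
  qed
  then have "C = k \<cdot>\<^sub>m 1\<^sub>m ?N" using Cc by (intro eq_matI) auto
  then show ?thesis by auto
qed

lemma ind_list_nonempty: "ind_list \<noteq> []"
proof -
  obtain i where "i < length ss" using coset_index[OF one_closed] by blast
  then have "length ind_list \<noteq> 0" using d_pos by auto
  then show ?thesis using length_0_conv by blast
qed

lemma strongly_indecomposable_ind:
  "irreducible_representation G H d \<rho> \<Longrightarrow> strongly_indecomposable FG (cobj ind_list ind_rep)"
  using strongly_indecomposable_if_scalar[OF graded_rep_ind ind_list_nonempty end_scalar] by blast

section \<open>Retracts that are induced objects\<close>

text \<open>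
  Frobenius reciprocity: a copy \<open>B\<close> of \<open>\<rho>\<close> in the fibre of \<open>A\<close> at \<open>X\<close> extends to \<open>\<iota>\<close> with column blocks
  \<open>\<Xi>(s\<^sub>i) B\<close>, and a splitting \<open>C\<close> of \<open>B\<close> extends to \<open>\<pi>\<close> with row blocks \<open>C \<Xi>(s\<^sub>j\<^sup>-\<^sup>1)\<close>. The off-diagonal blocks
  \<open>C \<Xi>(s\<^sub>j\<^sup>-\<^sup>1 s\<^sub>i) B\<close> of \<open>\<pi> \<iota>\<close> vanish for reasons of grading. The last conclusion says that the image of \<open>\<iota>\<close>
  is generated by that of \<open>B\<close>.
\<close>

lemma induced_retract:
  assumes rep: "graded_rep A \<Xi>" and B: "graded (replicate d X) A B" and C: "graded A (replicate d X) C"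
    and Bh: "\<And>h. h \<in> H \<Longrightarrow> \<Xi> h * B = B * \<rho> h" and Ch: "\<And>h. h \<in> H \<Longrightarrow> C * \<Xi> h = \<rho> h * C"
    and CB: "C * B = 1\<^sub>m d"
  obtains \<iota> \<pi> where "graded_hom ind_list ind_rep A \<Xi> \<iota>" "graded_hom A \<Xi> ind_list ind_rep \<pi>"
    "\<pi> * \<iota> = 1\<^sub>m (length ind_list)"
    "\<And>E. E \<in> carrier_mat (length A) (length A) \<Longrightarrow> (\<And>g. g \<in> carrier G \<Longrightarrow> E * \<Xi> g = \<Xi> g * E) \<Longrightarrow> E * B = B \<Longrightarrow> E * \<iota> = \<iota>"
proof -
  let ?n = "length A" and ?N = "length ss * d"
  note R = graded_repD[OF rep]
  have A: "A \<in> lists \<X>" by (rule R(1))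
  have Bc: "B \<in> carrier_mat ?n d" and Cc: "C \<in> carrier_mat d ?n" using gradedD[OF B] gradedD[OF C] by auto
  \<comment> \<open>translates of \<open>B\<close> and \<open>C\<close> by arbitrary lists of group elements, so that both equivariance and the choice of representatives become statements about \<open>block_mat\<close>\<close>
  define IM where "IM ys = mat ?n (length ys * d) (\<lambda>(k, q). (\<Xi> (ys ! (q div d)) * B) $$ (k, q mod d))" for ys
  define PM where "PM xs = mat (length xs * d) ?n (\<lambda>(p, k). (C * \<Xi> (inv (xs ! (p div d)))) $$ (p mod d, k))" for xs
  have IMc: "IM ys \<in> carrier_mat ?n (length ys * d)" and PMc: "PM ys \<in> carrier_mat (length ys * d) ?n" for ys
    by (auto simp: IM_def PM_def)
  have XB: "\<Xi> g * B \<in> carrier_mat ?n d" and CX: "C * \<Xi> g \<in> carrier_mat d ?n" if "g \<in> carrier G" for g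
    using R(3)[OF that] Bc Cc by auto
  have IM_block: "IM ss * block_mat ss ys = IM ys" if ys: "set ys \<subseteq> carrier G" for ys
  proof (rule eq_matI)
    fix k r assume "k < dim_row (IM ys)" "r < dim_col (IM ys)"
    then have kr: "k < ?n" "r < length ys * d" by (auto simp: IM_def)
    let ?y = "ys ! (r div d)" and ?e = "r mod d"
    have y: "?y \<in> carrier G" using nth_in_carrier ys kr by auto
    have e: "?e < d" using d_pos by simp
    obtain i where i: "i < length ss" "inv (ss ! i) \<otimes> ?y \<in> H"
      and uniq: "\<And>j. j < length ss \<Longrightarrow> inv (ss ! j) \<otimes> ?y \<in> H \<Longrightarrow> j = i"
      using coset_index[OF y] by metis
    let ?h = "inv (ss ! i) \<otimes> ?y"
    define f where "f j a = (\<Xi> (ss ! j) * B) $$ (k, a) * ext (inv (ss ! j) \<otimes> ?y) $$ (a, ?e)" for j a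
    have "(IM ss * block_mat ss ys) $$ (k, r) = (\<Sum>q<?N. f (q div d) (q mod d))"
      using mult_index[OF IMc block_mat_carrier[OF refl refl] kr] kr by (simp add: IM_def block_mat_def f_def)
    also have "\<dots> = (\<Sum>a<d. f i a)"
      by (rule sum_over_coset[OF i(1) uniq]) (auto simp: f_def ext_def e)
    also have "\<dots> = (\<Xi> (ss ! i) * B * \<rho> ?h) $$ (k, ?e)"
      using mult_index[OF XB \<rho>_carrier[OF i(2)] kr(1) e, of "ss ! i"] i by (simp add: f_def ext_def)
    also have "\<Xi> (ss ! i) * B * \<rho> ?h = \<Xi> (ss ! i) * (\<Xi> ?h * B)"
      using assoc_mult_mat[OF R(3) Bc \<rho>_carrier[OF i(2)], of "ss ! i"] i Bh[OF i(2)] by simp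
    also have "\<dots> = \<Xi> (ss ! i \<otimes> ?h) * B"
      using assoc_mult_mat[OF R(3) R(3) Bc, of "ss ! i" ?h] i y R(4)[of "ss ! i" ?h] by simp
    also have "ss ! i \<otimes> ?h = ?y" using i y by (simp flip: m_assoc)
    finally show "(IM ss * block_mat ss ys) $$ (k, r) = IM ys $$ (k, r)" using kr by (simp add: IM_def)
  qed (auto simp: IM_def block_mat_def)
  have block_PM: "block_mat xs ss * PM ss = PM xs" if xs: "set xs \<subseteq> carrier G" for xs
  proof (rule eq_matI)
    fix p k assume "p < dim_row (PM xs)" "k < dim_col (PM xs)"
    then have pk: "p < length xs * d" "k < ?n" by (auto simp: PM_def)
    let ?x = "xs ! (p div d)" and ?b = "p mod d"
    have x: "?x \<in> carrier G" using nth_in_carrier xs pk by auto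
    have b: "?b < d" using d_pos by simp
    obtain i where i: "i < length ss" "inv (ss ! i) \<otimes> ?x \<in> H"
      and uniq: "\<And>j. j < length ss \<Longrightarrow> inv (ss ! j) \<otimes> ?x \<in> H \<Longrightarrow> j = i"
      using coset_index[OF x] by metis
    let ?h = "inv ?x \<otimes> ss ! i"
    have swap: "inv ?x \<otimes> ss ! j \<in> H \<longleftrightarrow> inv (ss ! j) \<otimes> ?x \<in> H" if "j < length ss" for j
      using H_inv_iff[of "inv (ss ! j) \<otimes> ?x"] x that by (simp add: inv_mult_group)
    have h: "?h \<in> H" using swap i by simp
    define f where "f j a = ext (inv ?x \<otimes> ss ! j) $$ (?b, a) * (C * \<Xi> (inv (ss ! j))) $$ (a, k)" for j a
    have "(block_mat xs ss * PM ss) $$ (p, k) = (\<Sum>q<?N. f (q div d) (q mod d))"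
      using mult_index[OF block_mat_carrier[OF refl refl] PMc pk] pk by (simp add: PM_def block_mat_def f_def)
    also have "\<dots> = (\<Sum>a<d. f i a)"
      by (rule sum_over_coset[OF i(1) uniq]) (auto simp: f_def ext_def b swap)
    also have "\<dots> = (\<rho> ?h * (C * \<Xi> (inv (ss ! i)))) $$ (?b, k)"
      using mult_index[OF \<rho>_carrier[OF h] CX b pk(2), of "inv (ss ! i)"] i h by (simp add: f_def ext_def)
    also have "\<rho> ?h * (C * \<Xi> (inv (ss ! i))) = (C * \<Xi> ?h) * \<Xi> (inv (ss ! i))"
      using assoc_mult_mat[OF \<rho>_carrier[OF h] Cc R(3), of "inv (ss ! i)"] i Ch[OF h] by simp
    also have "\<dots> = C * \<Xi> (?h \<otimes> inv (ss ! i))"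
      using assoc_mult_mat[OF Cc R(3) R(3), of ?h "inv (ss ! i)"] i x R(4)[of ?h "inv (ss ! i)"] by simp
    also have "?h \<otimes> inv (ss ! i) = inv ?x" using i x by (simp add: m_assoc)
    finally show "(block_mat xs ss * PM ss) $$ (p, k) = PM xs $$ (p, k)" using pk by (simp add: PM_def)
  qed (auto simp: PM_def block_mat_def)
  define \<iota> where "\<iota> = IM ss"
  define \<pi> where "\<pi> = PM ss"
  have \<iota>c: "\<iota> \<in> carrier_mat ?n ?N" and \<pi>c: "\<pi> \<in> carrier_mat ?N ?n" using IMc PMc by (auto simp: \<iota>_def \<pi>_def)
  have "graded ind_list A \<iota>"
  proof (rule gradedI)
    fix k q assume kq: "k < ?n" "q < length ind_list" "\<not> cp_iso c (ind_list ! q) (A ! k)"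
    let ?s = "ss ! (q div d)"
    have s: "?s \<in> carrier G" and qm: "q mod d < d" using kq block_index_less[of q "length ss" d] by auto
    have "graded (replicate d (\<phi> ?s X)) (?s \<cdot> A) B"
      using graded_act[OF s, of "replicate d X" A B] B X A by (simp add: act_replicate)
    then have "graded (replicate d (\<phi> ?s X)) A (\<Xi> ?s * B)"
      using R(2)[OF s] s X A by (intro graded_mult[of _ "?s \<cdot> A"]) simp_all
    then show "\<iota> $$ (k, q) = 0"
      using kq qm gradedE[of "replicate d (\<phi> ?s X)" A _ k "q mod d"] by (simp add: \<iota>_def IM_def nth_ind_list)
  qed (use \<iota>c in simp)
  moreover have "\<iota> * ind_rep g = \<Xi> g * \<iota>" if g: "g \<in> carrier G" for g
  proof -
    have "\<iota> * ind_rep g = IM (shift g)" using IM_block[of "shift g"] g by (simp add: \<iota>_def ind_rep_def)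
    also have "\<dots> = \<Xi> g * \<iota>"
    proof (rule eq_matI)
      fix k q assume "k < dim_row (\<Xi> g * \<iota>)" "q < dim_col (\<Xi> g * \<iota>)"
      then have kq: "k < ?n" "q < ?N" using R(3)[OF g] \<iota>c by auto
      let ?s = "ss ! (q div d)"
      have s: "?s \<in> carrier G" and qm: "q div d < length ss" "q mod d < d" using kq block_index_less[of q "length ss" d] by auto
      have "(\<Xi> g * \<iota>) $$ (k, q) = (\<Sum>j<?n. \<Xi> g $$ (k, j) * (\<Xi> ?s * B) $$ (j, q mod d))"
        using mult_index[OF R(3)[OF g] \<iota>c kq] kq by (simp add: \<iota>_def IM_def)
      also have "\<dots> = (\<Xi> g * (\<Xi> ?s * B)) $$ (k, q mod d)"
        using mult_index[OF R(3)[OF g] XB[OF s] kq(1) qm(2)] by simp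
      also have "\<Xi> g * (\<Xi> ?s * B) = \<Xi> (g \<otimes> ?s) * B"
        using assoc_mult_mat[OF R(3)[OF g] R(3)[OF s] Bc] R(4)[OF g s] by simp
      finally show "IM (shift g) $$ (k, q) = (\<Xi> g * \<iota>) $$ (k, q)" using kq qm by (simp add: IM_def shift_def)
    qed (use R(3)[OF g] \<iota>c in \<open>auto simp: IM_def\<close>)
    finally show ?thesis .
  qed
  ultimately have 1: "graded_hom ind_list ind_rep A \<Xi> \<iota>" by (simp add: graded_hom_def)
  have "graded A ind_list \<pi>"
  proof (rule gradedI)
    fix p k assume pk: "p < length ind_list" "k < ?n" "\<not> cp_iso c (A ! k) (ind_list ! p)"
    let ?s = "ss ! (p div d)"
    have s: "?s \<in> carrier G" and pm: "p mod d < d" using pk block_index_less[of p "length ss" d] by auto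
    have "graded (inv ?s \<cdot> A) (replicate d X) (C * \<Xi> (inv ?s))"
      using R(2)[of "inv ?s"] s X A C by (intro graded_mult[of _ A]) simp_all
    then have "graded A (replicate d (\<phi> ?s X)) (C * \<Xi> (inv ?s))"
      using graded_act[OF s, of "inv ?s \<cdot> A" "replicate d X"] s X A by (simp add: act_replicate)
    then show "\<pi> $$ (p, k) = 0"
      using pk pm gradedE[of A "replicate d (\<phi> ?s X)" _ "p mod d" k] by (simp add: \<pi>_def PM_def nth_ind_list)
  qed (use \<pi>c in simp)
  moreover have "\<pi> * \<Xi> g = ind_rep g * \<pi>" if g: "g \<in> carrier G" for g
  proof -
    have "ind_rep g * \<pi> = PM (shift (inv g))" using block_PM[of "shift (inv g)"] g by (simp add: \<pi>_def ind_rep_alt)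
    also have "\<dots> = \<pi> * \<Xi> g"
    proof (rule eq_matI)
      fix p k assume "p < dim_row (\<pi> * \<Xi> g)" "k < dim_col (\<pi> * \<Xi> g)"
      then have pk: "p < ?N" "k < ?n" using R(3)[OF g] \<pi>c by auto
      let ?s = "ss ! (p div d)"
      have s: "?s \<in> carrier G" and pm: "p div d < length ss" "p mod d < d" using pk block_index_less[of p "length ss" d] by auto
      have "(\<pi> * \<Xi> g) $$ (p, k) = (\<Sum>j<?n. (C * \<Xi> (inv ?s)) $$ (p mod d, j) * \<Xi> g $$ (j, k))"
        using mult_index[OF \<pi>c R(3)[OF g] pk] pk by (simp add: \<pi>_def PM_def)
      also have "\<dots> = (C * \<Xi> (inv ?s) * \<Xi> g) $$ (p mod d, k)"
        using mult_index[OF CX R(3)[OF g] pm(2) pk(2), of "inv ?s"] s by simp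
      also have "C * \<Xi> (inv ?s) * \<Xi> g = C * \<Xi> (inv ?s \<otimes> g)"
        using assoc_mult_mat[OF Cc R(3) R(3)[OF g], of "inv ?s"] R(4)[of "inv ?s" g] s g by simp
      also have "inv ?s \<otimes> g = inv (inv g \<otimes> ?s)" using s g by (simp add: inv_mult_group)
      finally show "PM (shift (inv g)) $$ (p, k) = (\<pi> * \<Xi> g) $$ (p, k)" using pk pm by (simp add: PM_def shift_def)
    qed (use R(3)[OF g] \<pi>c in \<open>auto simp: PM_def\<close>)
    finally show ?thesis by simp
  qed
  ultimately have 2: "graded_hom A \<Xi> ind_list ind_rep \<pi>" by (simp add: graded_hom_def)
  have 3: "\<pi> * \<iota> = 1\<^sub>m ?N"
  proof (rule eq_matI)
    fix p q assume "p < dim_row (1\<^sub>m ?N)" "q < dim_col (1\<^sub>m ?N)"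
    then have pq: "p < ?N" "q < ?N" by auto
    note b = block_index_less[OF pq(1)] block_index_less[OF pq(2)]
    let ?s = "ss ! (p div d)" and ?t = "ss ! (q div d)" and ?g = "inv (ss ! (p div d)) \<otimes> ss ! (q div d)"
    have s: "?s \<in> carrier G" and t: "?t \<in> carrier G" using b by auto
    have "(\<pi> * \<iota>) $$ (p, q) = (\<Sum>j<?n. (C * \<Xi> (inv ?s)) $$ (p mod d, j) * (\<Xi> ?t * B) $$ (j, q mod d))"
      using mult_index[OF \<pi>c \<iota>c pq] pq by (simp add: \<pi>_def \<iota>_def PM_def IM_def)
    also have "\<dots> = ((C * \<Xi> (inv ?s)) * (\<Xi> ?t * B)) $$ (p mod d, q mod d)"
      using mult_index[OF CX XB[OF t], of "inv ?s" "p mod d" "q mod d"] s b by simp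
    also have "(C * \<Xi> (inv ?s)) * (\<Xi> ?t * B) = C * (\<Xi> (inv ?s) * (\<Xi> ?t * B))"
      using assoc_mult_mat[OF Cc R(3) XB[OF t], of "inv ?s"] s by simp
    also have "\<Xi> (inv ?s) * (\<Xi> ?t * B) = \<Xi> ?g * B"
      using assoc_mult_mat[OF R(3) R(3)[OF t] Bc, of "inv ?s"] R(4)[of "inv ?s" ?t] s t by simp
    also have "(C * (\<Xi> ?g * B)) $$ (p mod d, q mod d) = (if p = q then 1 else 0)"
    proof (cases "p div d = q div d")
      case True
      then have "p = q \<longleftrightarrow> p mod d = q mod d" by (metis div_mult_mod_eq)
      moreover have "\<Xi> ?g * B = B" using True t R(5) Bc by simp
      ultimately show ?thesis using CB b by simp
    next
      case False
      then have g: "?g \<notin> H" using ss_diff_in_H_iff b by simp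
      have gG: "?g \<in> carrier G" using s t by simp
      have "graded (replicate d (\<phi> ?g X)) (?g \<cdot> A) B"
        using graded_act[OF gG, of "replicate d X" A B] B X A by (simp add: act_replicate)
      then have "graded (replicate d (\<phi> ?g X)) A (\<Xi> ?g * B)"
        using R(2)[OF gG] gG X A by (intro graded_mult[of _ "?g \<cdot> A"]) simp_all
      then have "graded (replicate d (\<phi> ?g X)) (replicate d X) (C * (\<Xi> ?g * B))"
        using gG X A C by (simp add: graded_mult[of _ A])
      moreover have "\<not> cp_iso c (\<phi> ?g X) X" using g gG unfolding iso_stabilizer_def by blast
      ultimately have "(C * (\<Xi> ?g * B)) $$ (p mod d, q mod d) = 0"
        using b gradedE[of "replicate d (\<phi> ?g X)" "replicate d X" _ "p mod d" "q mod d"] by simp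
      then show ?thesis using False by auto
    qed
    finally show "(\<pi> * \<iota>) $$ (p, q) = 1\<^sub>m ?N $$ (p, q)" using pq by simp
  qed (use \<iota>c \<pi>c in auto)
  have 4: "E * \<iota> = \<iota>" if E: "E \<in> carrier_mat ?n ?n" "\<And>g. g \<in> carrier G \<Longrightarrow> E * \<Xi> g = \<Xi> g * E" "E * B = B" for E
  proof (rule eq_matI)
    fix k q assume "k < dim_row \<iota>" "q < dim_col \<iota>"
    then have kq: "k < ?n" "q < ?N" using \<iota>c by auto
    let ?s = "ss ! (q div d)"
    have s: "?s \<in> carrier G" and qm: "q mod d < d" using kq block_index_less[of q "length ss" d] by auto
    have "(E * \<iota>) $$ (k, q) = (\<Sum>j<?n. E $$ (k, j) * (\<Xi> ?s * B) $$ (j, q mod d))"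
      using mult_index[OF E(1) \<iota>c kq] kq by (simp add: \<iota>_def IM_def)
    also have "\<dots> = (E * (\<Xi> ?s * B)) $$ (k, q mod d)" using mult_index[OF E(1) XB[OF s] kq(1) qm] by simp
    also have "E * (\<Xi> ?s * B) = \<Xi> ?s * B"
      using assoc_mult_mat[OF E(1) R(3)[OF s] Bc] assoc_mult_mat[OF R(3)[OF s] E(1) Bc] E(2)[OF s] E(3) by simp
    finally show "(E * \<iota>) $$ (k, q) = \<iota> $$ (k, q)" using kq by (simp add: \<iota>_def IM_def)
  qed (use E \<iota>c in auto)
  have "\<pi> * \<iota> = 1\<^sub>m (length ind_list)" using 3 by simp
  then show thesis using 4 by (rule that[OF 1 2])
qed

end

section \<open>Splitting off an induced summand\<close>

lemma mat_assoc:
  fixes L :: "complex mat"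
  shows "dim_col L = dim_row M \<Longrightarrow> dim_col M = dim_row N \<Longrightarrow> L * M * N = L * (M * N)"
  by (rule assoc_mult_mat) auto

lemma mult_cols_fixed:
  fixes B C M :: "complex mat"
  assumes "B \<in> carrier_mat n d" "C \<in> carrier_mat d n" "M \<in> carrier_mat n m"
    and "\<And>j. j < m \<Longrightarrow> B *\<^sub>v (C *\<^sub>v col M j) = col M j"
  shows "B * (C * M) = M"
proof (rule mat_col_eqI)
  fix j assume "j < dim_col M"
  then have j: "j < m" using assms by simp
  have "col (B * (C * M)) j = B *\<^sub>v (C *\<^sub>v col M j)"
    using assms(1-3) j col_mult2[of B n d "C * M" m j] col_mult2[of C d n M m j] by simp
  then show "col (B * (C * M)) j = col M j" using assms(4)[OF j] by simp
qed (use assms in auto)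

lemma wsum_single:
  assumes "finite S" "l \<in> S" "f l \<in> carrier_mat n m" "\<And>x. x \<in> S \<Longrightarrow> x \<noteq> l \<Longrightarrow> f x = 0\<^sub>m n m"
  shows "wsum 1 n m S f = f l"
proof (rule eq_matI)
  fix i j assume "i < dim_row (f l)" "j < dim_col (f l)"
  then have ij: "i < n" "j < m" using assms by auto
  have "(\<Sum>x\<in>S. f x $$ (i, j)) = (\<Sum>x\<in>{l}. f x $$ (i, j))"
    using assms ij by (intro sum.mono_neutral_right) auto
  then show "wsum 1 n m S f $$ (i, j) = f l $$ (i, j)" using ij by (simp add: wsum_def)
qed (use assms in \<open>auto simp: wsum_def\<close>)

context cyc_poset_action
begin

lemma graded_hom_comp:
  assumes rep: "graded_rep A \<Xi>" "graded_rep B \<Omega>" "graded_rep D \<Theta>"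
    and M: "graded_hom A \<Xi> B \<Omega> M" and N: "graded_hom B \<Omega> D \<Theta> N"
  shows "graded_hom A \<Xi> D \<Theta> (N * M)"
  unfolding graded_hom_def
proof (intro conjI ballI)
  show "graded A D (N * M)"
    using graded_mult[OF _ _ _ graded_homD(1)[OF M] graded_homD(1)[OF N]] rep graded_repD(1) by blast
  fix g assume g: "g \<in> carrier G"
  note [simp] = carrier_matD[OF graded_homD(2)[OF M]] carrier_matD[OF graded_homD(2)[OF N]]
    carrier_matD[OF graded_repD(3)[OF rep(1) g]] carrier_matD[OF graded_repD(3)[OF rep(2) g]]
    carrier_matD[OF graded_repD(3)[OF rep(3) g]]
  have "N * M * \<Xi> g = (N * \<Omega> g) * M" using graded_homD(3)[OF M g] by (simp add: mat_assoc)
  then show "N * M * \<Xi> g = \<Theta> g * (N * M)" using graded_homD(3)[OF N g] by (simp add: mat_assoc)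
qed

lemma graded_replicate_act:
  assumes "g \<in> carrier G" "X \<in> \<X>" "A \<in> lists \<X>"
  shows "graded (replicate d X) A M \<longleftrightarrow> graded (replicate d (\<phi> g X)) (g \<cdot> A) M"
    and "graded A (replicate d X) M \<longleftrightarrow> graded (g \<cdot> A) (replicate d (\<phi> g X)) M"
  using graded_act[OF assms(1), of "replicate d X" A M] graded_act[OF assms(1), of A "replicate d X" M] assms
  by (simp_all add: act_replicate)

text \<open>
  Multiplication by \<open>\<Xi> g\<close> moves the fibre at \<open>X\<close> to the fibre at \<open>g X\<close>.
\<close>

lemma graded_rep_mult:
  assumes rep: "graded_rep A \<Xi>" and g: "g \<in> carrier G" and X: "X \<in> \<X>"
  shows "graded (replicate d X) A M \<Longrightarrow> graded (replicate d (\<phi> g X)) A (\<Xi> g * M)"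
    and "graded A (replicate d X) M \<Longrightarrow> graded A (replicate d (\<phi> (inv g) X)) (M * \<Xi> g)"
proof -
  note R = graded_repD[OF rep]
  assume "graded (replicate d X) A M"
  then have "graded (replicate d (\<phi> g X)) (g \<cdot> A) M" using graded_replicate_act R X g by blast
  then show "graded (replicate d (\<phi> g X)) A (\<Xi> g * M)"
    using R g X by (simp add: graded_mult[of _ "g \<cdot> A"])
next
  note R = graded_repD[OF rep]
  assume "graded A (replicate d X) M"
  then have "graded (g \<cdot> A) (replicate d X) (M * \<Xi> g)" using R g X by (simp add: graded_mult[of _ A])
  then show "graded A (replicate d (\<phi> (inv g) X)) (M * \<Xi> g)"
    using graded_replicate_act(2)[of "inv g" X "g \<cdot> A"] R g X by simp
qed

lemma graded_square: "X \<in> \<X> \<Longrightarrow> M \<in> carrier_mat e d \<Longrightarrow> graded (replicate d X) (replicate e X) M"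
  by (rule gradedI) auto

text \<open>
  Take \<open>X\<close> such that the image of \<open>E\<close> has a non-zero fibre at \<open>X\<close>, and in this fibre a non-zero
  subspace that is invariant under the stabilizer and of least dimension; the representation on it
  is irreducible. As in Maschke's theorem, a projection onto it becomes equivariant by averaging over
  the stabilizer.
\<close>

lemma irreducible_summand:
  assumes rep: "graded_rep A \<Xi>" and E: "graded_hom A \<Xi> A \<Xi> E" "E * E = E" "E \<noteq> 0\<^sub>m (length A) (length A)"
  obtains X d \<rho> B C where "X \<in> \<X>" "irreducible_representation G (stab X) d \<rho>"
    "graded (replicate d X) A B" "graded A (replicate d X) C"
    "\<And>h. h \<in> stab X \<Longrightarrow> \<Xi> h * B = B * \<rho> h" "\<And>h. h \<in> stab X \<Longrightarrow> C * \<Xi> h = \<rho> h * C"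
    "C * B = 1\<^sub>m d" "E * B = B"
proof -
  let ?n = "length A"
  note R = graded_repD[OF rep]
  have A: "A \<in> lists \<X>" by (rule R(1))
  have Ec: "E \<in> carrier_mat ?n ?n" and Eg: "graded A A E" using graded_homD[OF E(1)] by auto
  obtain k0 i0 where ki0: "k0 < ?n" "i0 < ?n" "E $$ (k0, i0) \<noteq> 0"
  proof (rule ccontr)
    assume "\<not> thesis"
    then have "E = 0\<^sub>m ?n ?n" using Ec that by (intro eq_matI) auto
    then show False using E by simp
  qed
  define X where "X = A ! i0"
  have X: "X \<in> \<X>" using nth_in[OF A ki0(2)] by (simp add: X_def)
  let ?H = "stab X"
  have HG: "h \<in> carrier G" if "h \<in> ?H" for h using that stab_subset by blast
  have iso_hX: "cp_iso c (\<phi> h X) X" if "h \<in> ?H" for h using that by (auto simp: iso_stabilizer_def)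
  have graded_H: "graded (replicate m X) A (\<Xi> h * M)" if "h \<in> ?H" "graded (replicate m X) A M" for h m M
    using graded_rep_mult(1)[OF rep HG[OF that(1)] X that(2)] graded_replicate_iso(1)[OF _ X iso_hX[OF that(1)] A]
      HG[OF that(1)] X by simp
  \<comment> \<open>bases \<open>B\<close> of invariant subspaces of the fibre at \<open>X\<close> of the image of \<open>E\<close>, split by \<open>C\<close>\<close>
  define good where "good d B C \<longleftrightarrow> 0 < d \<and> graded (replicate d X) A B \<and> C \<in> carrier_mat d ?n \<and> C * B = 1\<^sub>m d \<and> E * B = B \<and>
      (\<forall>h\<in>?H. B * (C * (\<Xi> h * B)) = \<Xi> h * B)" for d B C
  have "\<exists>d B C. good d B C"
  proof -
    define W where "W = {w \<in> carrier_vec ?n. E *\<^sub>v w = w \<and> (\<forall>k<?n. \<not> cp_iso c X (A ! k) \<longrightarrow> w $ k = 0)}"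
    have "subsp ?n W" unfolding subsp_iff W_def using Ec
      by (auto simp: mult_add_distrib_mat_vec[of _ ?n ?n] mult_mat_vec[of _ ?n ?n])
    then obtain d B C where B: "B \<in> carrier_mat ?n d" and C: "C \<in> carrier_mat d ?n" and CB: "C * B = 1\<^sub>m d"
      and BW: "\<And>v. v \<in> carrier_vec d \<Longrightarrow> B *\<^sub>v v \<in> W" and fix_W: "\<And>w. w \<in> W \<Longrightarrow> B *\<^sub>v (C *\<^sub>v w) = w"
      using subspace_split_basis by metis
    have colW: "col B j \<in> W" if "j < d" for j
    proof -
      have "col B j = B *\<^sub>v unit_vec d j" using B that by (intro eq_vecI) auto
      then show ?thesis using BW[of "unit_vec d j"] by simp
    qed
    have EB: "E * B = B"
    proof (rule mat_col_eqI)
      fix j assume "j < dim_col B"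
      then have j: "j < d" using B by simp
      then show "col (E * B) j = col B j" using colW[OF j] col_mult2[OF Ec B j] by (simp add: W_def)
    qed (use Ec B in auto)
    have Bg: "graded (replicate d X) A B"
    proof (rule gradedI)
      fix k a assume "k < ?n" "a < length (replicate d X)" "\<not> cp_iso c (replicate d X ! a) (A ! k)"
      then show "B $$ (k, a) = 0" using colW[of a] B by (auto simp: W_def)
    qed (use B in simp)
    have "B * (C * (\<Xi> h * B)) = \<Xi> h * B" if h: "h \<in> ?H" for h
    proof (rule mult_cols_fixed[OF B C])
      have Xh: "\<Xi> h \<in> carrier_mat ?n ?n" by (rule R(3)[OF HG[OF h]])
      show XB: "\<Xi> h * B \<in> carrier_mat ?n d" using Xh B by simp
      fix j assume j: "j < d"
      have "E * (\<Xi> h * B) = \<Xi> h * B"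
        using assoc_mult_mat[OF Ec Xh B] assoc_mult_mat[OF Xh Ec B] graded_homD(3)[OF E(1) HG[OF h]] EB by simp
      then have "E *\<^sub>v col (\<Xi> h * B) j = col (\<Xi> h * B) j" using col_mult2[OF Ec XB j] by simp
      moreover have "col (\<Xi> h * B) j $ k = 0" if "k < ?n" "\<not> cp_iso c X (A ! k)" for k
        using gradedE[OF graded_H[OF h Bg], of k j] that j XB Xh B by simp
      ultimately have "col (\<Xi> h * B) j \<in> W" using XB j Xh B by (simp add: W_def)
      then show "B *\<^sub>v (C *\<^sub>v col (\<Xi> h * B) j) = col (\<Xi> h * B) j" by (rule fix_W)
    qed
    moreover have "0 < d"
    proof (rule ccontr)
      assume "\<not> 0 < d"
      have "col E i0 \<in> W" using Ec ki0 col_mult2[OF Ec Ec ki0(2)] gradedE[OF Eg _ ki0(2)] E(2) by (simp add: W_def X_def)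
      then have "B *\<^sub>v (C *\<^sub>v col E i0) = col E i0" by (rule fix_W)
      moreover have "(B *\<^sub>v (C *\<^sub>v col E i0)) $ k0 = 0" using \<open>\<not> 0 < d\<close> B C ki0 by (simp add: scalar_prod_def)
      ultimately show False using ki0 Ec by simp
    qed
    ultimately show ?thesis using Bg C CB EB unfolding good_def by blast
  qed
  then have "\<exists>d. \<exists>B C. good d B C" by blast
  then obtain d where d: "\<exists>B C. good d B C" and min: "\<And>d'. \<exists>B C. good d' B C \<Longrightarrow> d \<le> d'"
    using LeastI_ex[of "\<lambda>d. \<exists>B C. good d B C"] Least_le[of "\<lambda>d. \<exists>B C. good d B C"] by blast
  then obtain B C where good: "good d B C" by blast
  then have d_pos: "0 < d" and Bg: "graded (replicate d X) A B" and C: "C \<in> carrier_mat d ?n" and CB: "C * B = 1\<^sub>m d"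
    and EB: "E * B = B" and inv_B: "\<And>h. h \<in> ?H \<Longrightarrow> B * (C * (\<Xi> h * B)) = \<Xi> h * B" by (auto simp: good_def)
  have B: "B \<in> carrier_mat ?n d" using gradedD[OF Bg] by simp
  define \<rho> where "\<rho> h = C * (\<Xi> h * B)" for h
  have Xc: "\<Xi> h \<in> carrier_mat ?n ?n" if "h \<in> ?H" for h using R(3)[OF HG[OF that]] .
  have \<rho>c: "\<rho> h \<in> carrier_mat d d" if "h \<in> ?H" for h using B C Xc[OF that] by (simp add: \<rho>_def)
  have Bh: "\<Xi> h * B = B * \<rho> h" if "h \<in> ?H" for h using inv_B[OF that] by (simp add: \<rho>_def)
  have \<rho>_mult: "\<rho> (h \<otimes> k) = \<rho> h * \<rho> k" if "h \<in> ?H" "k \<in> ?H" for h k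
  proof -
    note [simp] = carrier_matD[OF B] carrier_matD[OF C] carrier_matD[OF Xc[OF that(1)]] carrier_matD[OF Xc[OF that(2)]]
      carrier_matD[OF \<rho>c[OF that(1)]] carrier_matD[OF \<rho>c[OF that(2)]]
    have "\<rho> (h \<otimes> k) = C * (\<Xi> h * (\<Xi> k * B))" using R(4) HG that by (simp add: \<rho>_def mat_assoc)
    also have "\<dots> = \<rho> h * \<rho> k" unfolding Bh[OF that(2)] using that by (simp add: \<rho>_def mat_assoc)
    finally show ?thesis .
  qed
  have \<rho>_one: "\<rho> \<one> = 1\<^sub>m d" using R(5) B CB by (simp add: \<rho>_def)
  have rep\<rho>: "representation G ?H d \<rho>" by (rule representationI[OF X \<rho>c \<rho>_mult \<rho>_one])
  have irr: "irreducible_representation G ?H d \<rho>"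
    unfolding irreducible_representation_def subsp_def[symmetric]
  proof (intro conjI rep\<rho> d_pos allI impI)
    fix W assume W: "subsp d W \<and> (\<forall>h\<in>?H. \<forall>w\<in>W. \<rho> h *\<^sub>v w \<in> W)"
    then obtain d' B' C' where B': "B' \<in> carrier_mat d d'" and C': "C' \<in> carrier_mat d' d" and CB': "C' * B' = 1\<^sub>m d'"
      and BW: "\<And>v. v \<in> carrier_vec d' \<Longrightarrow> B' *\<^sub>v v \<in> W" and fix_W: "\<And>w. w \<in> W \<Longrightarrow> B' *\<^sub>v (C' *\<^sub>v w) = w"
      using subspace_split_basis by metis
    show "W = {0\<^sub>v d} \<or> W = carrier_vec d"
    proof (cases "d' = 0")
      case True
      have "w = 0\<^sub>v d" if "w \<in> W" for w
      proof -
        have "w = B' *\<^sub>v (C' *\<^sub>v w)" using fix_W[OF that] by simp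
        also have "\<dots> = 0\<^sub>v d" using B' C' True by (intro eq_vecI) (auto simp: scalar_prod_def)
        finally show ?thesis .
      qed
      moreover have "0\<^sub>v d \<in> W" using W by (simp add: subsp_iff)
      ultimately show ?thesis by blast
    next
      case False
      have colW: "col B' j \<in> W" if "j < d'" for j
      proof -
        have "col B' j = B' *\<^sub>v unit_vec d' j" using B' that by (intro eq_vecI) auto
        then show ?thesis using BW[of "unit_vec d' j"] by simp
      qed
      note dims[simp] = carrier_matD[OF B] carrier_matD[OF C] carrier_matD[OF B'] carrier_matD[OF C'] carrier_matD[OF Ec]
      \<comment> \<open>\<open>W\<close> gives an invariant subspace of the fibre, so by minimality its dimension is \<open>d\<close>\<close>
      have "good d' (B * B') (C' * C)" unfolding good_def
      proof (intro conjI ballI)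
        show "graded (replicate d' X) A (B * B')"
          using graded_mult[OF _ _ A graded_square[OF X B'] Bg] X by simp
        have "C' * C * (B * B') = C' * ((C * B) * B')" by (simp add: mat_assoc)
        then show "C' * C * (B * B') = 1\<^sub>m d'" using CB CB' B' by simp
        have "E * (B * B') = (E * B) * B'" by (simp add: mat_assoc)
        then show "E * (B * B') = B * B'" using EB by simp
        fix h assume h: "h \<in> ?H"
        note [simp] = carrier_matD[OF Xc[OF h]] carrier_matD[OF \<rho>c[OF h]]
        have "B' * (C' * (\<rho> h * B')) = \<rho> h * B'"
        proof (rule mult_cols_fixed[OF B' C'])
          show "\<rho> h * B' \<in> carrier_mat d d'" using \<rho>c[OF h] B' by simp
          fix j assume j: "j < d'"
          have "col (\<rho> h * B') j \<in> W" using col_mult2[OF \<rho>c[OF h] B' j] colW[OF j] W h by simp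
          then show "B' *\<^sub>v (C' *\<^sub>v col (\<rho> h * B') j) = col (\<rho> h * B') j" by (rule fix_W)
        qed
        moreover have XBB: "\<Xi> h * (B * B') = B * (\<rho> h * B')"
        proof -
          have "\<Xi> h * (B * B') = (\<Xi> h * B) * B'" by (simp add: mat_assoc)
          also have "\<dots> = B * (\<rho> h * B')" unfolding Bh[OF h] by (simp add: mat_assoc)
          finally show ?thesis .
        qed
        moreover have "C * (B * (\<rho> h * B')) = \<rho> h * B'"
        proof -
          have "C * (B * (\<rho> h * B')) = (C * B) * (\<rho> h * B')" by (simp add: mat_assoc)
          then show ?thesis using \<rho>c[OF h] by (simp add: CB)
        qed
        ultimately show "B * B' * (C' * C * (\<Xi> h * (B * B'))) = \<Xi> h * (B * B')"
          by (simp add: mat_assoc)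
      qed (use False C C' in auto)
      then have "d \<le> d'" using min by blast
      moreover have "d' \<le> d" using left_inverse_le_dim[OF B' C' CB'] .
      ultimately have "B' * C' = 1\<^sub>m d" using mat_mult_left_right_inverse[of C' d B'] B' C' CB' by simp
      then have "v \<in> W" if "v \<in> carrier_vec d" for v
        using BW[of "C' *\<^sub>v v"] assoc_mult_mat_vec[OF B' C' that] that C' by simp
      then show ?thesis using W by (auto simp: subsp_iff)
    qed
  qed
  \<comment> \<open>dropping the columns outside the fibre at \<open>X\<close> makes the left inverse graded; then it is averaged over the stabilizer\<close>
  define C1 where "C1 = mat d ?n (\<lambda>(a, k). if cp_iso c (A ! k) X then C $$ (a, k) else 0)"
  have C1c: "C1 \<in> carrier_mat d ?n" by (simp add: C1_def)
  have C1g: "graded A (replicate d X) C1" by (rule gradedI) (auto simp: C1_def)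
  have C1B: "C1 * B = 1\<^sub>m d"
  proof (rule eq_matI)
    fix a b assume "a < dim_row (1\<^sub>m d)" "b < dim_col (1\<^sub>m d)"
    then have ab: "a < d" "b < d" by auto
    have "C1 $$ (a, k) * B $$ (k, b) = C $$ (a, k) * B $$ (k, b)" if k: "k < ?n" for k
      using gradedE[OF Bg k, of b] ab k cp_iso_sym[of X "A ! k"] X nth_in[OF A k]
      by (auto simp: C1_def)
    then have "(C1 * B) $$ (a, b) = (C * B) $$ (a, b)"
      unfolding mult_index[OF C1c B ab] mult_index[OF C B ab] by (intro sum.cong) simp_all
    then show "(C1 * B) $$ (a, b) = 1\<^sub>m d $$ (a, b)" using CB by simp
  qed (use C1c B in auto)
  have Hfin: "finite ?H" using fin stab_subset finite_subset by blast
  let ?s = "1 / of_nat (card ?H) :: complex"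
  define f where "f h = \<rho> h * (C1 * \<Xi> (inv h))" for h
  define C2 where "C2 = wsum ?s d ?n ?H f"
  have invH: "inv h \<in> ?H" if "h \<in> ?H" for h using stab_inv[OF X that] .
  have fc: "f h \<in> carrier_mat d ?n" if "h \<in> ?H" for h
    using \<rho>c[OF that] C1c Xc[OF invH[OF that]] by (auto simp: f_def)
  have "graded A (replicate d X) (f h)" if h: "h \<in> ?H" for h
  proof -
    have "graded A (replicate d (\<phi> h X)) (C1 * \<Xi> (inv h))"
      using graded_rep_mult(2)[OF rep HG[OF invH[OF h]] X C1g] HG[OF h] by simp
    then have "graded A (replicate d X) (C1 * \<Xi> (inv h))"
      using graded_replicate_iso(2)[OF _ X iso_hX[OF h] A] X HG[OF h] by simp
    then show ?thesis using graded_mult[OF A _ _ _ graded_square[OF X \<rho>c[OF h]]] X by (simp add: f_def)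
  qed
  then have C2g: "graded A (replicate d X) C2"
    using graded_wsum[of ?H A "replicate d X" f ?s] by (simp add: C2_def)
  have "f h * B = 1\<^sub>m d" if h: "h \<in> ?H" for h
  proof -
    note [simp] = carrier_matD[OF B] carrier_matD[OF C1c] carrier_matD[OF Xc[OF invH[OF h]]]
      carrier_matD[OF \<rho>c[OF h]] carrier_matD[OF \<rho>c[OF invH[OF h]]]
    have "f h * B = \<rho> h * (C1 * (\<Xi> (inv h) * B))" by (simp add: f_def mat_assoc)
    also have "\<Xi> (inv h) * B = B * \<rho> (inv h)" using Bh invH h by blast
    also have "C1 * (B * \<rho> (inv h)) = (C1 * B) * \<rho> (inv h)" by (simp add: mat_assoc)
    also have "\<rho> h * \<dots> = \<rho> (h \<otimes> inv h)" using C1B \<rho>_mult[OF h invH[OF h]] \<rho>c[OF invH[OF h]] by simp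
    finally show ?thesis using HG[OF h] \<rho>_one by simp
  qed
  moreover have "C2 * B = wsum ?s d d ?H (\<lambda>h. f h * B)" unfolding C2_def by (rule wsum_mult[OF B fc])
  ultimately have C2B: "C2 * B = 1\<^sub>m d"
    using wsum_average[OF Hfin, of "1\<^sub>m d" d d "\<lambda>h. f h * B"] stab_one[OF X] by auto
  have C2h: "C2 * \<Xi> k = \<rho> k * C2" if k: "k \<in> ?H" for k
  proof -
    have 1: "\<rho> k * f h = f (k \<otimes> h) * \<Xi> k" if h: "h \<in> ?H" for h
    proof -
      have kh: "k \<otimes> h \<in> ?H" using stab_mult[OF X k h] .
      note [simp] = carrier_matD[OF C1c] carrier_matD[OF Xc[OF invH[OF h]]] carrier_matD[OF Xc[OF k]]
        carrier_matD[OF Xc[OF invH[OF kh]]] carrier_matD[OF \<rho>c[OF kh]]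
        carrier_matD[OF \<rho>c[OF h]] carrier_matD[OF \<rho>c[OF k]]
      have "f (k \<otimes> h) * \<Xi> k = \<rho> (k \<otimes> h) * (C1 * (\<Xi> (inv (k \<otimes> h)) * \<Xi> k))"
        by (simp add: f_def mat_assoc)
      also have "\<Xi> (inv (k \<otimes> h)) * \<Xi> k = \<Xi> (inv h)"
        using R(4)[of "inv (k \<otimes> h)" k] HG h k by (simp add: inv_mult_group m_assoc)
      finally show ?thesis using \<rho>_mult[OF k h] by (simp add: f_def mat_assoc)
    qed
    have bij: "bij_betw (\<lambda>h. k \<otimes> h) ?H ?H"
      using k invH HG stab_mult[OF X]
      by (intro bij_betwI[where g = "\<lambda>h. inv k \<otimes> h"]) (auto simp: m_assoc[symmetric])
    have "\<rho> k * C2 = wsum ?s d ?n ?H (\<lambda>h. \<rho> k * f h)"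
      unfolding C2_def by (rule mult_wsum[OF \<rho>c[OF k] fc])
    also have "\<dots> = wsum ?s d ?n ?H (\<lambda>h. f (k \<otimes> h) * \<Xi> k)" by (rule wsum_cong[OF 1])
    also have "\<dots> = wsum ?s d ?n ?H (\<lambda>h. f h * \<Xi> k)" by (rule wsum_reindex[OF bij])
    also have "\<dots> = C2 * \<Xi> k" unfolding C2_def by (rule wsum_mult[OF Xc[OF k] fc, symmetric])
    finally show ?thesis by simp
  qed
  show thesis by (rule that[OF X irr Bg C2g Bh C2h C2B EB])
qed

end

section \<open>Decomposition into induced objects\<close>

context cyc_poset_action
begin

lemma graded_rep_cancel:
  assumes rep: "graded_rep A \<Xi>" and g: "g \<in> carrier G" and Z: "Z \<in> carrier_mat (length A) b"
  shows "\<Xi> g * (\<Xi> (inv g) * Z) = Z" "\<Xi> (inv g) * (\<Xi> g * Z) = Z"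
proof -
  note R = graded_repD[OF rep]
  have "\<Xi> \<alpha> * (\<Xi> \<beta> * Z) = \<Xi> (\<alpha> \<otimes> \<beta>) * Z" if "\<alpha> \<in> carrier G" "\<beta> \<in> carrier G" for \<alpha> \<beta>
    using assoc_mult_mat[OF R(3)[OF that(1)] R(3)[OF that(2)] Z] R(4)[OF that] by simp
  then show "\<Xi> g * (\<Xi> (inv g) * Z) = Z" "\<Xi> (inv g) * (\<Xi> g * Z) = Z"
    using g R(5) left_mult_one_mat[OF Z] by simp_all
qed

lemma graded_hom_one_minus:
  assumes rep: "graded_rep A \<Xi>" and Q: "graded_hom A \<Xi> A \<Xi> Q"
  shows "graded_hom A \<Xi> A \<Xi> (1\<^sub>m (length A) - Q)"
proof -
  let ?n = "length A"
  note R = graded_repD[OF rep] and Q' = graded_homD[OF Q]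
  have "(1\<^sub>m ?n - Q) * \<Xi> g = \<Xi> g * (1\<^sub>m ?n - Q)" if g: "g \<in> carrier G" for g
    using minus_mult_distrib_mat[OF one_carrier_mat Q'(2) R(3)[OF g]]
      mult_minus_distrib_mat[OF R(3)[OF g] one_carrier_mat Q'(2)] R(3)[OF g] Q'(3)[OF g] by simp
  then show ?thesis using graded_minus[OF graded_one[OF R(1)] Q'(1)] by (simp add: graded_hom_def)
qed

end

type_synonym ('x, 'g) datum = "'x \<times> nat \<times> ('g \<Rightarrow> complex mat)"

locale cyc_poset_transversals = cyc_poset_action \<X> c G \<phi>
  for \<X> :: "'x set" and c and G :: "'g monoid" (structure) and \<phi> +
  fixes \<sigma> :: "'x \<Rightarrow> 'g list"
  assumes transversals: "\<And>X. X \<in> \<X> \<Longrightarrow> left_transversal G (iso_stabilizer G \<phi> c X) (\<sigma> X)"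
begin

definition irr_datum :: "('x, 'g) datum \<Rightarrow> bool" where
  "irr_datum = (\<lambda>(X, d, \<rho>). X \<in> \<X> \<and> irreducible_representation G (stab X) d \<rho>)"

definition S_list :: "('x, 'g) datum \<Rightarrow> 'x list" where
  "S_list = (\<lambda>(X, d, \<rho>). induced.ind_list \<phi> X (\<sigma> X) d)"

definition S_rep :: "('x, 'g) datum \<Rightarrow> 'g \<Rightarrow> complex mat" where
  "S_rep = (\<lambda>(X, d, \<rho>). induced.ind_rep c G \<phi> X (\<sigma> X) d \<rho>)"

lemma induced_if_irreducible:
  assumes "X \<in> \<X>" "irreducible_representation G (stab X) d \<rho>"
  shows "induced \<X> c G \<phi> X (\<sigma> X) d \<rho>"
  using assms transversals by unfold_locales (auto simp: irreducible_representation_def)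

lemma S_rep_graded: "irr_datum t \<Longrightarrow> graded_rep (S_list t) (S_rep t)"
  using induced.graded_rep_ind[OF induced_if_irreducible] by (auto simp: irr_datum_def S_list_def S_rep_def)

lemma S_list_nonempty: "irr_datum t \<Longrightarrow> S_list t \<noteq> []"
  using induced.ind_list_nonempty[OF induced_if_irreducible] by (auto simp: irr_datum_def S_list_def)

lemma S_obj_cobj: "irr_datum (X, d, \<rho>) \<Longrightarrow> S_obj G \<phi> c (\<sigma> X) X d \<rho> = cobj (S_list (X, d, \<rho>)) (S_rep (X, d, \<rho>))"
  using induced.S_obj_eq[OF induced_if_irreducible] by (simp add: irr_datum_def S_list_def S_rep_def)

text \<open>
  The structure maps of a direct sum of induced objects inside \<open>A\<close> that need not exhaust \<open>A\<close>.
\<close>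

definition orthogonal_summands where
  "orthogonal_summands A \<Xi> ts J K \<longleftrightarrow> (\<forall>t\<in>set ts. irr_datum t) \<and>
     (\<forall>k<length ts. graded_hom (S_list (ts ! k)) (S_rep (ts ! k)) A \<Xi> (J k) \<and>
        graded_hom A \<Xi> (S_list (ts ! k)) (S_rep (ts ! k)) (K k)) \<and>
     (\<forall>k<length ts. \<forall>l<length ts. K k * J l =
        (if k = l then 1\<^sub>m (length (S_list (ts ! k))) else 0\<^sub>m (length (S_list (ts ! k))) (length (S_list (ts ! l)))))"

text \<open>
  The first column of each \<open>J k\<close> and the first row of each \<open>K k\<close> form biorthogonal families.
\<close>

lemma orthogonal_summands_bound:
  assumes os: "orthogonal_summands A \<Xi> ts J K"
  shows "length ts \<le> length A"
proof (rule biorthogonal_le_dim[of _ "\<lambda>k. col (J k) 0" _ "\<lambda>k. row (K k) 0"])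
  have J: "J k \<in> carrier_mat (length A) (length (S_list (ts ! k)))"
    and K: "K k \<in> carrier_mat (length (S_list (ts ! k))) (length A)" if "k < length ts" for k
    using os that graded_homD(2) unfolding orthogonal_summands_def by blast+
  fix k assume k: "k < length ts"
  show "col (J k) 0 \<in> carrier_vec (length A)" "row (K k) 0 \<in> carrier_vec (length A)"
    using J[OF k] K[OF k] by (intro carrier_vecI; simp)+
  fix l assume l: "l < length ts"
  have pos: "0 < length (S_list (ts ! k))" if "k < length ts" for k
    using S_list_nonempty[of "ts ! k"] os that by (auto simp: orthogonal_summands_def)
  have "row (K k) 0 \<bullet> col (J l) 0 = (K k * J l) $$ (0, 0)"
    using J[OF l] K[OF k] pos[OF k] pos[OF l] by simp
  also have "\<dots> = (if k = l then 1 else 0)"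
    using os k l pos[OF k] pos[OF l] by (simp add: orthogonal_summands_def)
  finally show "row (K k) 0 \<bullet> col (J l) 0 = (if k = l then 1 else 0)" .
qed

text \<open>
  Let \<open>E\<close> be the idempotent complementary to a family of maximal length. If \<open>E\<close> is not zero, it contains
  a summand with maps \<open>\<iota>\<close> and \<open>\<pi>\<close> such that \<open>E \<iota> = \<iota>\<close>. Then \<open>\<iota>\<close> and \<open>\<pi> E\<close> extend the
  family, since \<open>E\<close> annihilates its members.
\<close>

lemma complete_orthogonal_summands:
  assumes rep: "graded_rep A \<Xi>"
  obtains ts J K where "orthogonal_summands A \<Xi> ts J K"
    "wsum 1 (length A) (length A) {..<length ts} (\<lambda>k. J k * K k) = 1\<^sub>m (length A)"
proof -
  let ?n = "length A"
  note R = graded_repD[OF rep]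
  define P where "P r \<longleftrightarrow> (\<exists>ts J K. orthogonal_summands A \<Xi> ts J K \<and> length ts = r)" for r
  have "P 0" unfolding P_def by (intro exI[of _ "[]"]) (simp add: orthogonal_summands_def)
  moreover have "r \<le> ?n" if "P r" for r using that orthogonal_summands_bound by (auto simp: P_def)
  ultimately have "P (Greatest P)" and max: "\<And>r. P r \<Longrightarrow> r \<le> Greatest P"
    by (metis GreatestI_nat, metis Greatest_le_nat)
  then obtain ts J K where os: "orthogonal_summands A \<Xi> ts J K" and len: "length ts = Greatest P"
    by (auto simp: P_def)
  let ?r = "length ts" and ?l = "\<lambda>k. length (S_list (ts ! k))"
  have irr: "irr_datum (ts ! k)" and J: "graded_hom (S_list (ts ! k)) (S_rep (ts ! k)) A \<Xi> (J k)"
    and K: "graded_hom A \<Xi> (S_list (ts ! k)) (S_rep (ts ! k)) (K k)" if "k < ?r" for k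
    using os that by (auto simp: orthogonal_summands_def)
  have KJ: "K k * J l = (if k = l then 1\<^sub>m (?l k) else 0\<^sub>m (?l k) (?l l))" if "k < ?r" "l < ?r" for k l
    using os that by (auto simp: orthogonal_summands_def)
  have Jc: "J k \<in> carrier_mat ?n (?l k)" and Kc: "K k \<in> carrier_mat (?l k) ?n" if "k < ?r" for k
    using graded_homD(2)[OF J[OF that]] graded_homD(2)[OF K[OF that]] by auto
  define Q where "Q = wsum 1 ?n ?n {..<?r} (\<lambda>k. J k * K k)"
  have JKc: "J k * K k \<in> carrier_mat ?n ?n" if "k \<in> {..<?r}" for k using Jc[of k] Kc[of k] that by auto
  have JK: "graded_hom A \<Xi> A \<Xi> (J k * K k)" if "k < ?r" for k
    using graded_hom_comp[OF rep S_rep_graded[OF irr[OF that]] rep K[OF that] J[OF that]] .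
  have Qc: "Q \<in> carrier_mat ?n ?n" by (simp add: Q_def)
  have Qh: "graded_hom A \<Xi> A \<Xi> Q" unfolding graded_hom_def
  proof (intro conjI ballI)
    show "graded A A Q" unfolding Q_def using graded_homD(1)[OF JK] by (intro graded_wsum) simp
    fix g assume g: "g \<in> carrier G"
    have "Q * \<Xi> g = wsum 1 ?n ?n {..<?r} (\<lambda>k. J k * K k * \<Xi> g)"
      unfolding Q_def by (rule wsum_mult[OF R(3)[OF g] JKc])
    also have "\<dots> = wsum 1 ?n ?n {..<?r} (\<lambda>k. \<Xi> g * (J k * K k))"
      by (rule wsum_cong) (use graded_homD(3)[OF JK _] g in simp)
    also have "\<dots> = \<Xi> g * Q" unfolding Q_def by (rule mult_wsum[OF R(3)[OF g] JKc, symmetric])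
    finally show "Q * \<Xi> g = \<Xi> g * Q" .
  qed
  have QJ: "Q * J l = J l" if l: "l < ?r" for l
  proof -
    have *: "J k * K k * J l = (if k = l then J l else 0\<^sub>m ?n (?l l))" if k: "k < ?r" for k
      using assoc_mult_mat[OF Jc[OF k] Kc[OF k] Jc[OF l]] KJ[OF k l] right_mult_one_mat[OF Jc[OF l]]
        right_mult_zero_mat[OF Jc[OF k], of "?l l"] by auto
    have "Q * J l = wsum 1 ?n (?l l) {..<?r} (\<lambda>k. J k * K k * J l)"
      unfolding Q_def by (rule wsum_mult[OF Jc[OF l] JKc])
    also have "\<dots> = J l * K l * J l"
      using * l Jc[OF l] by (intro wsum_single) auto
    finally show ?thesis using *[OF l] by simp
  qed
  have KQ: "K l * Q = K l" if l: "l < ?r" for l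
  proof -
    have *: "K l * (J k * K k) = (if k = l then K l else 0\<^sub>m (?l l) ?n)" if k: "k < ?r" for k
      using assoc_mult_mat[OF Kc[OF l] Jc[OF k] Kc[OF k]] KJ[OF l k] left_mult_one_mat[OF Kc[OF l]]
        left_mult_zero_mat[OF Kc[OF k], of "?l l"] by auto
    have "K l * Q = wsum 1 (?l l) ?n {..<?r} (\<lambda>k. K l * (J k * K k))"
      unfolding Q_def by (rule mult_wsum[OF Kc[OF l] JKc])
    also have "\<dots> = K l * (J l * K l)"
      using * l Kc[OF l] by (intro wsum_single) auto
    finally show ?thesis using *[OF l] by simp
  qed
  have QQ: "Q * Q = Q"
  proof -
    have "Q * wsum 1 ?n ?n {..<?r} (\<lambda>k. J k * K k) = wsum 1 ?n ?n {..<?r} (\<lambda>k. Q * (J k * K k))"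
      by (rule mult_wsum[OF Qc JKc])
    then have "Q * Q = wsum 1 ?n ?n {..<?r} (\<lambda>k. Q * (J k * K k))" by (simp flip: Q_def)
    also have "\<dots> = wsum 1 ?n ?n {..<?r} (\<lambda>k. J k * K k)"
    proof (rule wsum_cong)
      fix k assume "k \<in> {..<?r}"
      then have k: "k < ?r" by simp
      show "Q * (J k * K k) = J k * K k"
        using assoc_mult_mat[OF Qc Jc[OF k] Kc[OF k]] QJ[OF k] by simp
    qed
    also have "\<dots> = Q" by (simp add: Q_def)
    finally show ?thesis .
  qed
  define E where "E = 1\<^sub>m ?n - Q"
  have Eh: "graded_hom A \<Xi> A \<Xi> E" unfolding E_def by (rule graded_hom_one_minus[OF rep Qh])
  have Ec: "E \<in> carrier_mat ?n ?n" using graded_homD(2)[OF Eh] .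
  have EM: "E * M = M - Q * M" if "M \<in> carrier_mat ?n m" for M m
    using minus_mult_distrib_mat[OF one_carrier_mat Qc that] that by (simp add: E_def)
  have ME: "M * E = M - M * Q" if "M \<in> carrier_mat m ?n" for M m
    using mult_minus_distrib_mat[OF that one_carrier_mat Qc] that by (simp add: E_def)
  have EJ: "E * J l = 0\<^sub>m ?n (?l l)" if "l < ?r" for l
    using EM[OF Jc[OF that]] QJ[OF that] Jc[OF that] by (auto intro!: eq_matI)
  have KE: "K l * E = 0\<^sub>m (?l l) ?n" if "l < ?r" for l
    using ME[OF Kc[OF that]] KQ[OF that] Kc[OF that] by (auto intro!: eq_matI)
  have QE: "Q * E = 0\<^sub>m ?n ?n" using ME[OF Qc] QQ Qc by (auto intro!: eq_matI)
  have EE: "E * E = E" using EM[OF Ec] QE Ec by (auto intro!: eq_matI)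
  have "E = 0\<^sub>m ?n ?n"
  proof (rule ccontr)
    assume "E \<noteq> 0\<^sub>m ?n ?n"
    from irreducible_summand[OF rep Eh EE this]
    obtain X d \<rho> B C where X: "X \<in> \<X>" and irr\<rho>: "irreducible_representation G (stab X) d \<rho>"
      and BC: "graded (replicate d X) A B" "graded A (replicate d X) C"
      "\<And>h. h \<in> stab X \<Longrightarrow> \<Xi> h * B = B * \<rho> h" "\<And>h. h \<in> stab X \<Longrightarrow> C * \<Xi> h = \<rho> h * C"
      "C * B = 1\<^sub>m d" and EB: "E * B = B" by metis
    define t where "t = (X, d, \<rho>)"
    have t: "irr_datum t" using X irr\<rho> by (simp add: irr_datum_def t_def)
    interpret I: induced \<X> c G \<phi> X "\<sigma> X" d \<rho> by (rule induced_if_irreducible[OF X irr\<rho>])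
    let ?S = "S_list t" and ?T = "S_rep t"
    have St: "I.ind_list = ?S" "I.ind_rep = ?T" by (simp_all add: t_def S_list_def S_rep_def)
    obtain \<iota> \<pi> where \<iota>: "graded_hom ?S ?T A \<Xi> \<iota>" and \<pi>: "graded_hom A \<Xi> ?S ?T \<pi>"
      and \<pi>\<iota>: "\<pi> * \<iota> = 1\<^sub>m (length ?S)" and E\<iota>: "E * \<iota> = \<iota>"
      using I.induced_retract[OF rep BC] EB Ec graded_homD(3)[OF Eh] unfolding St by metis
    note trep = S_rep_graded[OF t]
    have \<iota>c: "\<iota> \<in> carrier_mat ?n (length ?S)" and \<pi>c: "\<pi> \<in> carrier_mat (length ?S) ?n"
      using graded_homD(2)[OF \<iota>] graded_homD(2)[OF \<pi>] by auto
    have \<pi>E: "graded_hom A \<Xi> ?S ?T (\<pi> * E)" by (rule graded_hom_comp[OF rep rep trep Eh \<pi>])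
    have 1: "\<pi> * E * \<iota> = 1\<^sub>m (length ?S)" using assoc_mult_mat[OF \<pi>c Ec \<iota>c] E\<iota> \<pi>\<iota> by simp
    have 2: "\<pi> * E * J l = 0\<^sub>m (length ?S) (?l l)" if "l < ?r" for l
      using assoc_mult_mat[OF \<pi>c Ec Jc[OF that]] EJ[OF that] \<pi>c by simp
    have 3: "K l * \<iota> = 0\<^sub>m (?l l) (length ?S)" if "l < ?r" for l
      using assoc_mult_mat[OF Kc[OF that] Ec \<iota>c] E\<iota> KE[OF that] \<iota>c by simp
    have "orthogonal_summands A \<Xi> (ts @ [t]) (J(?r := \<iota>)) (K(?r := \<pi> * E))"
      unfolding orthogonal_summands_def
      using irr J K KJ t \<iota> \<pi>E 1 2 3 os
      by (auto simp: less_Suc_eq nth_append orthogonal_summands_def)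
    then have "P (Suc ?r)" unfolding P_def by (intro exI[of _ "ts @ [t]"]) auto
    then show False using max[of "Suc ?r"] len by simp
  qed
  have "Q = 1\<^sub>m ?n"
  proof (rule eq_matI)
    fix i j assume "i < dim_row (1\<^sub>m ?n)" "j < dim_col (1\<^sub>m ?n)"
    then show "Q $$ (i, j) = 1\<^sub>m ?n $$ (i, j)"
      using arg_cong[OF \<open>E = 0\<^sub>m ?n ?n\<close>, of "\<lambda>M. M $$ (i, j)"] Qc by (auto simp: E_def)
  qed (use Qc in auto)
  then show thesis using that[OF os] by (simp add: Q_def)
qed

lemma Comp_const:
  assumes "graded_rep A \<Xi>" "graded_rep B \<Omega>" "graded_rep D \<Theta>" "graded A B M" "graded B D N"
  shows "Comp FG (B, D, const N) (A, B, const M) = (A, D, const (N * M))"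
  using assms graded_repD(1) by (simp add: FG_simps Comp_F twist_mult_const)

lemma direct_sum_of_induced:
  assumes rep: "graded_rep A \<Xi>"
  obtains ts where "\<forall>t\<in>set ts. irr_datum t"
    "is_direct_sum FG (cobj A \<Xi>) (map (\<lambda>t. cobj (S_list t) (S_rep t)) ts)"
proof -
  let ?n = "length A"
  obtain ts J K where os: "orthogonal_summands A \<Xi> ts J K"
    and total: "wsum 1 ?n ?n {..<length ts} (\<lambda>k. J k * K k) = 1\<^sub>m ?n"
    using complete_orthogonal_summands[OF rep] .
  let ?r = "length ts" and ?S = "\<lambda>k. S_list (ts ! k)"
  let ?O = "map (\<lambda>t. cobj (S_list t) (S_rep t)) ts"
  have irr: "irr_datum (ts ! k)" and J: "graded_hom (?S k) (S_rep (ts ! k)) A \<Xi> (J k)"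
    and K: "graded_hom A \<Xi> (?S k) (S_rep (ts ! k)) (K k)" if "k < ?r" for k
    using os that by (auto simp: orthogonal_summands_def)
  have KJ: "K k * J l = (if k = l then 1\<^sub>m (length (?S k)) else 0\<^sub>m (length (?S k)) (length (?S l)))" if "k < ?r" "l < ?r" for k l
    using os that by (auto simp: orthogonal_summands_def)
  note Srep = S_rep_graded[OF irr]
  define \<iota> where "\<iota> k = (?S k, A, const (J k))" for k
  define \<pi> where "\<pi> k = (A, ?S k, const (K k))" for k
  have homs: "\<iota> k \<in> Hom FG (?O ! k) (cobj A \<Xi>) \<and> \<pi> k \<in> Hom FG (cobj A \<Xi>) (?O ! k)" if "k < ?r" for k
    using eq_hom_const[OF Srep[OF that] rep J[OF that]] eq_hom_const[OF rep Srep[OF that] K[OF that]] that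
    by (simp add: cobj_def Hom_FG \<iota>_def \<pi>_def)
  have orth: "Comp FG (\<pi> k) (\<iota> l) = (if k = l then Idn FG (?O ! k) else Zer FG (?O ! l) (?O ! k))"
    if k: "k < ?r" and l: "l < ?r" for k l
  proof -
    have "Comp FG (\<pi> k) (\<iota> l) = (?S l, ?S k, const (K k * J l))"
      using Comp_const[OF Srep[OF l] rep Srep[OF k] graded_homD(1)[OF J[OF l]] graded_homD(1)[OF K[OF k]]]
      by (simp add: \<iota>_def \<pi>_def)
    moreover have "const (1\<^sub>m m) = 1\<^sub>m m" "const (0\<^sub>m m m') = 0\<^sub>m m m'" for m m'
      by (auto intro!: eq_matI)
    ultimately show ?thesis using KJ[OF k l] k l by (simp add: cobj_def FG_simps)
  qed
  have JKc: "J k * K k \<in> carrier_mat ?n ?n" if "k < ?r" for k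
    using graded_homD(2)[OF J[OF that]] graded_homD(2)[OF K[OF that]] by auto
  have comp: "Comp FG (\<iota> k) (\<pi> k) = (A, A, const (J k * K k))" if "k < ?r" for k
    using Comp_const[OF rep Srep[OF that] rep graded_homD(1)[OF K[OF that]] graded_homD(1)[OF J[OF that]]]
    by (simp add: \<iota>_def \<pi>_def)
  have sum: "foldr (Add FG) (map (\<lambda>k. Comp FG (\<iota> k) (\<pi> k)) ks) (Zer FG (cobj A \<Xi>) (cobj A \<Xi>)) =
      (A, A, mat ?n ?n (\<lambda>ij. fps_const (\<Sum>k\<leftarrow>ks. (J k * K k) $$ ij)))" if "set ks \<subseteq> {..<?r}" for ks
    using that
  proof (induction ks)
    case Nil
    show ?case by (auto simp: cobj_def FG_simps)
  next
    case (Cons k ks)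
    then have k: "k < ?r" by simp
    have "const (J k * K k) + mat ?n ?n (\<lambda>ij. fps_const (\<Sum>k\<leftarrow>ks. (J k * K k) $$ ij)) =
        mat ?n ?n (\<lambda>ij. fps_const (\<Sum>k\<leftarrow>k # ks. (J k * K k) $$ ij))"
      using carrier_matD[OF graded_homD(2)[OF J[OF k]]] carrier_matD[OF graded_homD(2)[OF K[OF k]]]
      by (intro eq_matI) auto
    then show ?case using Cons comp[OF k] JKc[OF k] by (simp add: FG_simps Add_F)
  qed
  have "mat ?n ?n (\<lambda>ij. fps_const (\<Sum>k\<leftarrow>[0..<?r]. (J k * K k) $$ ij)) = 1\<^sub>m ?n"
  proof (rule eq_matI)
    fix i j assume ij: "i < dim_row (1\<^sub>m ?n :: complex fps mat)" "j < dim_col (1\<^sub>m ?n :: complex fps mat)"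
    have "(\<Sum>k\<leftarrow>[0..<?r]. (J k * K k) $$ (i, j)) = wsum 1 ?n ?n {..<?r} (\<lambda>k. J k * K k) $$ (i, j)"
      using ij by (simp add: wsum_def interv_sum_list_conv_sum_set_nat lessThan_atLeast0)
    then show "mat ?n ?n (\<lambda>ij. fps_const (\<Sum>k\<leftarrow>[0..<?r]. (J k * K k) $$ ij)) $$ (i, j) = 1\<^sub>m ?n $$ (i, j)"
      using ij by (simp add: total)
  qed auto
  then have "foldr (Add FG) (map (\<lambda>k. Comp FG (\<iota> k) (\<pi> k)) [0..<?r]) (Zer FG (cobj A \<Xi>) (cobj A \<Xi>)) = Idn FG (cobj A \<Xi>)"
    using sum[of "[0..<?r]"] by (simp add: cobj_def FG_simps lessThan_atLeast0)
  moreover have "set ?O \<subseteq> Ob FG" using os S_rep_graded cobj_in_FG by (auto simp: orthogonal_summands_def)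
  ultimately have "is_direct_sum FG (cobj A \<Xi>) ?O"
    unfolding is_direct_sum_def using cobj_in_FG[OF rep] homs orth
    by (intro conjI exI[of _ \<iota>] exI[of _ \<pi>]) auto
  then show thesis using that os by (auto simp: orthogonal_summands_def)
qed

section \<open>Isomorphism classes of induced objects\<close>

lemma conjugate_in_stab:
  assumes X: "X \<in> \<X>" and Y: "Y \<in> \<X>" and g: "g \<in> carrier G" and iso: "cp_iso c Y (\<phi> g X)" and h: "h \<in> stab X"
  shows "g \<otimes> h \<otimes> inv g \<in> stab Y"
proof -
  have hG: "h \<in> carrier G" "cp_iso c (\<phi> h X) X" using h by (auto simp: iso_stabilizer_def)
  let ?k = "g \<otimes> h \<otimes> inv g"
  have k: "?k \<in> carrier G" using hG g by simp
  have "cp_iso c (\<phi> ?k Y) (\<phi> ?k (\<phi> g X))" using iso k X Y g by simp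
  moreover have "\<phi> ?k (\<phi> g X) = \<phi> g (\<phi> h X)" using hG g X by (simp add: m_assoc flip: act_mult)
  moreover have "cp_iso c (\<phi> g (\<phi> h X)) (\<phi> g X)" using hG g X by simp
  moreover have "cp_iso c (\<phi> g X) Y" using iso cp_iso_sym X Y g by simp
  ultimately have "cp_iso c (\<phi> ?k Y) Y"
    using cp_iso_trans[of "\<phi> ?k Y" "\<phi> g (\<phi> h X)" "\<phi> g X"] cp_iso_trans[of "\<phi> ?k Y" "\<phi> g X" Y] k X Y g hG by simp
  then show ?thesis using k by (simp add: iso_stabilizer_def)
qed

lemma iso_translate_inv:
  assumes "X \<in> \<X>" "Y \<in> \<X>" "g \<in> carrier G" "cp_iso c Y (\<phi> g X)"
  shows "cp_iso c X (\<phi> (inv g) Y)"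
proof -
  have "cp_iso c (\<phi> (inv g) Y) (\<phi> (inv g) (\<phi> g X))" using assms by simp
  then have "cp_iso c (\<phi> (inv g) Y) X" using assms by (simp flip: act_mult)
  then show ?thesis using cp_iso_sym assms by simp
qed

lemma stab_conjugate:
  assumes X: "X \<in> \<X>" and Y: "Y \<in> \<X>" and g: "g \<in> carrier G" and iso: "cp_iso c Y (\<phi> g X)"
  shows "stab Y = (\<lambda>\<beta>. g \<otimes> \<beta> \<otimes> inv g) ` stab X"
proof
  show "(\<lambda>\<beta>. g \<otimes> \<beta> \<otimes> inv g) ` stab X \<subseteq> stab Y" using conjugate_in_stab[OF X Y g iso] by blast
  show "stab Y \<subseteq> (\<lambda>\<beta>. g \<otimes> \<beta> \<otimes> inv g) ` stab X"
  proof
    fix k assume k: "k \<in> stab Y"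
    then have kG: "k \<in> carrier G" using stab_subset by blast
    have "inv g \<otimes> k \<otimes> g \<in> stab X"
      using conjugate_in_stab[OF Y X inv_closed[OF g] iso_translate_inv[OF X Y g iso] k] g by simp
    moreover have "k = g \<otimes> (inv g \<otimes> k \<otimes> g) \<otimes> inv g" using kG g by (simp add: m_assoc flip: m_assoc[of g])
    ultimately show "k \<in> (\<lambda>\<beta>. g \<otimes> \<beta> \<otimes> inv g) ` stab X" by blast
  qed
qed

text \<open>
  The reduction \<open>C\<close> of an isomorphism embeds the fibre of \<open>S\<^sub>l X\<close> at \<open>X\<close> into the fibre of \<open>S\<^sub>m Y\<close> at \<open>X\<close>. The
  latter is therefore not zero, so \<open>X\<close> is isomorphic to a translate \<open>g\<^sup>-\<^sup>1 Y\<close>, and the action of \<open>g\<close> carries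
  it to the fibre of \<open>S\<^sub>m Y\<close> at \<open>Y\<close>, which is \<open>m\<close>. The same construction for the inverse of \<open>C\<close> inverts the
  resulting map \<open>P\<close>.
\<close>

lemma equivalent_if_isomorphic:
  assumes X: "X \<in> \<X>" and Y: "Y \<in> \<X>"
    and l: "irreducible_representation G (stab X) d l" and m: "irreducible_representation G (stab Y) e m"
    and iso: "isomorphic FG (S_obj G \<phi> c (\<sigma> X) X d l) (S_obj G \<phi> c (\<sigma> Y) Y e m)"
  obtains g where "g \<in> carrier G" "cp_iso c Y (\<phi> g X)"
    "equivalent_representations (stab X) d l e (\<lambda>\<beta>. m (g \<otimes> \<beta> \<otimes> inv g))"
proof -
  interpret SX: induced \<X> c G \<phi> X "\<sigma> X" d l by (rule induced_if_irreducible[OF X l])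
  interpret SY: induced \<X> c G \<phi> Y "\<sigma> Y" e m by (rule induced_if_irreducible[OF Y m])
  let ?A = SX.ind_list and ?\<Xi> = SX.ind_rep and ?B = SY.ind_list and ?\<Omega> = SY.ind_rep
  note RX = graded_repD[OF SX.graded_rep_ind] and RY = graded_repD[OF SY.graded_rep_ind]
  obtain M N where M: "eq_hom ?A (\<lambda>g. const (?\<Xi> g)) ?B (\<lambda>g. const (?\<Omega> g)) M"
    and N: "eq_hom ?B (\<lambda>g. const (?\<Omega> g)) ?A (\<lambda>g. const (?\<Xi> g)) N"
    and NM: "twist_mult c ?A ?B ?A N M = 1\<^sub>m (length ?A)" and MN: "twist_mult c ?B ?A ?B M N = 1\<^sub>m (length ?B)"
    using iso unfolding SX.S_obj_eq SY.S_obj_eq cobj_def isomorphic_def isomorphism_def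
    by (auto simp: Hom_FG FG_simps Comp_F)
  define C where "C = red ?A ?B M"
  define C' where "C' = red ?B ?A N"
  have Ch: "graded_hom ?A ?\<Xi> ?B ?\<Omega> C"
    unfolding C_def by (rule graded_hom_red[OF SX.graded_rep_ind SY.graded_rep_ind M])
  have C'h: "graded_hom ?B ?\<Omega> ?A ?\<Xi> C'"
    unfolding C'_def by (rule graded_hom_red[OF SY.graded_rep_ind SX.graded_rep_ind N])
  have C'C: "C' * C = 1\<^sub>m (length ?A)" and CC': "C * C' = 1\<^sub>m (length ?B)"
    using red_twist_mult[OF RX(1) RY(1) RX(1), of N M] red_twist_mult[OF RY(1) RX(1) RY(1), of M N]
    unfolding C_def C'_def NM MN red_one[OF RX(1)] red_one[OF RY(1)] by simp_all
  note [simp] = carrier_matD[OF graded_homD(2)[OF Ch]] carrier_matD[OF graded_homD(2)[OF C'h]]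
    carrier_matD[OF SX.incl_carrier] carrier_matD[OF SY.incl_carrier]
    carrier_matD[OF SX.proj_carrier] carrier_matD[OF SY.proj_carrier]
    carrier_matD[OF SX.ind_rep_carrier] carrier_matD[OF SY.ind_rep_carrier]
  let ?iX = "SX.incl \<one>" and ?iY = "SY.incl \<one>" and ?pX = "SX.proj \<one>" and ?pY = "SY.proj \<one>"
  have CiX: "graded (replicate d X) ?B (C * ?iX)"
    using graded_mult[OF _ RX(1) RY(1) SX.graded_incl graded_homD(1)[OF Ch]] X by simp
  have C'Ci: "C' * (C * Z) = Z" if "Z \<in> carrier_mat (length ?A) a" for Z a
    using assoc_mult_mat[OF graded_homD(2)[OF C'h] graded_homD(2)[OF Ch] that] C'C that by simp
  have CC'i: "C * (C' * Z) = Z" if "Z \<in> carrier_mat (length ?B) a" for Z a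
    using assoc_mult_mat[OF graded_homD(2)[OF Ch] graded_homD(2)[OF C'h] that] CC' that by simp
  have "\<exists>k a. k < length ?B \<and> a < d \<and> (C * ?iX) $$ (k, a) \<noteq> 0"
  proof (rule ccontr)
    assume "\<not> ?thesis"
    then have "C * ?iX = 0\<^sub>m (length ?B) d" by (intro eq_matI) auto
    then have "?iX = 0\<^sub>m (length ?A) d" using C'Ci[of ?iX d] right_mult_zero_mat[OF graded_homD(2)[OF C'h], of d] by simp
    then have "1\<^sub>m d = (0\<^sub>m d d :: complex mat)" using SX.proj_incl right_mult_zero_mat[OF SX.proj_carrier[of \<one>]] by simp
    from arg_cong[OF this, of "\<lambda>Z. Z $$ (0, 0)"] show False using SX.d_pos by simp
  qed
  then obtain k a where k: "k < length ?B" and a: "a < d" and nz: "(C * ?iX) $$ (k, a) \<noteq> 0" by blast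
  let ?\<tau> = "\<sigma> Y ! (k div e)"
  have \<tau>: "?\<tau> \<in> carrier G" using k block_index_less[of k "length (\<sigma> Y)" e] by simp
  have "cp_iso c X (\<phi> ?\<tau> Y)" using gradedE[OF CiX k, of a] nz a k by (auto simp: SY.nth_ind_list)
  then have YgX: "cp_iso c Y (\<phi> (inv ?\<tau>) X)" by (rule iso_translate_inv[OF Y X \<tau>])
  define g where "g = inv ?\<tau>"
  have g: "g \<in> carrier G" and iso: "cp_iso c Y (\<phi> g X)" using \<tau> YgX by (simp_all add: g_def)
  have iso': "cp_iso c X (\<phi> (inv g) Y)" by (rule iso_translate_inv[OF X Y g iso])
  note cancel = graded_rep_cancel[OF SY.graded_rep_ind g]
  define P where "P = ?pY * (?\<Omega> g * (C * ?iX))"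
  define P' where "P' = ?pX * (C' * (?\<Omega> (inv g) * ?iY))"
  have Pc: "P \<in> carrier_mat e d" and P'c: "P' \<in> carrier_mat d e" by (auto simp: P_def P'_def)
  have "graded (replicate d Y) ?B (?\<Omega> g * (C * ?iX))"
    using graded_rep_mult(1)[OF SY.graded_rep_ind g X CiX] graded_replicate_iso(1)[OF Y _ iso RY(1)] X g by simp
  from SY.incl_proj_mult[OF this] have iP: "?iY * P = ?\<Omega> g * (C * ?iX)" by (simp add: P_def)
  have "graded (replicate e X) ?B (?\<Omega> (inv g) * ?iY)"
    using graded_rep_mult(1)[OF SY.graded_rep_ind inv_closed[OF g] Y SY.graded_incl]
      graded_replicate_iso(1)[OF X _ iso' RY(1)] Y g by simp
  then have "graded (replicate e X) ?A (C' * (?\<Omega> (inv g) * ?iY))"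
    using graded_mult[OF _ RY(1) RX(1) _ graded_homD(1)[OF C'h]] X by simp
  from SX.incl_proj_mult[OF this] have iP': "?iX * P' = C' * (?\<Omega> (inv g) * ?iY)" by (simp add: P'_def)
  have P'P: "P' * P = 1\<^sub>m d"
  proof -
    have "P' * P = ?pX * (C' * (?\<Omega> (inv g) * (?iY * P)))"
      using carrier_matD[OF Pc] by (simp add: P'_def mat_assoc)
    also have "\<dots> = ?pX * ?iX" unfolding iP using cancel(2)[of "C * ?iX" d] C'Ci[of ?iX d] by (simp add: carrier_matI)
    finally show ?thesis by (simp add: SX.proj_incl)
  qed
  have PP': "P * P' = 1\<^sub>m e"
  proof -
    have "P * P' = ?pY * (?\<Omega> g * (C * (?iX * P')))"
      using carrier_matD[OF P'c] by (simp add: P_def mat_assoc)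
    also have "\<dots> = ?pY * ?iY" unfolding iP' using cancel(1)[of ?iY e] CC'i[of "?\<Omega> (inv g) * ?iY" e] by (simp add: carrier_matI)
    finally show ?thesis by (simp add: SY.proj_incl)
  qed
  have de: "d = e" using left_inverse_le_dim[OF Pc P'c P'P] left_inverse_le_dim[OF P'c Pc PP'] by simp
  have "P \<in> carrier (GL d)"
    using Pc P'c P'P PP' de by (auto simp: units_of_def Units_def ring_mat_simps)
  moreover have "P * l h = m (g \<otimes> h \<otimes> inv g) * P" if h: "h \<in> stab X" for h
  proof -
    let ?k = "g \<otimes> h \<otimes> inv g"
    have hG: "h \<in> carrier G" using h stab_subset by blast
    have kY: "?k \<in> stab Y" by (rule conjugate_in_stab[OF X Y g iso h])
    note [simp] = carrier_matD[OF SX.\<rho>_carrier[OF h]] carrier_matD[OF SY.\<rho>_carrier[OF kY]]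
    have "P * l h = ?pY * (?\<Omega> g * (C * (?iX * l h)))" by (simp add: P_def mat_assoc)
    also have "?iX * l h = ?\<Xi> h * ?iX" using SX.incl_mult[OF h] SX.ind_rep_incl[OF hG one_closed] hG by simp
    also have "C * (?\<Xi> h * ?iX) = (C * ?\<Xi> h) * ?iX" by (simp add: mat_assoc)
    also have "C * ?\<Xi> h = ?\<Omega> h * C" by (rule graded_homD(3)[OF Ch hG])
    also have "?\<Omega> g * (?\<Omega> h * C * ?iX) = (?\<Omega> g * ?\<Omega> h) * (C * ?iX)" by (simp add: mat_assoc)
    also have "?\<Omega> g * ?\<Omega> h = ?\<Omega> (?k \<otimes> g)" using RY(4)[OF g hG] hG g by (simp add: m_assoc)
    also have "\<dots> = ?\<Omega> ?k * ?\<Omega> g" using RY(4)[of ?k g] hG g by simp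
    also have "?pY * (?\<Omega> ?k * ?\<Omega> g * (C * ?iX)) = (?pY * ?\<Omega> ?k) * (?\<Omega> g * (C * ?iX))" by (simp add: mat_assoc)
    also have "?pY * ?\<Omega> ?k = m ?k * ?pY" using SY.proj_ind_rep[of ?k \<one>] SY.mult_proj[OF kY] hG g by simp
    finally show ?thesis by (simp add: P_def mat_assoc)
  qed
  ultimately show thesis using that[OF g iso] de unfolding equivalent_representations_def by blast
qed

text \<open>
  The intertwiner \<open>P\<close> embeds \<open>l\<close> into the fibre of \<open>S\<^sub>m Y\<close> at \<open>g\<^sup>-\<^sup>1 Y\<close>, which is isomorphic to \<open>X\<close>. So \<open>S\<^sub>l X\<close> is a
  retract of \<open>S\<^sub>m Y\<close>, and the endomorphism \<open>\<iota> \<pi>\<close> of \<open>S\<^sub>m Y\<close> is a scalar; this avoids comparing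
  the numbers of cosets.
\<close>

lemma isomorphic_if_equivalent:
  assumes X: "X \<in> \<X>" and Y: "Y \<in> \<X>"
    and l: "irreducible_representation G (stab X) d l" and m: "irreducible_representation G (stab Y) e m"
    and g: "g \<in> carrier G" and iso: "cp_iso c Y (\<phi> g X)"
    and equiv: "equivalent_representations (stab X) d l e (\<lambda>\<beta>. m (g \<otimes> \<beta> \<otimes> inv g))"
  shows "isomorphic FG (S_obj G \<phi> c (\<sigma> X) X d l) (S_obj G \<phi> c (\<sigma> Y) Y e m)"
proof -
  have de: "e = d" using equiv by (simp add: equivalent_representations_def)
  note m = m[unfolded de]
  interpret SX: induced \<X> c G \<phi> X "\<sigma> X" d l by (rule induced_if_irreducible[OF X l])
  interpret SY: induced \<X> c G \<phi> Y "\<sigma> Y" d m by (rule induced_if_irreducible[OF Y m])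
  let ?A = SX.ind_list and ?\<Xi> = SX.ind_rep and ?B = SY.ind_list and ?\<Omega> = SY.ind_rep
  note RX = graded_repD[OF SX.graded_rep_ind] and RY = graded_repD[OF SY.graded_rep_ind]
  obtain P where "P \<in> carrier (GL d)" and comm: "\<And>h. h \<in> stab X \<Longrightarrow> P * l h = m (g \<otimes> h \<otimes> inv g) * P"
    using equiv unfolding equivalent_representations_def by blast
  then obtain Q where P: "P \<in> carrier_mat d d" and Q: "Q \<in> carrier_mat d d" and QP: "Q * P = 1\<^sub>m d" and PQ: "P * Q = 1\<^sub>m d"
    by (auto simp: units_of_def Units_def ring_mat_simps)
  let ?iY = "SY.incl \<one>" and ?pY = "SY.proj \<one>"
  note [simp] = carrier_matD[OF P] carrier_matD[OF Q]
    carrier_matD[OF SY.incl_carrier] carrier_matD[OF SY.proj_carrier]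
    carrier_matD[OF SY.ind_rep_carrier]
  define B where "B = ?\<Omega> (inv g) * (?iY * P)"
  define C where "C = Q * (?pY * ?\<Omega> g)"
  have iso': "cp_iso c X (\<phi> (inv g) Y)" by (rule iso_translate_inv[OF X Y g iso])
  have "graded (replicate d Y) ?B (?iY * P)"
    using graded_mult[OF _ _ RY(1) graded_square[OF Y P] SY.graded_incl] Y by simp
  then have B: "graded (replicate d X) ?B B"
    using graded_rep_mult(1)[OF SY.graded_rep_ind inv_closed[OF g] Y] graded_replicate_iso(1)[OF X _ iso' RY(1)] Y g
    by (simp add: B_def)
  have "graded ?B (replicate d X) (?pY * ?\<Omega> g)"
    using graded_rep_mult(2)[OF SY.graded_rep_ind g Y SY.graded_proj] graded_replicate_iso(2)[OF X _ iso' RY(1)] Y g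
    by simp
  then have C: "graded ?B (replicate d X) C"
    using graded_mult[OF RY(1) _ _ _ graded_square[OF X Q]] X by (simp add: C_def)
  have CB: "C * B = 1\<^sub>m d"
  proof -
    have "C * B = Q * (?pY * ((?\<Omega> g * ?\<Omega> (inv g)) * (?iY * P)))" by (simp add: B_def C_def mat_assoc)
    also have "?\<Omega> g * ?\<Omega> (inv g) = 1\<^sub>m (length ?B)" using RY(4)[of g "inv g"] RY(5) g by simp
    also have "\<dots> * (?iY * P) = ?iY * P" by (rule left_mult_one_mat[of _ _ d]) (simp add: carrier_matI)
    also have "?pY * (?iY * P) = (?pY * ?iY) * P" by (simp add: mat_assoc)
    also have "\<dots> = P" using SY.proj_incl P by simp
    finally show ?thesis using QP by simp
  qed
  have conj: "g \<otimes> h \<otimes> inv g \<in> stab Y" if "h \<in> stab X" for h by (rule conjugate_in_stab[OF X Y g iso that])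
  have HG: "h \<in> carrier G" if "h \<in> stab X" for h using that stab_subset by blast
  have Bh: "?\<Omega> h * B = B * l h" if h: "h \<in> stab X" for h
  proof -
    let ?k = "g \<otimes> h \<otimes> inv g"
    note [simp] = carrier_matD[OF SX.\<rho>_carrier[OF h]] carrier_matD[OF SY.\<rho>_carrier[OF conj[OF h]]]
    have "?\<Omega> h * B = (?\<Omega> h * ?\<Omega> (inv g)) * (?iY * P)" by (simp add: B_def mat_assoc)
    also have "?\<Omega> h * ?\<Omega> (inv g) = ?\<Omega> (inv g \<otimes> ?k)"
      using RY(4)[of h "inv g"] HG[OF h] g by (simp flip: m_assoc)
    also have "\<dots> = ?\<Omega> (inv g) * ?\<Omega> ?k" using RY(4)[of "inv g" ?k] HG[OF h] g by simp
    also have "\<dots> * (?iY * P) = ?\<Omega> (inv g) * ((?\<Omega> ?k * ?iY) * P)" by (simp add: mat_assoc)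
    also have "?\<Omega> ?k * ?iY = ?iY * m ?k"
      using SY.incl_mult[OF conj[OF h]] SY.ind_rep_incl[of ?k \<one>] HG[OF h] g by simp
    also have "?iY * m ?k * P = ?iY * (P * l h)" using comm[OF h] by (simp add: mat_assoc)
    finally show ?thesis by (simp add: B_def mat_assoc)
  qed
  have Ch: "C * ?\<Omega> h = l h * C" if h: "h \<in> stab X" for h
  proof -
    let ?k = "g \<otimes> h \<otimes> inv g"
    have lc: "l h \<in> carrier_mat d d" using SX.\<rho>_carrier[OF h] .
    have mc: "m ?k \<in> carrier_mat d d" using SY.\<rho>_carrier[OF conj[OF h]] .
    note [simp] = carrier_matD[OF lc] carrier_matD[OF mc]
    have "C * ?\<Omega> h = Q * (?pY * (?\<Omega> g * ?\<Omega> h))" by (simp add: C_def mat_assoc)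
    also have "?\<Omega> g * ?\<Omega> h = ?\<Omega> (?k \<otimes> g)" using RY(4)[OF g HG[OF h]] HG[OF h] g by (simp add: m_assoc)
    also have "\<dots> = ?\<Omega> ?k * ?\<Omega> g" using RY(4)[of ?k g] HG[OF h] g by simp
    also have "?pY * (?\<Omega> ?k * ?\<Omega> g) = (?pY * ?\<Omega> ?k) * ?\<Omega> g" by (simp add: mat_assoc)
    also have "?pY * ?\<Omega> ?k = m ?k * ?pY" using SY.proj_ind_rep[of ?k \<one>] SY.mult_proj[OF conj[OF h]] HG[OF h] g by simp
    also have "Q * (m ?k * ?pY * ?\<Omega> g) = (Q * m ?k) * (?pY * ?\<Omega> g)" by (simp add: mat_assoc)
    also have "Q * m ?k = l h * Q"
    proof -
      have "Q * m ?k = Q * (m ?k * (P * Q))" using PQ mc by simp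
      also have "\<dots> = Q * ((m ?k * P) * Q)" by (simp add: mat_assoc)
      also have "\<dots> = (Q * P) * (l h * Q)" unfolding comm[OF h, symmetric] by (simp add: mat_assoc)
      finally show ?thesis using QP lc Q by simp
    qed
    finally show ?thesis by (simp add: C_def mat_assoc)
  qed
  obtain \<iota> \<pi> where \<iota>: "graded_hom ?A ?\<Xi> ?B ?\<Omega> \<iota>" and \<pi>: "graded_hom ?B ?\<Omega> ?A ?\<Xi> \<pi>" and \<pi>\<iota>: "\<pi> * \<iota> = 1\<^sub>m (length ?A)"
    using SX.induced_retract[OF SY.graded_rep_ind B C Bh Ch CB] by metis
  have \<iota>c: "\<iota> \<in> carrier_mat (length ?B) (length ?A)" and \<pi>c: "\<pi> \<in> carrier_mat (length ?A) (length ?B)"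
    using graded_homD(2)[OF \<iota>] graded_homD(2)[OF \<pi>] .
  obtain k where k: "\<iota> * \<pi> = k \<cdot>\<^sub>m 1\<^sub>m (length ?B)"
    using SY.end_scalar[OF m graded_hom_comp[OF SY.graded_rep_ind SX.graded_rep_ind SY.graded_rep_ind \<pi> \<iota>]] by blast
  \<comment> \<open>the scalar is \<open>1\<close>, as \<open>\<iota> = \<iota> (\<pi> \<iota>) = (\<iota> \<pi>) \<iota>\<close> is not zero\<close>
  have "\<iota> = (\<iota> * \<pi>) * \<iota>" using assoc_mult_mat[OF \<iota>c \<pi>c \<iota>c] \<pi>\<iota> \<iota>c by simp
  also have "\<dots> = k \<cdot>\<^sub>m \<iota>" unfolding k using mult_smult_assoc_mat[OF one_carrier_mat \<iota>c, of k] \<iota>c by simp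
  finally have k\<iota>: "\<iota> = k \<cdot>\<^sub>m \<iota>" .
  have "k = 1"
  proof (rule ccontr)
    assume "k \<noteq> 1"
    have "\<iota> = 0\<^sub>m (length ?B) (length ?A)"
    proof (rule eq_matI)
      fix i j assume "i < dim_row (0\<^sub>m (length ?B) (length ?A))" "j < dim_col (0\<^sub>m (length ?B) (length ?A))"
      then show "\<iota> $$ (i, j) = 0\<^sub>m (length ?B) (length ?A) $$ (i, j)"
        using arg_cong[OF k\<iota>, of "\<lambda>Z. Z $$ (i, j)"] \<open>k \<noteq> 1\<close> \<iota>c by simp
    qed (use \<iota>c in auto)
    then have "1\<^sub>m (length ?A) = (0\<^sub>m (length ?A) (length ?A) :: complex mat)" using \<pi>\<iota> \<pi>c by simp
    moreover have "0 < length (\<sigma> X) * d"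
      using SX.ind_list_nonempty SX.length_ind_list by (metis length_greater_0_conv)
    ultimately show False using arg_cong[of _ _ "\<lambda>Z. Z $$ (0, 0)"] SX.length_ind_list
      by (metis index_one_mat(1) index_zero_mat(1) zero_neq_one)
  qed
  then have \<iota>\<pi>: "\<iota> * \<pi> = 1\<^sub>m (length ?B)" using k by (auto intro!: eq_matI)
  have const_one: "const (1\<^sub>m n) = 1\<^sub>m n" for n by (auto intro!: eq_matI)
  have "isomorphism FG (obj ?A (\<lambda>g. const (?\<Xi> g))) (obj ?B (\<lambda>g. const (?\<Omega> g))) (?A, ?B, const \<iota>)"
  proof (rule isomorphismI[OF equivariant_const[OF SX.graded_rep_ind] equivariant_const[OF SY.graded_rep_ind]
        eq_hom_const[OF SX.graded_rep_ind SY.graded_rep_ind \<iota>]])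
    show "const \<pi> \<in> carrier_mat (length ?A) (length ?B)" using \<pi>c by simp
    show "twist_mult c ?A ?B ?A (const \<pi>) (const \<iota>) = 1\<^sub>m (length ?A)"
      using twist_mult_const[OF RX(1) RY(1) RX(1) graded_homD(1)[OF \<iota>] graded_homD(1)[OF \<pi>]] \<pi>\<iota> const_one by simp
    show "twist_mult c ?B ?A ?B (const \<iota>) (const \<pi>) = 1\<^sub>m (length ?B)"
      using twist_mult_const[OF RY(1) RX(1) RY(1) graded_homD(1)[OF \<pi>] graded_homD(1)[OF \<iota>]] \<iota>\<pi> const_one by simp
  qed
  then show ?thesis unfolding de SX.S_obj_eq SY.S_obj_eq cobj_def isomorphic_def by blast
qed

end

theorem theorem4p0p4:
  fixes G :: "'g monoid" and \<X> \<X>\<^sub>0 :: "'x set" and c :: "'x \<Rightarrow> 'x \<Rightarrow> 'x \<Rightarrow> nat"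
    and \<phi> :: "'g \<Rightarrow> 'x \<Rightarrow> 'x" and \<sigma> :: "'x \<Rightarrow> 'g list"
  assumes "frobenius_cyclic_poset \<X> c \<X>\<^sub>0"
    and "finite (carrier G)"
    and "cyclic_poset_action G \<phi> \<X> c \<X>\<^sub>0"
    and "\<And>X. X \<in> \<X> \<Longrightarrow> left_transversal G (iso_stabilizer G \<phi> c X) (\<sigma> X)"
  shows
    "(\<forall>X\<in>\<X>. \<forall>d \<rho>. irreducible_representation G (iso_stabilizer G \<phi> c X) d \<rho> \<longrightarrow>
        strongly_indecomposable (\<F>G G \<phi> \<X> c) (S_obj G \<phi> c (\<sigma> X) X d \<rho>)) \<and>
     (\<forall>A\<in>Ob (\<F>G G \<phi> \<X> c).
        \<exists>ts. (\<forall>(X, d, \<rho>)\<in>set ts. X \<in> \<X> \<and>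
            irreducible_representation G (iso_stabilizer G \<phi> c X) d \<rho>) \<and>
          (\<exists>D. is_direct_sum (\<F>G G \<phi> \<X> c) D (map (\<lambda>(X, d, \<rho>). S_obj G \<phi> c (\<sigma> X) X d \<rho>) ts) \<and>
            isomorphic (\<F>G G \<phi> \<X> c) A D)) \<and>
     (\<forall>X\<in>\<X>. \<forall>Y\<in>\<X>. \<forall>\<gamma>\<in>carrier G. cp_iso c Y (\<phi> \<gamma> X) \<longrightarrow>
        iso_stabilizer G \<phi> c Y = (\<lambda>\<beta>. \<gamma> \<otimes>\<^bsub>G\<^esub> \<beta> \<otimes>\<^bsub>G\<^esub> inv\<^bsub>G\<^esub> \<gamma>) ` iso_stabilizer G \<phi> c X) \<and>
     (\<forall>X\<in>\<X>. \<forall>Y\<in>\<X>. \<forall>d l e m.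
        irreducible_representation G (iso_stabilizer G \<phi> c X) d l \<and>
        irreducible_representation G (iso_stabilizer G \<phi> c Y) e m \<longrightarrow>
        (isomorphic (\<F>G G \<phi> \<X> c) (S_obj G \<phi> c (\<sigma> X) X d l) (S_obj G \<phi> c (\<sigma> Y) Y e m) \<longleftrightarrow>
          (\<exists>\<gamma>\<in>carrier G. cp_iso c Y (\<phi> \<gamma> X) \<and>
             equivalent_representations (iso_stabilizer G \<phi> c X) d l e
               (\<lambda>\<beta>. m (\<gamma> \<otimes>\<^bsub>G\<^esub> \<beta> \<otimes>\<^bsub>G\<^esub> inv\<^bsub>G\<^esub> \<gamma>)))))"
proof -
  have action: "group_action G \<X> \<phi>" using assms(3) by (simp add: cyclic_poset_action_def)
  then have "group G" by (simp add: group_action_def group_hom_def)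
  then interpret cyc_poset_transversals \<X> c G \<phi> \<sigma>
    using assms action
    by (intro cyc_poset_transversals.intro cyc_poset_action.intro cyc_poset.intro
        cyc_poset_transversals_axioms.intro cyc_poset_action_axioms.intro)
      (auto simp: frobenius_cyclic_poset_def cyclic_poset_action_def)
  have "strongly_indecomposable FG (S_obj G \<phi> c (\<sigma> X) X d \<rho>)"
    if "X \<in> \<X>" "irreducible_representation G (stab X) d \<rho>" for X d \<rho>
    using induced.strongly_indecomposable_ind[OF induced_if_irreducible[OF that] that(2)]
      induced.S_obj_eq[OF induced_if_irreducible[OF that]] by simp
  moreover have "\<exists>ts. (\<forall>(X, d, \<rho>)\<in>set ts. X \<in> \<X> \<and> irreducible_representation G (stab X) d \<rho>) \<and>
      (\<exists>D. is_direct_sum FG D (map (\<lambda>(X, d, \<rho>). S_obj G \<phi> c (\<sigma> X) X d \<rho>) ts) \<and> isomorphic FG P D)"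
    if "P \<in> Ob FG" for P
  proof -
    obtain A m where m: "equivariant A m" and P: "P = obj A m" using Ob_FG_obtain[OF \<open>P \<in> Ob FG\<close>] .
    let ?\<Xi> = "\<lambda>\<gamma>. red (\<gamma> \<cdot> A) A (m \<gamma>)"
    obtain ts where ts: "\<forall>t\<in>set ts. irr_datum t"
      and sum: "is_direct_sum FG (cobj A ?\<Xi>) (map (\<lambda>t. cobj (S_list t) (S_rep t)) ts)"
      using direct_sum_of_induced[OF graded_rep_red[OF m]] .
    have "map (\<lambda>(X, d, \<rho>). S_obj G \<phi> c (\<sigma> X) X d \<rho>) ts = map (\<lambda>t. cobj (S_list t) (S_rep t)) ts"
      using ts S_obj_cobj by (auto intro!: map_cong)
    then have "is_direct_sum FG (cobj A ?\<Xi>) (map (\<lambda>(X, d, \<rho>). S_obj G \<phi> c (\<sigma> X) X d \<rho>) ts)"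
      using sum by (rule ssubst)
    moreover have "\<forall>(X, d, \<rho>)\<in>set ts. X \<in> \<X> \<and> irreducible_representation G (stab X) d \<rho>"
      using ts by (simp add: irr_datum_def)
    ultimately show ?thesis using isomorphic_const_red[OF m] unfolding P by blast
  qed
  moreover have "isomorphic FG (S_obj G \<phi> c (\<sigma> X) X d l) (S_obj G \<phi> c (\<sigma> Y) Y e m) \<longleftrightarrow>
      (\<exists>\<gamma>\<in>carrier G. cp_iso c Y (\<phi> \<gamma> X) \<and>
        equivalent_representations (stab X) d l e (\<lambda>\<beta>. m (\<gamma> \<otimes>\<^bsub>G\<^esub> \<beta> \<otimes>\<^bsub>G\<^esub> inv\<^bsub>G\<^esub> \<gamma>)))"
    if "X \<in> \<X>" "Y \<in> \<X>" "irreducible_representation G (stab X) d l" "irreducible_representation G (stab Y) e m"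
    for X Y d l e m
    using equivalent_if_isomorphic[OF that] isomorphic_if_equivalent[OF that] by metis
  ultimately show ?thesis using stab_conjugate by blast
qed

end
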